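(* Let $r\ge3$ and $\Pi(2)(X)=\prod_{a\in A\text{ monic},\ \deg a=2}S_a(X)\in\mathcal{O}'[X]$. Then $$o(\Pi(2)-1)=(q-1)q(q^{2(r-1)}-q^{r-1})=(q-1)(q^{2r-1}-q^r).$$
   Context: $\mathbb{F}=\mathbb{F}_q$, $A=\mathbb{F}[T]$, $K_\infty=\mathbb{F}((T^{-1}))$, $C_\infty$ the completed algebraic closure of $K_\infty$. $\Omega^{r-1}=\{(\omega_2,\dots,\omega_r)\in C_\infty^{r-1}: K_\infty\text{-linearly independent},\ \omega_r=1\}$, $\mathcal{O}'$ = ring of holomorphic functions on it. For $\boldsymbol\omega'\in\Omega^{r-1}$, $\Lambda'=\sum_{i=2}^rA\omega_i$, $e^{\Lambda'}(z)=z\prod_{0\ne\lambda\in\Lambda'}(1-z/\lambda)$, and $\phi'$ the Drinfeld module with $\phi'_a(e^{\Lambda'}(z))=e^{\Lambda'}(az)$; $\phi'_T(X)=TX+g'_1X^q+\dots+g'_{r-1}X^{q^{r-1}}$, $\Delta'=g'_{r-1}$. For $a\in A$ monic of degree $d\ge1$, $\phi'_a(X)=aX+\dots+\Delta'_{(d)}X^{q^{(r-1)d}}$ with $\Delta'_{(d)}=\Delta'^{(q^{(r-1)d}-1)/(q^{r-1}-1)}$, and $S_a(X)=\Delta'^{-1}_{(d)}X^{q^{(r-1)d}}\phi'_a(X^{-1})\in\mathcal{O}'[X]$. For a polynomial or power series $P=\sum c_nX^n$, $o(P)=\min\{n:c_n\ne0\}$. *)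

theory Defs
  imports
    "HOL-Library.Extended_Nat"
    "HOL-Library.FuncSet"
    "HOL-Library.Cardinality"
    "HOL-Computational_Algebra.Polynomial"
    "HOL-Computational_Algebra.Formal_Laurent_Series"
    "HOL-Algebra.UnivPoly"
begin

text \<open>
  The finite field is a type \<open>'f\<close> of sort \<open>{field, finite}\<close>, with \<open>q = CARD('f)\<close>; the ring
  \<open>A\<close> is \<open>'f poly\<close>, and \<open>K\<^sub>\<infinity>\<close> is \<open>'f fls\<close>, whose indeterminate \<^const>\<open>fls_X\<close> stands for
  \<open>T\<^sup>-\<^sup>1\<close>, so that \<open>T\<close> is \<^const>\<open>fls_X_inv\<close>.
\<close>

definition abs_Kinf :: "'f::{field,finite} fls \<Rightarrow> real" where
  "abs_Kinf x = (if x = 0 then 0 else real CARD('f) powi (- fls_subdegree x))"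

definition A_to_Kinf :: "'f::{field,finite} poly \<Rightarrow> 'f fls" where
  "A_to_Kinf a = poly (map_poly fls_const a) fls_X_inv"

definition algebraic_over_Kinf :: "('f::{field,finite} fls \<Rightarrow> 'c::field) \<Rightarrow> 'c set" where
  "algebraic_over_Kinf \<iota> = {x. \<exists>p. p \<noteq> 0 \<and> poly (map_poly \<iota> p) x = 0}"

text \<open>
  \<open>completed_alg_closure \<iota>\<close>: the field \<open>'c\<close>, with absolute value \<open>x \<mapsto> dist x 0\<close> and the
  embedding \<open>\<iota>\<close>, is the completion of an algebraic closure of \<open>K\<^sub>\<infinity>\<close>. Completeness is part of
  the sort of \<open>'c\<close>; the elements algebraic over \<open>K\<^sub>\<infinity>\<close> are the algebraic closure that is being
  completed.
\<close>

locale completed_alg_closure =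
  fixes \<iota> :: "'f::{field,finite} fls \<Rightarrow> 'c::{field,complete_space}"
  assumes emb_one: "\<iota> 1 = 1"
    and emb_add: "\<iota> (x + y) = \<iota> x + \<iota> y"
    and emb_mult: "\<iota> (x * y) = \<iota> x * \<iota> y"
    and dist_translate: "dist (u + w) (v + w) = dist u v"
    and abs_mult: "dist (u * v) 0 = dist u 0 * dist v 0"
    and abs_ultrametric: "dist (u + v) 0 \<le> max (dist u 0) (dist v 0)"
    and abs_emb: "dist (\<iota> x) 0 = abs_Kinf x"
    and algebraically_closed:
      "\<lbrakk>0 < degree P; \<forall>n. Polynomial.coeff P n \<in> algebraic_over_Kinf \<iota>\<rbrakk>
        \<Longrightarrow> \<exists>x\<in>algebraic_over_Kinf \<iota>. poly P x = 0"
    and algebraic_dense: "0 < \<epsilon> \<Longrightarrow> \<exists>x\<in>algebraic_over_Kinf \<iota>. dist x u < \<epsilon>"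

definition A_emb :: "('f::{field,finite} fls \<Rightarrow> 'c) \<Rightarrow> 'f poly \<Rightarrow> 'c" where
  "A_emb \<iota> a = \<iota> (A_to_Kinf a)"

text \<open>
  The space \<open>\<Omega>\<^bsup>r-1\<^esup>\<close>: a point \<open>(\<omega>\<^sub>2,\<dots>,\<omega>\<^sub>r)\<close> is a function on \<open>{2..r}\<close>, extended by
  \<^const>\<open>undefined\<close>.
\<close>

definition Omega :: "('f::{field,finite} fls \<Rightarrow> 'c::field) \<Rightarrow> nat \<Rightarrow> (nat \<Rightarrow> 'c) set" where
  "Omega \<iota> r = {\<omega> \<in> extensional {2..r}. \<omega> r = 1 \<and>
     (\<forall>c. (\<Sum>i=2..r. \<iota> (c i) * \<omega> i) = 0 \<longrightarrow> (\<forall>i\<in>{2..r}. c i = 0))}"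

text \<open>
  The standard exhaustion of \<open>\<Omega>\<^bsup>r-1\<^esup>\<close> by affinoid subdomains:
  \<open>\<bar>\<Sum>c\<^sub>i \<omega>\<^sub>i\<bar> \<ge> q\<^bsup>-n\<^esup> \<cdot> max\<^sub>i \<bar>c\<^sub>i\<bar> \<cdot> max\<^sub>j \<bar>\<omega>\<^sub>j\<bar>\<close> for all \<open>c\<^sub>2,\<dots>,c\<^sub>r \<in> K\<^sub>\<infinity>\<close>.
\<close>

definition Omega_affinoid ::
  "('f::{field,finite} fls \<Rightarrow> 'c::{field,complete_space}) \<Rightarrow> nat \<Rightarrow> nat \<Rightarrow> (nat \<Rightarrow> 'c) set" where
  "Omega_affinoid \<iota> r n = {\<omega> \<in> Omega \<iota> r. \<forall>c. \<forall>i\<in>{2..r}. \<forall>j\<in>{2..r}.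
     abs_Kinf (c i) * dist (\<omega> j) 0 / real CARD('f) ^ n
       \<le> dist (\<Sum>k=2..r. \<iota> (c k) * \<omega> k) 0}"

inductive_set poly_functions :: "nat \<Rightarrow> ((nat \<Rightarrow> 'c::field) \<Rightarrow> 'c) set" for r :: nat where
  const: "(\<lambda>\<omega>. u) \<in> poly_functions r"
| coord: "i \<in> {2..r} \<Longrightarrow> (\<lambda>\<omega>. \<omega> i) \<in> poly_functions r"
| add: "\<lbrakk>f \<in> poly_functions r; g \<in> poly_functions r\<rbrakk> \<Longrightarrow> (\<lambda>\<omega>. f \<omega> + g \<omega>) \<in> poly_functions r"
| mult: "\<lbrakk>f \<in> poly_functions r; g \<in> poly_functions r\<rbrakk> \<Longrightarrow> (\<lambda>\<omega>. f \<omega> * g \<omega>) \<in> poly_functions r"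

text \<open>
  A function on \<open>\<Omega>\<^bsup>r-1\<^esup>\<close> is holomorphic if on each affinoid of the exhaustion it is a uniform
  limit of rational functions without poles there.
\<close>

definition holomorphic_functions ::
  "('f::{field,finite} fls \<Rightarrow> 'c::{field,complete_space}) \<Rightarrow> nat \<Rightarrow> ((nat \<Rightarrow> 'c) \<Rightarrow> 'c) set" where
  "holomorphic_functions \<iota> r = {f \<in> extensional (Omega \<iota> r).
     \<forall>n. \<forall>\<epsilon>>0. \<exists>P\<in>poly_functions r. \<exists>Q\<in>poly_functions r.
       \<forall>\<omega>\<in>Omega_affinoid \<iota> r n. Q \<omega> \<noteq> 0 \<and> dist (f \<omega>) (P \<omega> / Q \<omega>) < \<epsilon>}"

definition hol_ring ::
  "('f::{field,finite} fls \<Rightarrow> 'c::{field,complete_space}) \<Rightarrow> nat \<Rightarrow> ((nat \<Rightarrow> 'c) \<Rightarrow> 'c) ring" where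
  "hol_ring \<iota> r = \<lparr>
     carrier = holomorphic_functions \<iota> r,
     monoid.mult = (\<lambda>f g. \<lambda>\<omega>\<in>Omega \<iota> r. f \<omega> * g \<omega>),
     one = (\<lambda>\<omega>\<in>Omega \<iota> r. 1),
     zero = (\<lambda>\<omega>\<in>Omega \<iota> r. 0),
     add = (\<lambda>f g. \<lambda>\<omega>\<in>Omega \<iota> r. f \<omega> + g \<omega>)\<rparr>"

definition lattice_of ::
  "('f::{field,finite} fls \<Rightarrow> 'c::field) \<Rightarrow> nat \<Rightarrow> (nat \<Rightarrow> 'c) \<Rightarrow> 'c set" where
  "lattice_of \<iota> r \<omega> = {\<Sum>i=2..r. A_emb \<iota> (a i) * \<omega> i | a. True}"

text \<open>The product over the nonzero lattice points is the limit over finite subsets.\<close>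

definition lattice_exp :: "'c::{field,complete_space} set \<Rightarrow> 'c \<Rightarrow> 'c" where
  "lattice_exp \<Lambda> z =
     z * Lim (finite_subsets_at_top (\<Lambda> - {0})) (\<lambda>F. \<Prod>l\<in>F. 1 - z / l)"

text \<open>
  A Drinfeld module of rank \<open>s\<close> over \<open>'c\<close>: an \<open>'f\<close>-algebra homomorphism from \<open>A\<close> to the ring of
  \<open>q\<close>-polynomials under composition, with \<open>\<phi>\<^sub>a(X) = aX + \<dots>\<close> and \<open>\<phi>\<^sub>T\<close> of degree \<open>q\<^sup>s\<close>.
\<close>

definition drinfeld_module ::
  "('f::{field,finite} fls \<Rightarrow> 'c::field) \<Rightarrow> nat \<Rightarrow> ('f poly \<Rightarrow> 'c poly) \<Rightarrow> bool" where
  "drinfeld_module \<iota> s \<phi> \<longleftrightarrow>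
     (\<forall>a n. Polynomial.coeff (\<phi> a) n \<noteq> 0 \<longrightarrow> (\<exists>k. n = CARD('f) ^ k)) \<and>
     (\<forall>c. \<phi> [:c:] = [:0, A_emb \<iota> [:c:]:]) \<and>
     (\<forall>a b. \<phi> (a + b) = \<phi> a + \<phi> b) \<and>
     (\<forall>a b. \<phi> (a * b) = pcompose (\<phi> a) (\<phi> b)) \<and>
     (\<forall>a. Polynomial.coeff (\<phi> a) 1 = A_emb \<iota> a) \<and>
     degree (\<phi> [:0, 1:]) = CARD('f) ^ s"

text \<open>The Drinfeld module \<open>\<phi>'\<close> of rank \<open>r - 1\<close> attached to a point of \<open>\<Omega>\<^bsup>r-1\<^esup>\<close>.\<close>

definition phi' ::
  "('f::{field,finite} fls \<Rightarrow> 'c::{field,complete_space}) \<Rightarrow> nat \<Rightarrow> (nat \<Rightarrow> 'c)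
    \<Rightarrow> 'f poly \<Rightarrow> 'c poly" where
  "phi' \<iota> r \<omega> = (THE \<phi>. drinfeld_module \<iota> (r - 1) \<phi> \<and>
     (\<forall>a z. poly (\<phi> a) (lattice_exp (lattice_of \<iota> r \<omega>) z)
            = lattice_exp (lattice_of \<iota> r \<omega>) (A_emb \<iota> a * z)))"

definition Delta' ::
  "('f::{field,finite} fls \<Rightarrow> 'c::{field,complete_space}) \<Rightarrow> nat \<Rightarrow> (nat \<Rightarrow> 'c) \<Rightarrow> 'c" where
  "Delta' \<iota> r \<omega> = Polynomial.coeff (phi' \<iota> r \<omega> [:0, 1:]) (CARD('f) ^ (r - 1))"

definition Delta'_deg ::
  "('f::{field,finite} fls \<Rightarrow> 'c::{field,complete_space}) \<Rightarrow> nat \<Rightarrow> nat \<Rightarrow> (nat \<Rightarrow> 'c) \<Rightarrow> 'c" where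
  "Delta'_deg \<iota> r d \<omega> =
     Delta' \<iota> r \<omega> ^ ((CARD('f) ^ ((r - 1) * d) - 1) div (CARD('f) ^ (r - 1) - 1))"

text \<open>
  \<open>S\<^sub>a(X) = \<Delta>'\<^sub>(\<^sub>d\<^sub>)\<^sup>-\<^sup>1 X\<^sup>N \<phi>'\<^sub>a(X\<^sup>-\<^sup>1)\<close> with \<open>N = q\<^bsup>(r-1)d\<^esup>\<close> and \<open>d = deg a\<close>, as an element of
  \<open>\<O>'[X]\<close>: the coefficient of \<open>X\<^sup>n\<close> is the function on \<open>\<Omega>\<^bsup>r-1\<^esup>\<close> given by the coefficient of
  \<open>X\<^bsup>N-n\<^esup>\<close> in \<open>\<phi>'\<^sub>a\<close>, divided by \<open>\<Delta>'\<^sub>(\<^sub>d\<^sub>)\<close>.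
\<close>

definition S_poly ::
  "('f::{field,finite} fls \<Rightarrow> 'c::{field,complete_space}) \<Rightarrow> nat \<Rightarrow> 'f poly
    \<Rightarrow> nat \<Rightarrow> (nat \<Rightarrow> 'c) \<Rightarrow> 'c" where
  "S_poly \<iota> r a = (\<lambda>n. \<lambda>\<omega>\<in>Omega \<iota> r.
     let N = CARD('f) ^ ((r - 1) * degree a) in
     if n \<le> N then Polynomial.coeff (phi' \<iota> r \<omega> a) (N - n) / Delta'_deg \<iota> r (degree a) \<omega>
     else 0)"

definition Pi_poly ::
  "('f::{field,finite} fls \<Rightarrow> 'c::{field,complete_space}) \<Rightarrow> nat \<Rightarrow> nat
    \<Rightarrow> nat \<Rightarrow> (nat \<Rightarrow> 'c) \<Rightarrow> 'c" where
  "Pi_poly \<iota> r d =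
     finprod (UP (hol_ring \<iota> r)) (S_poly \<iota> r) {a. lead_coeff a = 1 \<and> degree a = d}"

text \<open>The order \<open>o(P)\<close>; it is \<open>\<infinity>\<close> for \<open>P = 0\<close>.\<close>

definition order_at_0 :: "('a, 'm) ring_scheme \<Rightarrow> (nat \<Rightarrow> 'a) \<Rightarrow> enat" where
  "order_at_0 R P = (INF n \<in> {n. up_ring.coeff (UP R) P n \<noteq> \<zero>\<^bsub>R\<^esub>}. enat n)"

end

theory Submission
  imports Defs
begin

text \<open>
  Let \<open>s = r - 1\<close>. For \<open>a = T\<^sup>2 + b T + c\<close> with \<open>b, c\<close> in the finite field one has
  \<open>S\<^sub>a = F + b G + c H\<close> with \<open>F = 1 + \<dots>\<close>, where \<open>G\<close> and \<open>H\<close> have orders \<open>q\<^bsup>2s\<^esup> - q\<^sup>s\<close> and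
  \<open>q\<^bsup>2s\<^esup> - 1\<close>. Since \<open>\<Prod>\<^sub>c (x + c y) = x\<^sup>q - y\<^bsup>q-1\<^esup> x\<close>, the product over all \<open>b, c\<close> is
  additive in \<open>F\<close>, and its lowest nonconstant term is that of \<open>- G\<^bsup>q(q-1)\<^esup>\<close>, with coefficient
  a power of \<open>\<Delta>'\<close> up to sign and hence without zeros.

  For a finite subspace \<open>W\<close> put \<open>e\<^sub>W(z) = z \<Prod>\<^sub>w (1 - z / w)\<close>. The part \<open>\<Lambda>\<^sub>m\<close> of the lattice with
  coefficients of degree below \<open>m\<close> is such a subspace, and \<open>T\<^sup>-\<^sup>1 \<Lambda>\<^bsub>m+1\<^esub>\<close> consists of the cosets
  \<open>\<mu> + \<Lambda>\<^sub>m\<close> with \<open>\<mu>\<close> in \<open>T\<^sup>-\<^sup>1 \<Lambda>\<^sub>1\<close>. Writing \<open>e\<^sub>m\<close> for the exponential of \<open>\<Lambda>\<^sub>m\<close>, additivity gives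
  \<open>e\<^bsub>m+1\<^esub>(T z) = T e\<^sub>m(z) \<Prod>\<^sub>\<mu> (1 - e\<^sub>m(z) / e\<^sub>m(\<mu>))\<close>, and the limit over \<open>m\<close> is the functional
  equation of the lattice exponential. It exhibits the coefficients of \<open>\<phi>'\<^sub>T\<close> and \<open>\<Delta>'\<^sup>-\<^sup>1\<close> as
  polynomials in the torsion points and their inverses, which are uniform limits of the rational
  functions \<open>e\<^sub>m(\<mu>)\<^bsup>\<plusminus>1\<^esup>\<close> on every affinoid.
\<close>

section \<open>Additive polynomials over a finite field\<close>

text \<open>The obstacle is less the order than the ring in which it is taken. \<open>phi'\<close>
  is a definite description and says nothing before existence and uniqueness are known; both rest on
  the fact that a polynomial is determined by its values on the infinite range of the lattice
  exponential. No closure of \<open>hol_ring\<close> under products is proved, so formal products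
  and negatives are evaluated by hand within the smaller class \<open>bhol\<close>. For
  \<open>1 / \<Delta>'\<close> and the coefficients of \<open>S_a\<close> to lie in it, the torsion
  points must be bounded away from zero uniformly on each affinoid: \<open>|e_m(\<mu>)|\<close> is
  constant in \<open>m\<close> from some level on, and its factors are, up to \<open>T\<close>,
  quotients of nonzero lattice points. The order is then a comparison of exponents:
  \<open>F^(q^2) - 1 = (F - 1)^(q^2)\<close> vanishes at least to order
  \<open>(q-1) q q^(2s)\<close>, beyond the order of \<open>G^(q(q-1))\<close>. Since coefficients
  in \<open>O'\<close> are functions, \<open>\<Omega>\<close> has to be nonempty, and estimates on
  affinoids reach all of its points only because the affinoids exhaust it.\<close>

lemma finite_field_power_card:
  fixes x :: "'f::{field,finite}"
  shows "x ^ CARD('f) = x"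
proof (cases "x = 0")
  case False
  have "x * (\<Prod>y\<in>UNIV-{0}. x * y) = x * x ^ (CARD('f) - 1) * \<Prod>(UNIV-{0})"
    by (simp add: prod.distrib mult_ac)
  also have "x * x ^ (CARD('f) - 1) = x ^ CARD('f)"
    by (metis power_minus_mult zero_less_card_finite mult.commute)
  also have "(\<Prod>y\<in>UNIV-{0}. x * y) = (\<Prod>y\<in>UNIV-{0}. y)"
    by (rule prod.reindex_bij_witness[of _ "\<lambda>y. y / x" "\<lambda>y. x * y"]) (use False in auto)
  finally show ?thesis
    by simp
qed simp

lemma card_finite_field_ge_2: "CARD('f::{field,finite}) \<ge> 2"
proof -
  have "card {0, 1 :: 'f} \<le> CARD('f)"
    by (rule card_mono) auto
  then show ?thesis
    by simp
qed

text \<open>\<open>CARD('f)\<close> need not be prime. The polynomials \<open>(1 + X)^q\<close> and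
  \<open>X^q + 1\<close> are monic of degree \<open>q\<close> and agree at all \<open>q\<close>
  elements of the field, so their difference, of degree below \<open>q\<close>, is zero; the claim
  is read off from the coefficients.\<close>

lemma finite_field_choose_card_eq_0:
  assumes "0 < k" "k < CARD('f::{field,finite})"
  shows "of_nat (CARD('f) choose k) = (0::'f)"
proof -
  let ?q = "CARD('f)"
  have "[:1, 1::'f:] ^ ?q = Polynomial.monom 1 ?q + 1"
  proof (rule poly_eqI_degree_lead_coeff[where n = ?q and A = UNIV])
    have "lead_coeff ([:1, 1::'f:] ^ ?q) = 1"
      by (simp add: lead_coeff_power)
    moreover have "degree ([:1, 1::'f:] ^ ?q) = ?q"
      by (simp add: degree_power_eq)
    ultimately show "Polynomial.coeff ([:1, 1::'f:] ^ ?q) ?q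
        = Polynomial.coeff (Polynomial.monom 1 ?q + 1) ?q"
      by (simp add: Polynomial.coeff_1)
    show "degree (Polynomial.monom (1::'f) ?q + 1) \<le> ?q"
      by (rule degree_add_le) (auto simp: degree_monom_le)
  qed (auto simp: degree_power_eq finite_field_power_card poly_monom)
  then have "Polynomial.coeff ([:1, 1::'f:] ^ ?q) k = 0"
    using assms by (simp add: Polynomial.coeff_1)
  then show ?thesis
    using assms by (simp add: coeff_linear_poly_power)
qed

text \<open>The target is an integral domain and not only a field, so that constant polynomials give
  a second instance and the Frobenius identities become available in the polynomial ring.\<close>

locale finite_field_algebra =
  fixes \<kappa> :: "'f::{field,finite} \<Rightarrow> 'a::idom"
  assumes kappa_1 [simp]: "\<kappa> 1 = 1"
    and kappa_add: "\<kappa> (x + y) = \<kappa> x + \<kappa> y"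
    and kappa_mult: "\<kappa> (x * y) = \<kappa> x * \<kappa> y"
begin

lemma kappa_0 [simp]: "\<kappa> 0 = 0"
  by (metis add_cancel_right_right add.right_neutral kappa_add)

lemma kappa_uminus: "\<kappa> (- x) = - \<kappa> x"
  using kappa_add[of x "- x"] by (simp add: eq_neg_iff_add_eq_0 add.commute)

lemma kappa_diff: "\<kappa> (x - y) = \<kappa> x - \<kappa> y"
  using kappa_add[of x "- y"] by (simp add: kappa_uminus)

lemma kappa_of_nat: "\<kappa> (of_nat n) = of_nat n"
  by (induction n) (simp_all add: kappa_add)

lemma kappa_power: "\<kappa> (x ^ n) = \<kappa> x ^ n"
  by (induction n) (simp_all add: kappa_mult)

lemma kappa_eq_0_iff [simp]: "\<kappa> x = 0 \<longleftrightarrow> x = 0"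
proof
  assume "\<kappa> x = 0"
  then have "\<kappa> (x * inverse x) = 0"
    by (simp add: kappa_mult)
  then show "x = 0"
    by (cases "x = 0") auto
qed simp

lemma inj_kappa: "inj \<kappa>"
  by (rule injI) (metis kappa_diff kappa_eq_0_iff right_minus_eq)

lemma kappa_power_card: "\<kappa> x ^ CARD('f) = \<kappa> x"
  by (metis kappa_power finite_field_power_card)

lemma frobenius_add: "(x + y :: 'a) ^ CARD('f) = x ^ CARD('f) + y ^ CARD('f)"
proof -
  let ?q = "CARD('f)"
  have "(x + y) ^ ?q = (\<Sum>k\<le>?q. of_nat (?q choose k) * x ^ k * y ^ (?q - k))"
    by (rule binomial_ring)
  also have "\<dots> = (\<Sum>k\<in>{0,?q}. of_nat (?q choose k) * x ^ k * y ^ (?q - k))"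
  proof (intro sum.mono_neutral_right ballI)
    fix k assume "k \<in> {..?q} - {0, ?q}"
    then have "of_nat (?q choose k) = (0::'f)"
      by (intro finite_field_choose_card_eq_0) auto
    then have "of_nat (?q choose k) = (0::'a)"
      by (metis kappa_of_nat kappa_0)
    then show "of_nat (?q choose k) * x ^ k * y ^ (?q - k) = 0"
      by simp
  qed auto
  finally show ?thesis
    by (simp add: add.commute)
qed

lemma frobenius_sum: "sum f A ^ CARD('f) = (\<Sum>i\<in>A. f i ^ CARD('f))" for f :: "'b \<Rightarrow> 'a"
  by (induction A rule: infinite_finite_induct) (simp_all add: frobenius_add)

lemma frobenius_uminus: "(- x :: 'a) ^ CARD('f) = - (x ^ CARD('f))"
proof -
  have "(x + - x) ^ CARD('f) = x ^ CARD('f) + (- x) ^ CARD('f)"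
    by (rule frobenius_add)
  then show ?thesis
    by (simp add: add_eq_0_iff zero_power)
qed

lemma frobenius_diff: "(x - y :: 'a) ^ CARD('f) = x ^ CARD('f) - y ^ CARD('f)"
  using frobenius_add[of x "- y"] by (simp add: frobenius_uminus)

text \<open>The homogeneous form of \<open>\<Prod>(X + c) = X^q - X\<close>. For
  \<open>y \<noteq> 0\<close> both sides are monic of degree \<open>q\<close> in \<open>x\<close>
  and vanish at the \<open>q\<close> distinct points \<open>- (\<kappa> c * y)\<close>; for
  \<open>y = 0\<close> these points coincide.\<close>

lemma prod_add_kappa_mult:
  "(\<Prod>c\<in>UNIV. x + \<kappa> c * y) = x ^ CARD('f) - y ^ (CARD('f) - 1) * x"
proof (cases "y = 0")
  case True
  then show ?thesis
    using card_finite_field_ge_2[where ?'f='f] by simp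
next
  case False
  let ?q = "CARD('f)"
  define P where "P = (\<Prod>c\<in>UNIV. [:\<kappa> c * y, 1:])"
  define Q where "Q = Polynomial.monom 1 ?q - Polynomial.monom (y ^ (?q - 1)) 1"
  have degP: "degree P = ?q"
    unfolding P_def by (subst degree_prod_eq_sum_degree) auto
  have "lead_coeff P = 1"
    by (simp add: P_def lead_coeff_prod)
  have inj: "inj (\<lambda>c. - (\<kappa> c * y))"
    using False inj_kappa by (auto simp: inj_on_def)
  have "P = Q"
  proof (rule poly_eqI_degree_lead_coeff[where n = ?q and A = "range (\<lambda>c. - (\<kappa> c * y))"])
    show "Polynomial.coeff P ?q = Polynomial.coeff Q ?q"
      using \<open>lead_coeff P = 1\<close> card_finite_field_ge_2[where ?'f='f]
      by (simp add: degP Q_def)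
    show "?q \<le> card (range (\<lambda>c. - (\<kappa> c * y)))"
      using inj by (simp add: card_image)
    show "degree Q \<le> ?q"
      unfolding Q_def
      by (rule degree_diff_le)
        (auto intro!: order.trans[OF degree_monom_le] simp: Suc_leI)
    fix z assume "z \<in> range (\<lambda>c. - (\<kappa> c * y))"
    then obtain c where z: "z = - (\<kappa> c * y)"
      by auto
    have "poly P z = 0"
      unfolding P_def poly_prod by (rule prod_zero) (auto simp: z)
    moreover have "y ^ ?q = y * y ^ (?q - 1)"
      by (metis power_minus_mult zero_less_card_finite mult.commute)
    then have "poly Q z = 0"
      by (simp add: Q_def z poly_monom frobenius_uminus power_mult_distrib kappa_power_card)
    ultimately show "poly P z = poly Q z"
      by simp
  qed (simp add: degP)
  then have "poly P x = poly Q x"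
    by simp
  then show ?thesis
    by (simp add: P_def Q_def poly_prod poly_monom add.commute)
qed

lemma finite_field_algebra_poly: "finite_field_algebra (\<lambda>c. [:\<kappa> c:])"
  by standard (simp_all add: kappa_add kappa_mult)

end

lemma poly_eqI_infinite:
  fixes p p' :: "'a::idom poly"
  assumes "infinite A" and "\<And>x. x \<in> A \<Longrightarrow> poly p x = poly p' x"
  shows "p = p'"
proof (rule ccontr)
  assume "p \<noteq> p'"
  then have "finite {x. poly (p - p') x = 0}"
    by (intro poly_roots_finite) simp
  moreover have "A \<subseteq> {x. poly (p - p') x = 0}"
    using assms(2) by auto
  ultimately show False
    using assms(1) finite_subset by blast
qed

section \<open>Polynomials whose exponents are powers of q\<close>

definition q_poly :: "nat \<Rightarrow> 'a::zero poly \<Rightarrow> bool" where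
  "q_poly q p \<longleftrightarrow> (\<forall>n. Polynomial.coeff p n \<noteq> 0 \<longrightarrow> (\<exists>k. n = q ^ k))"

lemma q_poly_0 [simp]: "q_poly q 0"
  by (simp add: q_poly_def)

lemma q_poly_linear [simp]: "q_poly q [:0, a:]"
  unfolding q_poly_def
proof (intro allI impI)
  fix n assume "Polynomial.coeff [:0, a:] n \<noteq> 0"
  then have "n = q ^ 0"
    by (auto simp: coeff_pCons split: nat.splits)
  then show "\<exists>k. n = q ^ k" ..
qed

lemma q_poly_add: "q_poly q p \<Longrightarrow> q_poly q p' \<Longrightarrow> q_poly q (p + p')"
  unfolding q_poly_def coeff_add by (metis add_0)

lemma q_poly_diff: "q_poly q p \<Longrightarrow> q_poly q p' \<Longrightarrow> q_poly q (p - p')"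
  for p p' :: "'a::ab_group_add poly"
  unfolding q_poly_def coeff_diff by (metis diff_zero)

lemma q_poly_smult: "q_poly q p \<Longrightarrow> q_poly q (Polynomial.smult a p)"
  for p :: "'a::comm_semiring_0 poly"
  unfolding q_poly_def coeff_smult by (metis mult_zero_right)

lemma q_poly_sum: "(\<And>i. i \<in> A \<Longrightarrow> q_poly q (f i)) \<Longrightarrow> q_poly q (sum f A)"
  by (induction A rule: infinite_finite_induct) (auto intro: q_poly_add)

context finite_field_algebra
begin

lemma frobenius_power_add:
  "(x + y :: 'a) ^ (CARD('f) ^ k) = x ^ (CARD('f) ^ k) + y ^ (CARD('f) ^ k)"
  by (induction k) (simp_all add: power_mult frobenius_add mult.commute[of "CARD('f)"])

lemma kappa_power_card_power: "\<kappa> c ^ (CARD('f) ^ k) = \<kappa> c"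
  by (induction k) (simp_all add: power_mult kappa_power_card)

lemma poly_q_poly_add:
  fixes p :: "'a poly"
  assumes "q_poly CARD('f) p"
  shows "poly p (x + y) = poly p x + poly p y"
proof -
  have "Polynomial.coeff p n * (x + y) ^ n
      = Polynomial.coeff p n * x ^ n + Polynomial.coeff p n * y ^ n" for n
  proof (cases "Polynomial.coeff p n = 0")
    case False
    then obtain k where "n = CARD('f) ^ k"
      using assms by (auto simp: q_poly_def)
    then show ?thesis
      by (simp add: frobenius_power_add distrib_left)
  qed simp
  then show ?thesis
    by (simp add: poly_altdef sum.distrib)
qed

lemma poly_q_poly_kappa:
  assumes "q_poly CARD('f) p"
  shows "poly p (\<kappa> c * x) = \<kappa> c * poly p x"
  unfolding poly_altdef sum_distrib_left
proof (rule sum.cong)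
  fix n
  show "Polynomial.coeff p n * (\<kappa> c * x) ^ n = \<kappa> c * (Polynomial.coeff p n * x ^ n)"
  proof (cases "Polynomial.coeff p n = 0")
    case False
    then obtain k where "n = CARD('f) ^ k"
      using assms by (auto simp: q_poly_def)
    then show ?thesis
      by (simp add: power_mult_distrib kappa_power_card_power)
  qed simp
qed simp

text \<open>Frobenius is additive on the polynomial ring as well, so the \<open>q\<close>-th power
  is taken monomial by monomial and multiplies every exponent by \<open>q\<close>.\<close>

lemma q_poly_power_card:
  fixes p :: "'a poly"
  assumes "q_poly CARD('f) p"
  shows "q_poly CARD('f) (p ^ CARD('f))"
proof -
  interpret P: finite_field_algebra "\<lambda>c. [:\<kappa> c:]"
    by (rule finite_field_algebra_poly)
  let ?q = "CARD('f)"
  have "p ^ ?q = (\<Sum>i\<le>degree p. Polynomial.monom (Polynomial.coeff p i) i) ^ ?q"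
    by (simp add: poly_as_sum_of_monoms)
  also have "\<dots> = (\<Sum>i\<le>degree p. Polynomial.monom (Polynomial.coeff p i ^ ?q) (i * ?q))"
    by (simp add: P.frobenius_sum Polynomial.monom_power mult.commute)
  also have "q_poly ?q \<dots>"
  proof (rule q_poly_sum)
    fix i
    show "q_poly ?q (Polynomial.monom (Polynomial.coeff p i ^ ?q) (i * ?q))"
    proof (cases "Polynomial.coeff p i = 0")
      case False
      then obtain k where "i = ?q ^ k"
        using assms by (auto simp: q_poly_def)
      then have "i * ?q = ?q ^ Suc k"
        by simp
      then show ?thesis
        unfolding q_poly_def coeff_monom by metis
    qed (simp add: zero_power)
  qed
  finally show ?thesis .
qed

lemma q_poly_power_card_power:
  fixes p :: "'a poly"
  shows "q_poly CARD('f) p \<Longrightarrow> q_poly CARD('f) (p ^ (CARD('f) ^ k))"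
  by (induction k) (auto simp: power_mult mult.commute[of "CARD('f)"] intro: q_poly_power_card)

lemma q_poly_pcompose:
  fixes p p' :: "'a poly"
  assumes "q_poly CARD('f) p" "q_poly CARD('f) p'"
  shows "q_poly CARD('f) (pcompose p p')"
proof -
  have "pcompose p p' = (\<Sum>i\<le>degree p. Polynomial.smult (Polynomial.coeff p i) (p' ^ i))"
    by (simp add: pcompose_altdef poly_altdef degree_map_poly coeff_map_poly)
  also have "q_poly CARD('f) \<dots>"
  proof (rule q_poly_sum)
    fix i
    show "q_poly CARD('f) (Polynomial.smult (Polynomial.coeff p i) (p' ^ i))"
    proof (cases "Polynomial.coeff p i = 0")
      case False
      then obtain k where "i = CARD('f) ^ k"
        using assms(1) by (auto simp: q_poly_def)
      then show ?thesis
        using assms(2) by (auto intro: q_poly_smult q_poly_power_card_power)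
    qed simp
  qed
  finally show ?thesis .
qed

section \<open>Finite subspaces and their vanishing polynomials\<close>

definition fq_subspace :: "'a set \<Rightarrow> bool" where
  "fq_subspace V \<longleftrightarrow> 0 \<in> V \<and> (\<forall>x\<in>V. \<forall>y\<in>V. x + y \<in> V) \<and> (\<forall>c. \<forall>x\<in>V. \<kappa> c * x \<in> V)"

lemma subspace_diff: "fq_subspace V \<Longrightarrow> x \<in> V \<Longrightarrow> y \<in> V \<Longrightarrow> x - y \<in> V"
proof -
  assume V: "fq_subspace V" "x \<in> V" "y \<in> V"
  then have "x + \<kappa> (- 1) * y \<in> V"
    by (auto simp: fq_subspace_def)
  then show ?thesis
    by (simp add: kappa_uminus)
qed

text \<open>Every finite subspace is built up from \<open>{0}\<close> by adjoining one vector at a time.\<close>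

inductive flag :: "'a set \<Rightarrow> bool" where
  zero: "flag {0}"
| adjoin: "\<lbrakk>flag V; w \<notin> V\<rbrakk> \<Longrightarrow> flag ((\<lambda>(c, v). v + \<kappa> c * w) ` (UNIV \<times> V))"

lemma flag_subspace: "flag V \<Longrightarrow> finite V \<and> fq_subspace V"
proof (induction rule: flag.induct)
  case zero
  show ?case
    by (simp add: fq_subspace_def)
next
  case (adjoin V w)
  have "fq_subspace ((\<lambda>(c, v). v + \<kappa> c * w) ` (UNIV \<times> V))"
    unfolding fq_subspace_def
  proof (intro conjI ballI allI)
    show "0 \<in> (\<lambda>(c, v). v + \<kappa> c * w) ` (UNIV \<times> V)"
      using adjoin by (intro image_eqI[of _ _ "(0, 0)"]) (auto simp: fq_subspace_def)
  next
    fix x y assume "x \<in> (\<lambda>(c, v). v + \<kappa> c * w) ` (UNIV \<times> V)"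
      "y \<in> (\<lambda>(c, v). v + \<kappa> c * w) ` (UNIV \<times> V)"
    then obtain c v c' v' where *: "x = v + \<kappa> c * w" "v \<in> V" "y = v' + \<kappa> c' * w" "v' \<in> V"
      by auto
    show "x + y \<in> (\<lambda>(c, v). v + \<kappa> c * w) ` (UNIV \<times> V)"
      using adjoin * by (intro image_eqI[of _ _ "(c + c', v + v')"])
        (auto simp: fq_subspace_def kappa_add algebra_simps)
  next
    fix b x assume "x \<in> (\<lambda>(c, v). v + \<kappa> c * w) ` (UNIV \<times> V)"
    then obtain c v where *: "x = v + \<kappa> c * w" "v \<in> V"
      by auto
    show "\<kappa> b * x \<in> (\<lambda>(c, v). v + \<kappa> c * w) ` (UNIV \<times> V)"
      using adjoin * by (intro image_eqI[of _ _ "(b * c, \<kappa> b * v)"])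
        (auto simp: fq_subspace_def kappa_mult algebra_simps)
  qed
  then show ?case
    using adjoin by simp
qed

text \<open>Choose a flag inside \<open>V\<close> that is maximal for inclusion; a vector of
  \<open>V\<close> outside it could be adjoined without leaving \<open>V\<close>, against
  maximality.\<close>

lemma subspace_flag:
  assumes "finite V" "fq_subspace V"
  shows "flag V"
proof -
  let ?S = "{W. flag W \<and> W \<subseteq> V}"
  have "finite ?S"
    by (rule finite_subset[of _ "Pow V"]) (use assms(1) in auto)
  moreover have "{0} \<in> ?S"
    using assms(2) by (auto simp: flag.zero fq_subspace_def)
  then have "?S \<noteq> {}"
    by blast
  ultimately have "\<exists>W\<in>?S. \<forall>U\<in>?S. W \<subseteq> U \<longrightarrow> W = U"
    by (rule finite_has_maximal)
  then obtain W where W: "W \<in> ?S" and max: "\<And>U. U \<in> ?S \<Longrightarrow> W \<subseteq> U \<Longrightarrow> W = U"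
    by meson
  have "V \<subseteq> W"
  proof
    fix w assume "w \<in> V"
    show "w \<in> W"
    proof (rule ccontr)
      assume "w \<notin> W"
      let ?U = "(\<lambda>(c, v). v + \<kappa> c * w) ` (UNIV \<times> W)"
      have "?U \<in> ?S"
      proof
        have "flag ?U"
          using W \<open>w \<notin> W\<close> by (intro flag.adjoin) auto
        moreover have "v + \<kappa> c * w \<in> V" if "v \<in> W" for v c
          using that W \<open>w \<in> V\<close> assms(2) unfolding fq_subspace_def by blast
        ultimately show "flag ?U \<and> ?U \<subseteq> V"
          by auto
      qed
      moreover have "W \<subseteq> ?U"
      proof
        fix v assume "v \<in> W"
        then show "v \<in> ?U"
          by (intro image_eqI[of _ _ "(0, v)"]) auto
      qed
      ultimately have "W = ?U"
        by (rule max)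
      moreover have "w \<in> ?U"
        using flag_subspace[of W] W
        by (intro image_eqI[of _ _ "(1, 0)"]) (auto simp: fq_subspace_def)
      ultimately show False
        using \<open>w \<notin> W\<close> by blast
    qed
  qed
  with W show ?thesis
    by auto
qed

end

locale finite_field_extension = finite_field_algebra \<kappa> for \<kappa> :: "'f::{field,finite} \<Rightarrow> 'a::field" +
  assumes infinite_UNIV: "infinite (UNIV :: 'a set)"
begin

text \<open>Let \<open>P\<close> be the product for \<open>V\<close>, additive by induction. Once
  \<open>w\<close> is adjoined, the product at \<open>x\<close> runs over the values
  \<open>P (x + \<kappa> c * w) = P x + \<kappa> c * P w\<close>, and
  \<open>prod_add_kappa_mult\<close> turns it into \<open>P^q - P(w)^(q-1) P\<close>.\<close>

lemma q_poly_prod_subspace: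
  assumes "finite V" "fq_subspace V"
  shows "q_poly CARD('f) (\<Prod>v\<in>V. [:v, 1:])"
  using subspace_flag[OF assms]
proof (induction rule: flag.induct)
  case zero
  show ?case
    by simp
next
  case (adjoin V w)
  let ?q = "CARD('f)"
  define P where "P = (\<Prod>v\<in>V. [:v, 1:])"
  have V: "finite V" "fq_subspace V"
    using flag_subspace[OF adjoin.hyps(1)] by auto
  have P: "q_poly ?q P"
    using adjoin by (simp add: P_def)
  \<comment> \<open>As \<open>w\<close> lies outside \<open>V\<close>, scalar and vector can be
    recovered from the sum, so the product over the larger space is a double product.\<close>
  have inj: "inj_on (\<lambda>(c, v). v + \<kappa> c * w) (UNIV \<times> V)"
  proof (rule inj_onI, clarify)
    fix c v c' v' assume *: "v \<in> V" "v' \<in> V" "v + \<kappa> c * w = v' + \<kappa> c' * w"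
    have "c = c'"
    proof (rule ccontr)
      assume "c \<noteq> c'"
      then have "\<kappa> (inverse (c - c')) * \<kappa> (c - c') = 1"
        by (simp flip: kappa_mult)
      then have "w = \<kappa> (inverse (c - c')) * (\<kappa> (c - c') * w)"
        by (simp flip: mult.assoc)
      also have "\<kappa> (c - c') * w = v' - v"
        using *(3) by (simp add: kappa_diff algebra_simps)
      finally have "w \<in> V"
        using V * subspace_diff[OF V(2)] by (auto simp: fq_subspace_def)
      then show False
        using adjoin by simp
    qed
    with * show "c = c' \<and> v = v'"
      by simp
  qed
  have "(\<Prod>v\<in>(\<lambda>(c, v). v + \<kappa> c * w) ` (UNIV \<times> V). [:v, 1:])
      = P ^ ?q - Polynomial.smult (poly P w ^ (?q - 1)) P"
  proof (rule poly_eqI_infinite[OF infinite_UNIV])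
    fix x
    have "poly (\<Prod>v\<in>(\<lambda>(c, v). v + \<kappa> c * w) ` (UNIV \<times> V). [:v, 1:]) x
        = (\<Prod>c\<in>UNIV. \<Prod>v\<in>V. (x + \<kappa> c * w) + v)"
      by (subst prod.reindex[OF inj])
        (simp add: poly_prod prod.cartesian_product case_prod_beta add_ac)
    also have "\<dots> = (\<Prod>c\<in>UNIV. poly P x + \<kappa> c * poly P w)"
      unfolding poly_q_poly_kappa[OF P, symmetric] poly_q_poly_add[OF P, symmetric]
      by (simp add: P_def poly_prod add_ac)
    also have "\<dots> = poly (P ^ ?q - Polynomial.smult (poly P w ^ (?q - 1)) P) x"
      by (simp add: prod_add_kappa_mult)
    finally show "poly (\<Prod>v\<in>(\<lambda>(c, v). v + \<kappa> c * w) ` (UNIV \<times> V). [:v, 1:]) x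
      = poly (P ^ ?q - Polynomial.smult (poly P w ^ (?q - 1)) P) x" .
  qed
  then show ?case
    using P by (simp add: q_poly_diff q_poly_smult q_poly_power_card)
qed

end

section \<open>The product of the reversed polynomials\<close>

text \<open>This is \<open>X^N p(1/X)\<close> with \<open>N\<close> prescribed instead of taken from
  the degree of \<open>p\<close>, which makes the operation linear in \<open>p\<close>.\<close>

definition rev_poly :: "nat \<Rightarrow> 'a::comm_monoid_add poly \<Rightarrow> 'a poly" where
  "rev_poly N p = (\<Sum>k\<le>N. Polynomial.monom (Polynomial.coeff p (N - k)) k)"

lemma coeff_rev_poly:
  "Polynomial.coeff (rev_poly N p) n = (if n \<le> N then Polynomial.coeff p (N - n) else 0)"
  by (simp add: rev_poly_def Polynomial.coeff_sum)

lemma rev_poly_add: "rev_poly N (p + p') = rev_poly N p + rev_poly N p'"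
  by (rule poly_eqI) (simp add: coeff_rev_poly)

lemma rev_poly_smult: "rev_poly N (Polynomial.smult a p) = Polynomial.smult a (rev_poly N p)"
  for p :: "'a::comm_semiring_0 poly"
  by (rule poly_eqI) (simp add: coeff_rev_poly)

context finite_field_algebra
begin

text \<open>The product over \<open>c\<close> is \<open>L (x + \<kappa> b * y)\<close> with
  \<open>L w = w^q - z^(q-1) w\<close>. As \<open>L\<close> is linear over the finite field, the
  product over \<open>b\<close> has the same shape again, now with \<open>L x\<close> and
  \<open>L y\<close>.\<close>

lemma prod_add_kappa_mult_two:
  "(\<Prod>b\<in>UNIV. \<Prod>c\<in>UNIV. x + \<kappa> b * y + \<kappa> c * z)
    = x ^ (CARD('f) * CARD('f)) - z ^ ((CARD('f) - 1) * CARD('f)) * x ^ CARD('f)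
      - (y ^ CARD('f) - z ^ (CARD('f) - 1) * y) ^ (CARD('f) - 1)
        * (x ^ CARD('f) - z ^ (CARD('f) - 1) * x)"
proof -
  define L where "L w = w ^ CARD('f) - z ^ (CARD('f) - 1) * w" for w
  have "L (x + \<kappa> b * y) = L x + \<kappa> b * L y" for b
    by (simp add: L_def frobenius_add power_mult_distrib kappa_power_card algebra_simps)
  moreover have "(\<Prod>c\<in>UNIV. x + \<kappa> b * y + \<kappa> c * z) = L (x + \<kappa> b * y)" for b
    unfolding L_def by (rule prod_add_kappa_mult)
  ultimately have "(\<Prod>b\<in>UNIV. \<Prod>c\<in>UNIV. x + \<kappa> b * y + \<kappa> c * z) = (\<Prod>b\<in>UNIV. L x + \<kappa> b * L y)"
    by simp
  also have "\<dots> = L x ^ CARD('f) - L y ^ (CARD('f) - 1) * L x"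
    by (rule prod_add_kappa_mult)
  also have "L x ^ CARD('f)
      = x ^ (CARD('f) * CARD('f)) - z ^ ((CARD('f) - 1) * CARD('f)) * x ^ CARD('f)"
    by (simp add: L_def frobenius_diff power_mult_distrib flip: power_mult)
  finally show ?thesis
    by (simp add: L_def)
qed

end

context finite_field_extension
begin

text \<open>
  The product is \<open>e\<^sub>V(F)\<close> for the additive polynomial \<open>e\<^sub>V\<close> with set of roots the span \<open>V\<close> of
  \<open>G\<close> and \<open>H\<close>. As \<open>F - 1\<close> and \<open>H\<close> vanish to higher order than \<open>G\<close>, the lowest term of
  \<open>e\<^sub>V(F) - 1\<close> is that of \<open>- G\<^bsup>q(q-1)\<^esup>\<close>.
\<close>

lemma prod_rev_poly_order:
  fixes p :: "'a poly" and s :: nat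
  defines "q \<equiv> CARD('f)"
  defines "N \<equiv> q ^ (2 * s)" and "D \<equiv> lead_coeff p ^ (q ^ s + 1)"
  assumes p: "q_poly q p" and deg: "degree p = q ^ s" and s: "s > 0"
  shows "\<exists>U. (\<Prod>b\<in>UNIV. \<Prod>c\<in>UNIV. Polynomial.smult (1 / D)
            (rev_poly N (pcompose p p + Polynomial.smult (\<kappa> b) p + [:0, \<kappa> c:]))) - 1
           = Polynomial.monom 1 ((q - 1) * q * (q ^ (2 * s) - q ^ s)) * U
         \<and> Polynomial.coeff U 0 \<noteq> 0"
proof -
  interpret P: finite_field_algebra "\<lambda>c. [:\<kappa> c:]"
    by (rule finite_field_algebra_poly)
  define x where "x n = Polynomial.monom (1::'a) n" for n
  have x_add: "x (m + n) = x m * x n" for m n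
    by (simp add: x_def mult_monom)
  have x_power: "x m ^ n = x (m * n)" for m n
    by (simp add: x_def Polynomial.monom_power)
  define F where "F = Polynomial.smult (1 / D) (rev_poly N (pcompose p p))"
  define G where "G = Polynomial.smult (1 / D) (rev_poly N p)"
  define H where "H = Polynomial.smult (1 / D) (rev_poly N [:0, 1:])"
  \<comment> \<open>The exponents of \<open>pcompose p p\<close> are powers of \<open>q\<close>, so
    all but the top one are at most \<open>q^(2 * s - 1)\<close>; hence \<open>F - 1\<close>
    vanishes at least to order \<open>f\<close>. The order of \<open>G\<close> is
    \<open>\<gamma>\<close>.\<close>
  define f where "f = q ^ (2 * s) - q ^ (2 * s - 1)"
  define \<gamma> where "\<gamma> = q ^ (2 * s) - q ^ s"
  have q: "q \<ge> 2"
    unfolding q_def by (rule card_finite_field_ge_2)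
  have pos: "degree p > 0"
    using deg q by simp
  then have lc: "lead_coeff p \<noteq> 0"
    by auto
  then have D: "D \<noteq> 0"
    by (simp add: D_def)
  have Ns: "q ^ s < N"
    unfolding N_def using q s by (intro power_strict_increasing) auto
  have qs: "1 < q ^ s"
    using q s by (intro one_less_power) auto

  have degpp: "degree (pcompose p p) = N"
    by (simp add: degree_pcompose deg N_def mult_2 power_add)
  have lcpp: "Polynomial.coeff (pcompose p p) N = D"
    using lead_coeff_comp[OF pos, of p] by (simp add: degpp deg D_def mult.commute)
  have qpp: "q_poly q (pcompose p p)"
    using p q_poly_pcompose unfolding q_def by blast
  have F0: "Polynomial.coeff F 0 = 1"
    using D by (simp add: F_def coeff_rev_poly lcpp)
  have "x f dvd F - 1"
    unfolding x_def monom_1_dvd_iff'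
  proof (intro allI impI)
    fix k assume k: "k < f"
    show "Polynomial.coeff (F - 1) k = 0"
    proof (cases "k = 0")
      case False
      have "Polynomial.coeff (pcompose p p) (N - k) = 0"
      proof (rule ccontr)
        assume "Polynomial.coeff (pcompose p p) (N - k) \<noteq> 0"
        then obtain j where j: "N - k = q ^ j"
          using qpp by (auto simp: q_poly_def)
        have "q ^ (2 * s - 1) < N - k" "N - k < q ^ (2 * s)"
          using k False unfolding f_def N_def by auto
        then have "q ^ (2 * s - 1) < q ^ j" "q ^ j < q ^ (2 * s)"
          by (simp_all add: j)
        then have "2 * s - 1 < j" "j < 2 * s"
          using q by (auto simp: power_strict_increasing_iff)
        then show False
          by simp
      qed
      then show ?thesis
        using False by (simp add: F_def coeff_rev_poly Polynomial.coeff_1)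
    qed (simp add: F0)
  qed
  then obtain F2 where F2: "F - 1 = x f * F2"
    by (auto simp: dvd_def)
  have "Polynomial.coeff p (N - k) = 0" if "k < \<gamma>" for k
    by (rule coeff_eq_0) (use that in \<open>auto simp: deg \<gamma>_def N_def\<close>)
  then have "x \<gamma> dvd G"
    unfolding x_def monom_1_dvd_iff' by (auto simp: G_def coeff_rev_poly)
  then obtain G1 where G1: "G = x \<gamma> * G1"
    by (auto simp: dvd_def)
  have "Polynomial.coeff G \<gamma> = lead_coeff p / D"
    using Ns by (simp add: G_def coeff_rev_poly \<gamma>_def N_def deg)
  moreover have "Polynomial.coeff G \<gamma> = poly G1 0"
    by (simp add: G1 x_def coeff_monom_mult poly_0_coeff_0)
  ultimately have G10: "poly G1 0 \<noteq> 0"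
    using lc D by simp
  have "Polynomial.coeff H k = 0" if "k < Suc \<gamma>" for k
    using that Ns qs
    by (auto simp: H_def coeff_rev_poly \<gamma>_def N_def coeff_pCons split: nat.splits)
  then have "x (Suc \<gamma>) dvd H"
    unfolding x_def monom_1_dvd_iff' by auto
  then obtain H1 where "H = x (\<gamma> + 1) * H1"
    by (auto simp: dvd_def)
  \<comment> \<open>Since \<open>1 < q^s\<close>, one more factor of the variable splits off than
    for \<open>G\<close>; it stays inside \<open>H2\<close>, which therefore vanishes at
    zero.\<close>
  then obtain H2 where H2: "H = x \<gamma> * H2" and H20: "poly H2 0 = 0"
    by (metis x_add mult.assoc x_def poly_mult poly_monom power_one_right mult_zero_left mult_zero_right)
  have H0: "poly H 0 = 0"
    by (simp add: H2 H20)

  \<comment> \<open>The order of \<open>G^(q (q-1))\<close>; \<open>U\<close> collects what is left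
    of each term once this power of the variable is taken out.\<close>
  define t where "t = (q - 1) * q * \<gamma>"
  define U where "U = x (f * (q * q) - t) * F2 ^ (q * q) - H2 ^ ((q - 1) * q) * F ^ q
      - (G1 ^ q - H2 ^ (q - 1) * G1) ^ (q - 1) * (F ^ q - H ^ (q - 1) * F)"
  have qq: "q = Suc (q - 1)"
    using q by simp
  \<comment> \<open>Here \<open>f q^2 = (q-1) q q^(2s)\<close>, which exceeds \<open>t\<close>
    because \<open>\<gamma> < q^(2s)\<close>. So \<open>F^(q^2) - 1\<close> does not reach the
    lowest coefficient.\<close>
  have ft: "t < f * (q * q)"
  proof -
    have "f * (q * q) = (q - 1) * q * (q * q ^ (2 * s - 1))"
      unfolding f_def using s
      by (cases s) (simp_all add: algebra_simps diff_mult_distrib diff_mult_distrib2)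
    also have "q * q ^ (2 * s - 1) = q ^ (2 * s)"
      using s by (cases s) simp_all
    finally have *: "f * (q * q) = (q - 1) * q * q ^ (2 * s)" .
    have "\<gamma> < q ^ (2 * s)"
      unfolding \<gamma>_def using q by simp
    then show ?thesis
      unfolding t_def * using q by simp
  qed
  have "F ^ (q * q) - 1 = (F - 1) ^ (q * q)"
    unfolding power_mult q_def by (simp add: P.frobenius_diff)
  also have "\<dots> = x t * (x (f * (q * q) - t) * F2 ^ (q * q))"
    using ft by (simp add: F2 power_mult_distrib x_power flip: x_add mult.assoc)
  finally have FF: "F ^ (q * q) = 1 + x t * (x (f * (q * q) - t) * F2 ^ (q * q))"
    by (simp add: algebra_simps)
  have HH: "H ^ ((q - 1) * q) = x t * H2 ^ ((q - 1) * q)"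
    by (simp add: H2 power_mult_distrib x_power t_def mult_ac)
  have "x (\<gamma> * q) = x (\<gamma> * (q - 1)) * x \<gamma>"
    by (subst qq) (simp flip: x_add add: algebra_simps)
  then have "G ^ q - H ^ (q - 1) * G = x (\<gamma> * q) * (G1 ^ q - H2 ^ (q - 1) * G1)"
    by (simp add: G1 H2 power_mult_distrib x_power algebra_simps)
  then have GG: "(G ^ q - H ^ (q - 1) * G) ^ (q - 1) = x t * (G1 ^ q - H2 ^ (q - 1) * G1) ^ (q - 1)"
    by (simp add: power_mult_distrib x_power t_def mult_ac)

  have "(\<Prod>b\<in>UNIV. \<Prod>c\<in>UNIV. Polynomial.smult (1 / D)
            (rev_poly N (pcompose p p + Polynomial.smult (\<kappa> b) p + [:0, \<kappa> c:])))
      = (\<Prod>b\<in>UNIV. \<Prod>c\<in>UNIV. F + [:\<kappa> b:] * G + [:\<kappa> c:] * H)"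
  proof (intro prod.cong refl)
    fix b c
    have "[:0, \<kappa> c:] = Polynomial.smult (\<kappa> c) [:0, 1:]"
      by simp
    then show "Polynomial.smult (1 / D)
          (rev_poly N (pcompose p p + Polynomial.smult (\<kappa> b) p + [:0, \<kappa> c:]))
        = F + [:\<kappa> b:] * G + [:\<kappa> c:] * H"
      unfolding F_def G_def H_def
      by (simp only: rev_poly_add rev_poly_smult)
        (simp add: smult_add_right mult_ac)
  qed
  also have "\<dots> = F ^ (q * q) - H ^ ((q - 1) * q) * F ^ q
      - (G ^ q - H ^ (q - 1) * G) ^ (q - 1) * (F ^ q - H ^ (q - 1) * F)"
    unfolding q_def by (rule P.prod_add_kappa_mult_two)
  also have "\<dots> - 1 = x t * U"
    unfolding FF HH GG U_def by (simp add: algebra_simps)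
  finally have 1: "(\<Prod>b\<in>UNIV. \<Prod>c\<in>UNIV. Polynomial.smult (1 / D)
            (rev_poly N (pcompose p p + Polynomial.smult (\<kappa> b) p + [:0, \<kappa> c:]))) - 1 = x t * U" .
  \<comment> \<open>At zero the terms containing \<open>F2\<close>, \<open>H2\<close> or
    \<open>H\<close> vanish and \<open>F\<close> is \<open>1\<close>, so only the power of
    \<open>G1\<close> remains.\<close>
  have "poly U 0 = - ((poly G1 0 ^ q) ^ (q - 1))"
    using q ft F0[folded poly_0_coeff_0]
    by (simp add: U_def x_def poly_monom zero_power H20 H0)
  then have "Polynomial.coeff U 0 \<noteq> 0"
    using G10 by (simp add: poly_0_coeff_0)
  with 1 show ?thesis
    unfolding x_def t_def \<gamma>_def by blast
qed

end

section \<open>The absolute value\<close>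

context completed_alg_closure
begin

definition nrm :: "'c \<Rightarrow> real" where
  "nrm x = dist x 0"

definition \<kappa> :: "'f \<Rightarrow> 'c" where
  "\<kappa> c = \<iota> (fls_const c)"

definition T :: 'c where
  "T = \<iota> fls_X_inv"

lemma dist_eq_nrm: "dist x y = nrm (x - y)"
  using dist_translate[of x "- y" y] by (simp add: nrm_def)

lemma nrm_0 [simp]: "nrm 0 = 0"
  by (simp add: nrm_def)

lemma nrm_eq_0_iff [simp]: "nrm x = 0 \<longleftrightarrow> x = 0"
  by (simp add: nrm_def)

lemma nrm_nonneg [simp]: "nrm x \<ge> 0"
  by (simp add: nrm_def)

lemma nrm_pos_iff [simp]: "nrm x > 0 \<longleftrightarrow> x \<noteq> 0"
  by (simp add: nrm_def)

lemma nrm_mult: "nrm (x * y) = nrm x * nrm y"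
  by (simp add: nrm_def abs_mult)

lemma nrm_1 [simp]: "nrm 1 = 1"
  using nrm_mult[of 1 1] by simp

lemma nrm_uminus [simp]: "nrm (- x) = nrm x"
  using dist_eq_nrm[of 0 x] by (simp add: nrm_def dist_commute)

lemma nrm_minus_commute: "nrm (x - y) = nrm (y - x)"
  by (metis nrm_uminus minus_diff_eq)

lemma nrm_add_le_max: "nrm (x + y) \<le> max (nrm x) (nrm y)"
  by (simp add: nrm_def abs_ultrametric)

lemma nrm_diff_le_max: "nrm (x - y) \<le> max (nrm x) (nrm y)"
  using nrm_add_le_max[of x "- y"] by simp

lemma nrm_add_le: "nrm x \<le> C \<Longrightarrow> nrm y \<le> C \<Longrightarrow> nrm (x + y) \<le> C"
  using nrm_add_le_max[of x y] by linarith

lemma nrm_diff_le: "nrm x \<le> C \<Longrightarrow> nrm y \<le> C \<Longrightarrow> nrm (x - y) \<le> C"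
  using nrm_diff_le_max[of x y] by linarith

lemma nrm_add_eq:
  assumes "nrm y < nrm x"
  shows "nrm (x + y) = nrm x"
  using nrm_add_le_max[of x y] nrm_diff_le_max[of "x + y" y] assms by simp

lemma nrm_sum_le:
  assumes "0 \<le> C" and "\<And>i. i \<in> A \<Longrightarrow> nrm (f i) \<le> C"
  shows "nrm (sum f A) \<le> C"
  using assms by (induction A rule: infinite_finite_induct) (auto intro: nrm_add_le)

lemma nrm_power: "nrm (x ^ n) = nrm x ^ n"
  by (induction n) (auto simp: nrm_mult)

lemma nrm_inverse: "nrm (inverse x) = inverse (nrm x)"
proof (cases "x = 0")
  case False
  then have "nrm x * nrm (inverse x) = 1"
    by (simp flip: nrm_mult)
  then show ?thesis
    by (metis inverse_unique)
qed simp

lemma nrm_divide: "nrm (x / y) = nrm x / nrm y"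
  by (simp add: divide_inverse nrm_mult nrm_inverse)

text \<open>A term of strictly largest absolute value determines the absolute value of the sum, so
  it cannot be cancelled by the others.\<close>

lemma sum_nonzero_if_inj_on_nrm:
  assumes "finite A" "A \<noteq> {}" and "inj_on (\<lambda>i. nrm (f i)) A" and "\<And>i. i \<in> A \<Longrightarrow> f i \<noteq> 0"
  shows "sum f A \<noteq> 0"
proof -
  have "Max ((\<lambda>i. nrm (f i)) ` A) \<in> (\<lambda>i. nrm (f i)) ` A"
    using assms by (intro Max_in) auto
  then obtain m where m: "m \<in> A" "Max ((\<lambda>i. nrm (f i)) ` A) = nrm (f m)"
    by auto
  have less: "nrm (f i) < nrm (f m)" if "i \<in> A - {m}" for i
  proof -
    have "nrm (f i) \<le> nrm (f m)"
      unfolding m(2)[symmetric] using assms(1) that by (intro Max_ge) auto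
    moreover have "nrm (f i) \<noteq> nrm (f m)"
      using inj_onD[OF assms(3), of i m] that m by auto
    ultimately show ?thesis
      by simp
  qed
  have "nrm (sum f (A - {m})) < nrm (f m)"
  proof (cases "A - {m} = {}")
    case True
    then show ?thesis
      using assms(4)[OF m(1)] by (simp only: sum.empty nrm_0 nrm_pos_iff not_False_eq_True)
  next
    case False
    let ?M = "Max ((\<lambda>i. nrm (f i)) ` (A - {m}))"
    have "?M \<in> (\<lambda>i. nrm (f i)) ` (A - {m})"
      using assms False by (intro Max_in) auto
    then obtain i where "i \<in> A - {m}" "?M = nrm (f i)"
      by auto
    then have "?M < nrm (f m)" "0 \<le> ?M"
      using less by simp_all
    moreover have "nrm (sum f (A - {m})) \<le> ?M"
      using assms \<open>0 \<le> ?M\<close> by (intro nrm_sum_le) (auto intro: Max_ge)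
    ultimately show ?thesis
      by simp
  qed
  then have "nrm (sum f A) = nrm (f m)"
    using nrm_add_eq m assms(1) by (simp add: sum.remove)
  then show ?thesis
    using assms(4)[OF m(1)] by auto
qed

lemma emb_0 [simp]: "\<iota> 0 = 0"
  using emb_add[of 0 0] by (metis add_cancel_right_right add.right_neutral)

lemma emb_uminus: "\<iota> (- x) = - \<iota> x"
  using emb_add[of x "- x"] by (simp add: eq_neg_iff_add_eq_0 add.commute)

lemma emb_diff: "\<iota> (x - y) = \<iota> x - \<iota> y"
  using emb_add[of x "- y"] by (simp add: emb_uminus)

lemma nrm_emb: "nrm (\<iota> x) = abs_Kinf x"
  by (simp add: nrm_def abs_emb)

lemma nrm_T: "nrm T = real CARD('f)"
  by (simp add: T_def nrm_emb abs_Kinf_def)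

lemma card_gt_1: "real CARD('f) > 1"
  using card_finite_field_ge_2[where ?'f = 'f] by simp

lemma T_nonzero [simp]: "T \<noteq> 0"
  using nrm_T card_gt_1 nrm_eq_0_iff[of T] by linarith

lemma nrm_kappa: "nrm (\<kappa> c) = (if c = 0 then 0 else 1)"
  by (simp add: \<kappa>_def nrm_emb abs_Kinf_def)

sublocale finite_field_extension \<kappa>
proof
  show "\<kappa> 1 = 1"
    by (simp add: \<kappa>_def emb_one)
  show "\<kappa> (x + y) = \<kappa> x + \<kappa> y" "\<kappa> (x * y) = \<kappa> x * \<kappa> y" for x y
    by (simp_all add: \<kappa>_def flip: emb_add emb_mult fls_plus_const)
  \<comment> \<open>The powers of \<open>T\<close> have pairwise different absolute values, so the
    field is infinite.\<close>
  have "inj (\<lambda>n::nat. T ^ n)"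
  proof (rule injI)
    fix m n :: nat assume "T ^ m = T ^ n"
    then have "real CARD('f) ^ m = real CARD('f) ^ n"
      by (metis nrm_T nrm_power)
    then show "m = n"
      using card_gt_1 by (simp add: power_inject_exp)
  qed
  then show "infinite (UNIV :: 'c set)"
    using finite_imageD finite_subset infinite_UNIV_nat by (metis subset_UNIV)
qed

section \<open>The ring A inside the complete field\<close>

lemma A_emb_0 [simp]: "A_emb \<iota> 0 = 0"
  by (simp add: A_emb_def A_to_Kinf_def)

lemma A_emb_pCons: "A_emb \<iota> (pCons c p) = \<kappa> c + T * A_emb \<iota> p"
  by (simp add: A_emb_def A_to_Kinf_def map_poly_pCons emb_add emb_mult \<kappa>_def T_def)

lemma A_emb_const [simp]: "A_emb \<iota> [:c:] = \<kappa> c"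
  by (simp add: A_emb_pCons)

lemma A_emb_T [simp]: "A_emb \<iota> [:0, 1:] = T"
  by (simp add: A_emb_pCons)

lemma A_emb_add: "A_emb \<iota> (a + b) = A_emb \<iota> a + A_emb \<iota> b"
proof (induction a arbitrary: b)
  case (pCons c p)
  then show ?case
    by (cases b) (simp add: A_emb_pCons kappa_add algebra_simps)
qed simp

lemma A_emb_smult: "A_emb \<iota> (Polynomial.smult c a) = \<kappa> c * A_emb \<iota> a"
  by (induction a) (simp_all add: A_emb_pCons kappa_mult algebra_simps)

lemma A_emb_mult: "A_emb \<iota> (a * b) = A_emb \<iota> a * A_emb \<iota> b"
  by (induction a) (simp_all add: A_emb_pCons A_emb_add A_emb_smult algebra_simps)

lemma A_emb_uminus: "A_emb \<iota> (- a) = - A_emb \<iota> a"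
  using A_emb_add[of a "- a"] by (simp add: eq_neg_iff_add_eq_0 add.commute)

lemma A_emb_diff: "A_emb \<iota> (a - b) = A_emb \<iota> a - A_emb \<iota> b"
  using A_emb_add[of a "- b"] by (simp add: A_emb_uminus)

text \<open>In \<open>\<kappa> c + T * A_emb \<iota> p\<close> with \<open>p \<noteq> 0\<close> the
  second summand has absolute value above \<open>1\<close> and dominates the constant.\<close>

lemma nrm_A_emb: "a \<noteq> 0 \<Longrightarrow> nrm (A_emb \<iota> a) = real CARD('f) ^ degree a"
proof (induction a)
  case (pCons c p)
  show ?case
  proof (cases "p = 0")
    case True
    then show ?thesis
      using pCons.hyps by (simp add: nrm_kappa)
  next
    case False
    then have *: "nrm (T * A_emb \<iota> p) = real CARD('f) ^ degree (pCons c p)"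
      using pCons.IH by (simp add: nrm_mult nrm_T)
    have "1 < real CARD('f) ^ degree (pCons c p)"
      using False card_gt_1 by (intro one_less_power) auto
    then have "nrm (\<kappa> c) < nrm (T * A_emb \<iota> p)"
      unfolding * by (simp add: nrm_kappa)
    then show ?thesis
      using nrm_add_eq * by (simp add: A_emb_pCons add.commute)
  qed
qed simp

lemma nrm_A_emb_ge_1: "a \<noteq> 0 \<Longrightarrow> nrm (A_emb \<iota> a) \<ge> 1"
  using card_gt_1 by (simp add: nrm_A_emb)

section \<open>Limit laws for the ultrametric absolute value\<close>

lemma tendsto_nrm: "(X \<longlongrightarrow> L) F \<Longrightarrow> ((\<lambda>n. nrm (X n)) \<longlongrightarrow> nrm L) F"
  unfolding nrm_def by (intro tendsto_intros)

lemma tendsto_iff_nrm: "(X \<longlongrightarrow> L) F \<longleftrightarrow> ((\<lambda>n. nrm (X n - L)) \<longlongrightarrow> 0) F"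
  by (subst tendsto_dist_iff) (simp add: dist_eq_nrm)

lemma tendsto_if_nrm_le:
  assumes "(g \<longlongrightarrow> 0) F" and "eventually (\<lambda>n. nrm (X n - L) \<le> g n) F"
  shows "(X \<longlongrightarrow> L) F"
  unfolding tendsto_iff_nrm
  by (rule tendsto_sandwich[OF _ assms(2) tendsto_const assms(1)]) simp

text \<open>The sort of \<open>'c\<close> provides a field and a complete metric but no
  compatibility between them; continuity of the field operations comes from the locale axioms
  through \<open>nrm\<close>.\<close>

lemma tendsto_add_nrm:
  fixes L M :: 'c
  assumes "(X \<longlongrightarrow> L) F" "(Y \<longlongrightarrow> M) F"
  shows "((\<lambda>n. X n + Y n) \<longlongrightarrow> L + M) F"
proof (rule tendsto_if_nrm_le)
  show "((\<lambda>n. nrm (X n - L) + nrm (Y n - M)) \<longlongrightarrow> 0) F"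
    using tendsto_add[OF assms[unfolded tendsto_iff_nrm]] by simp
  have "nrm (X n + Y n - (L + M)) \<le> nrm (X n - L) + nrm (Y n - M)" for n
  proof -
    have "nrm (X n + Y n - (L + M)) = nrm ((X n - L) + (Y n - M))"
      by (simp add: algebra_simps)
    also have "\<dots> \<le> max (nrm (X n - L)) (nrm (Y n - M))"
      by (rule nrm_add_le_max)
    also have "\<dots> \<le> nrm (X n - L) + nrm (Y n - M)"
      using nrm_nonneg[of "X n - L"] nrm_nonneg[of "Y n - M"] by linarith
    finally show ?thesis .
  qed
  then show "eventually (\<lambda>n. nrm (X n + Y n - (L + M)) \<le> nrm (X n - L) + nrm (Y n - M)) F"
    by simp
qed

lemma tendsto_mult_nrm:
  fixes L M :: 'c
  assumes "(X \<longlongrightarrow> L) F" "(Y \<longlongrightarrow> M) F"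
  shows "((\<lambda>n. X n * Y n) \<longlongrightarrow> L * M) F"
proof (rule tendsto_if_nrm_le)
  have "((\<lambda>n. nrm (X n - L) * nrm (Y n) + nrm L * nrm (Y n - M)) \<longlongrightarrow> 0 * nrm M + nrm L * 0) F"
    using assms[unfolded tendsto_iff_nrm] tendsto_nrm[OF assms(2)] by (intro tendsto_intros)
  then show "((\<lambda>n. nrm (X n - L) * nrm (Y n) + nrm L * nrm (Y n - M)) \<longlongrightarrow> 0) F"
    by simp
  have "nrm (X n * Y n - L * M) \<le> nrm (X n - L) * nrm (Y n) + nrm L * nrm (Y n - M)" for n
  proof -
    have "nrm (X n * Y n - L * M) = nrm ((X n - L) * Y n + L * (Y n - M))"
      by (simp add: algebra_simps)
    also have "\<dots> \<le> max (nrm ((X n - L) * Y n)) (nrm (L * (Y n - M)))"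
      by (rule nrm_add_le_max)
    also have "\<dots> \<le> nrm ((X n - L) * Y n) + nrm (L * (Y n - M))"
      using nrm_nonneg[of "(X n - L) * Y n"] nrm_nonneg[of "L * (Y n - M)"] by linarith
    finally show ?thesis
      by (simp add: nrm_mult)
  qed
  then show "eventually (\<lambda>n. nrm (X n * Y n - L * M)
      \<le> nrm (X n - L) * nrm (Y n) + nrm L * nrm (Y n - M)) F"
    by simp
qed

lemma tendsto_diff_nrm:
  fixes L M :: 'c
  assumes "(X \<longlongrightarrow> L) F" "(Y \<longlongrightarrow> M) F"
  shows "((\<lambda>n. X n - Y n) \<longlongrightarrow> L - M) F"
  using tendsto_add_nrm[OF assms(1) tendsto_mult_nrm[OF tendsto_const[of "- 1"] assms(2)]]
  by simp

lemma tendsto_prod_nrm: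
  fixes L :: "'i \<Rightarrow> 'c"
  assumes "\<And>i. i \<in> A \<Longrightarrow> ((\<lambda>n. X i n) \<longlongrightarrow> L i) F"
  shows "((\<lambda>n. \<Prod>i\<in>A. X i n) \<longlongrightarrow> (\<Prod>i\<in>A. L i)) F"
  using assms
  by (induction A rule: infinite_finite_induct) (auto intro: tendsto_mult_nrm)

lemma nrm_inverse_diff:
  assumes "x \<noteq> 0" "y \<noteq> 0"
  shows "nrm (inverse x - inverse y) = nrm (x - y) / (nrm x * nrm y)"
proof -
  have "inverse x - inverse y = (y - x) / (x * y)"
    using assms by (simp add: field_simps)
  then show ?thesis
    by (simp add: nrm_divide nrm_mult nrm_minus_commute)
qed

lemma tendsto_inverse_nrm:
  fixes L :: 'c
  assumes "(X \<longlongrightarrow> L) F" "L \<noteq> 0"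
  shows "((\<lambda>n. inverse (X n)) \<longlongrightarrow> inverse L) F"
proof (rule tendsto_if_nrm_le)
  have "((\<lambda>n. nrm (X n - L) / (nrm (X n) * nrm L)) \<longlongrightarrow> 0 / (nrm L * nrm L)) F"
    using assms(1)[unfolded tendsto_iff_nrm] tendsto_nrm[OF assms(1)] assms(2)
    by (intro tendsto_intros) auto
  then show "((\<lambda>n. nrm (X n - L) / (nrm (X n) * nrm L)) \<longlongrightarrow> 0) F"
    by simp
  have "eventually (\<lambda>n. X n \<noteq> 0) F"
    using assms by (rule tendsto_imp_eventually_ne)
  then show "eventually (\<lambda>n. nrm (inverse (X n) - inverse L)
      \<le> nrm (X n - L) / (nrm (X n) * nrm L)) F"
    by eventually_elim (simp add: nrm_inverse_diff assms(2))
qed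

end

section \<open>The space of period vectors\<close>

text \<open>Koenig's lemma: a prefix is extended one digit at a time, and as \<open>D\<close> is
  finite, some next digit keeps infinitely many of the sequences \<open>h k\<close>.\<close>

lemma exists_infinitely_often_prefix:
  fixes h :: "nat \<Rightarrow> nat \<Rightarrow> 'd"
  assumes "finite D" and "\<And>k j. h k j \<in> D"
  shows "\<exists>f. \<forall>n. infinite {k. \<forall>j<n. h k j = f j}"
proof -
  define P where "P n xs \<longleftrightarrow> length xs = n \<and> infinite {k. \<forall>j<n. h k j = xs ! j}" for n xs
  have "\<exists>L. \<forall>n. P n (L n) \<and> (\<exists>d. L (Suc n) = L n @ [d])"
  proof (rule dependent_nat_choice)
    show "\<exists>xs. P 0 xs"
      by (auto simp: P_def)
    fix xs n assume xs: "P n xs"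
    let ?S = "{k. \<forall>j<n. h k j = xs ! j}"
    have "infinite ?S"
      using xs by (simp add: P_def)
    moreover have "finite ((\<lambda>k. h k n) ` ?S)"
      by (rule finite_subset[OF _ assms(1)]) (use assms(2) in auto)
    ultimately obtain k0 where k0: "infinite {k \<in> ?S. h k n = h k0 n}"
      using pigeonhole_infinite by blast
    have "{k \<in> ?S. h k n = h k0 n} \<subseteq> {k. \<forall>j<Suc n. h k j = (xs @ [h k0 n]) ! j}"
      using xs by (auto simp: P_def nth_append less_Suc_eq)
    with k0 have "infinite {k. \<forall>j<Suc n. h k j = (xs @ [h k0 n]) ! j}"
      using infinite_super by blast
    then have "P (Suc n) (xs @ [h k0 n])"
      using xs by (simp add: P_def)
    then show "\<exists>ys. P (Suc n) ys \<and> (\<exists>d. ys = xs @ [d])"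
      by blast
  qed
  then obtain L where L: "\<And>n. P n (L n)" "\<And>n. \<exists>d. L (Suc n) = L n @ [d]"
    by blast
  have prefix: "L n ! j = L (Suc j) ! j" if "j < n" for n j
    using that
  proof (induction n)
    case (Suc n)
    obtain d where d: "L (Suc n) = L n @ [d]"
      using L(2) by blast
    have "length (L n) = n"
      using L(1) by (simp add: P_def)
    with Suc d show ?case
      by (cases "j = n") (auto simp: nth_append)
  qed simp
  have "{k. \<forall>j<n. h k j = L n ! j} = {k. \<forall>j<n. h k j = L (Suc j) ! j}" for n
    by (rule Collect_cong) (metis prefix)
  moreover have "infinite {k. \<forall>j<n. h k j = L n ! j}" for n
    using L(1) by (simp add: P_def)
  ultimately show ?thesis
    by (intro exI[of _ "\<lambda>j. L (Suc j) ! j"]) simp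
qed

lemma abs_Kinf_nonneg [simp]: "abs_Kinf x \<ge> 0"
  by (simp add: abs_Kinf_def)

lemma abs_Kinf_le:
  fixes x :: "'f::{field,finite} fls"
  assumes "\<And>j. j < int n \<Longrightarrow> fls_nth x j = 0"
  shows "abs_Kinf x \<le> 1 / real CARD('f) ^ n"
proof (cases "x = 0")
  case False
  then have "fls_subdegree x \<ge> int n"
    using assms by (intro fls_subdegree_geI) auto
  then have "real CARD('f) powi (- fls_subdegree x) \<le> real CARD('f) powi (- int n)"
    using card_finite_field_ge_2[where ?'f = 'f] by (intro power_int_increasing) auto
  also have "\<dots> = 1 / real CARD('f) ^ n"
    by (simp add: power_int_minus divide_inverse)
  finally show ?thesis
    using False by (simp add: abs_Kinf_def)
qed (simp add: abs_Kinf_def)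

lemma abs_Kinf_le_1D:
  fixes x :: "'f::{field,finite} fls"
  assumes "abs_Kinf x \<le> 1" "j < 0"
  shows "fls_nth x j = 0"
proof (cases "x = 0")
  case False
  have "fls_subdegree x \<ge> 0"
  proof (rule ccontr)
    assume "\<not> fls_subdegree x \<ge> 0"
    then have "real CARD('f) powi 0 < real CARD('f) powi (- fls_subdegree x)"
      using card_finite_field_ge_2[where ?'f = 'f] by (intro power_int_strict_increasing) auto
    then show False
      using assms False by (simp add: abs_Kinf_def)
  qed
  then show ?thesis
    using assms by (intro fls_eq0_below_subdegree) simp
qed simp

context completed_alg_closure
begin

text \<open>The powers of an \<open>(r-1)\<close>-st root of \<open>T\<close> have values in distinct classes modulo those of \<open>K\<^sub>\<infinity>\<close>.\<close>

lemma Omega_nonempty: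
  assumes "r \<ge> 2"
  shows "Omega \<iota> r \<noteq> {}"
proof -
  define s where "s = r - 1"
  have s: "s > 0"
    using assms by (simp add: s_def)
  \<comment> \<open>A root of \<open>X^s - T\<close> is wanted; the coefficients are images under
    \<open>\<iota>\<close>, hence algebraic as \<open>algebraically_closed\<close> demands.\<close>
  define P where "P = Polynomial.monom 1 s + [:- T:]"
  have emb_alg: "\<iota> y \<in> algebraic_over_Kinf \<iota>" for y
    unfolding algebraic_over_Kinf_def
    by (rule CollectI, rule exI[of _ "[:- y, 1:]"]) (simp add: map_poly_pCons emb_one emb_uminus)
  have "degree P = s"
    unfolding P_def using s by (subst degree_add_eq_left) (auto simp: degree_monom_eq)
  moreover have "Polynomial.coeff P n \<in> algebraic_over_Kinf \<iota>" for n
  proof -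
    have "Polynomial.coeff P n = \<iota> ((if n = s then 1 else 0) - (if n = 0 then fls_X_inv else 0))"
      by (auto simp: P_def emb_one emb_diff T_def coeff_pCons split: nat.splits)
    then show ?thesis
      using emb_alg by simp
  qed
  ultimately obtain x where "poly P x = 0"
    using algebraically_closed[of P] s by auto
  then have x: "x ^ s = T"
    by (simp add: P_def poly_monom)
  then have nx: "nrm x ^ s = real CARD('f)"
    by (metis nrm_T nrm_power)
  \<comment> \<open>The exponents \<open>r - i\<close> run through \<open>0, ..., s - 1\<close>, one
    for each class modulo \<open>s\<close>, and \<open>\<omega> r = 1\<close>.\<close>
  define \<omega> where "\<omega> = (\<lambda>i\<in>{2..r}. x ^ (r - i))"
  have "c i = 0" if sum: "(\<Sum>i=2..r. \<iota> (c i) * \<omega> i) = 0" and i: "i \<in> {2..r}" for c i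
  proof (rule ccontr)
    assume "c i \<noteq> 0"
    define A where "A = {i \<in> {2..r}. c i \<noteq> 0}"
    have "(\<Sum>i\<in>A. \<iota> (c i) * \<omega> i) \<noteq> 0"
    proof (rule sum_nonzero_if_inj_on_nrm)
      show "A \<noteq> {}"
        using i \<open>c i \<noteq> 0\<close> by (auto simp: A_def)
      \<comment> \<open>The \<open>s\<close>-th power makes the absolute value an integral power of
        \<open>q\<close>, with exponent congruent to \<open>r - i\<close> modulo
        \<open>s\<close>.\<close>
      have val: "nrm (\<iota> (c i) * \<omega> i) ^ s
          = real CARD('f) powi (int (r - i) - fls_subdegree (c i) * int s)" if "i \<in> A" for i
      proof -
        have "nrm (\<iota> (c i) * \<omega> i) ^ s
            = (real CARD('f) powi (- fls_subdegree (c i))) ^ s * (nrm x ^ s) ^ (r - i)"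
          using that by (simp add: A_def \<omega>_def nrm_mult nrm_emb abs_Kinf_def nrm_power
              power_mult_distrib power_mult[symmetric] mult.commute)
        also have "\<dots> = real CARD('f) powi (- fls_subdegree (c i) * int s + int (r - i))"
          using card_gt_1
          by (subst power_int_add) (auto simp: nx simp del: mult_minus_left simp flip: power_int_power')
        finally show ?thesis
          by (simp add: algebra_simps)
      qed
      show "inj_on (\<lambda>i. nrm (\<iota> (c i) * \<omega> i)) A"
      proof (rule inj_onI)
        fix i j assume ij: "i \<in> A" "j \<in> A" "nrm (\<iota> (c i) * \<omega> i) = nrm (\<iota> (c j) * \<omega> j)"
        then have eq: "real CARD('f) powi (int (r - i) - fls_subdegree (c i) * int s)
            = real CARD('f) powi (int (r - j) - fls_subdegree (c j) * int s)"
          using val by metis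
        have "int (r - i) - fls_subdegree (c i) * int s = int (r - j) - fls_subdegree (c j) * int s"
          using power_int_strict_increasing[OF _ card_gt_1] eq
          by (metis less_irrefl linorder_neqE)
        then have "(int (r - i) - fls_subdegree (c i) * int s) mod int s
            = (int (r - j) - fls_subdegree (c j) * int s) mod int s"
          by simp
        then have "int (r - i) mod int s = int (r - j) mod int s"
          using mod_mult_self1[of "int (r - i)" "- fls_subdegree (c i)" "int s"]
            mod_mult_self1[of "int (r - j)" "- fls_subdegree (c j)" "int s"] by simp
        moreover have "r - i < s" "r - j < s"
          using ij by (auto simp: A_def s_def)
        ultimately have "r - i = r - j"
          by simp
        then show "i = j"
          using ij by (auto simp: A_def)
      qed
      fix i assume "i \<in> A"
      moreover have "x \<noteq> 0"
        using x s by (metis T_nonzero zero_power)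
      moreover have "\<iota> (c i) \<noteq> 0" if "c i \<noteq> 0"
        using that nrm_emb[of "c i"] card_gt_1 by (auto simp: abs_Kinf_def)
      ultimately show "\<iota> (c i) * \<omega> i \<noteq> 0"
        by (auto simp: A_def \<omega>_def)
    qed (simp add: A_def)
    moreover have "(\<Sum>i\<in>A. \<iota> (c i) * \<omega> i) = (\<Sum>i=2..r. \<iota> (c i) * \<omega> i)"
      by (rule sum.mono_neutral_left) (auto simp: A_def)
    ultimately show False
      using sum by simp
  qed
  then have "\<omega> \<in> Omega \<iota> r"
    using assms by (auto simp: Omega_def \<omega>_def)
  then show ?thesis
    by auto
qed

text \<open>A compactness argument, which works because the residue field of \<open>K\<^sub>\<infinity>\<close> is finite.\<close>

lemma Omega_in_affinoid:
  assumes \<omega>: "\<omega> \<in> Omega \<iota> r" and r: "r \<ge> 2"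
  shows "\<exists>n. \<omega> \<in> Omega_affinoid \<iota> r n"
proof (rule ccontr)
  assume not: "\<not> ?thesis"
  define M where "M = Max ((\<lambda>j. nrm (\<omega> j)) ` {2..r})"
  have M: "nrm (\<omega> j) \<le> M" if "j \<in> {2..r}" for j
    unfolding M_def using that by (intro Max_ge) auto
  have "\<omega> r = 1"
    using \<omega> by (simp add: Omega_def)
  then have M1: "M \<ge> 1"
    using M[of r] r by simp
  let ?q = "real CARD('f)"
  have qn: "?q ^ n > 0" for n
    using card_gt_1 by simp
  define S where "S c = (\<Sum>k=2..r. \<iota> (c k) * \<omega> k)" for c
  \<comment> \<open>The failing affinoid conditions, divided by a coefficient of largest absolute
    value, give integral vectors with a coordinate \<open>1\<close> at which \<open>S\<close>
    becomes arbitrarily small.\<close>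
  have "\<exists>c. (\<forall>i\<in>{2..r}. abs_Kinf (c i) \<le> 1) \<and> (\<exists>i\<in>{2..r}. c i = 1) \<and> nrm (S c) < M / ?q ^ n" for n
  proof -
    obtain c i j where ij: "i \<in> {2..r}" "j \<in> {2..r}"
      and less: "nrm (S c) < abs_Kinf (c i) * nrm (\<omega> j) / ?q ^ n"
      using not \<omega> unfolding Omega_affinoid_def S_def nrm_def[symmetric] by (force simp: not_le)
    have "Max ((\<lambda>j. abs_Kinf (c j)) ` {2..r}) \<in> (\<lambda>j. abs_Kinf (c j)) ` {2..r}"
      using r by (intro Max_in) auto
    then obtain m where m: "m \<in> {2..r}" "Max ((\<lambda>j. abs_Kinf (c j)) ` {2..r}) = abs_Kinf (c m)"
      by auto
    have max: "abs_Kinf (c j) \<le> abs_Kinf (c m)" if "j \<in> {2..r}" for j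
      unfolding m(2)[symmetric] using that by (intro Max_ge) auto
    have "abs_Kinf (c i) * nrm (\<omega> j) / ?q ^ n \<le> abs_Kinf (c m) * M / ?q ^ n"
      using max[OF ij(1)] M[OF ij(2)] qn[of n] by (intro divide_right_mono mult_mono) auto
    with less have less': "nrm (S c) < abs_Kinf (c m) * M / ?q ^ n"
      by simp
    then have "0 < abs_Kinf (c m) * M / ?q ^ n"
      using nrm_nonneg[of "S c"] by linarith
    then have cm: "c m \<noteq> 0"
      by (auto simp: abs_Kinf_def)
    then have acm: "abs_Kinf (c m) > 0"
      using card_gt_1 by (simp add: abs_Kinf_def)
    define c' where "c' j = c j / c m" for j
    have emb: "\<iota> (c j) = \<iota> (c m) * \<iota> (c' j)" for j
      using cm by (simp add: c'_def flip: emb_mult)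
    have "S c = \<iota> (c m) * S c'"
      unfolding S_def sum_distrib_left 
    proof (rule sum.cong)
      fix k
      show "\<iota> (c k) * \<omega> k = \<iota> (c m) * (\<iota> (c' k) * \<omega> k)"
        by (subst emb[of k]) (simp add: mult.assoc)
    qed simp
    then have "nrm (S c) = abs_Kinf (c m) * nrm (S c')"
      by (simp add: nrm_mult nrm_emb)
    with less' have "nrm (S c') < M / ?q ^ n"
      using acm by (simp add: field_simps)
    moreover have "c' m = 1"
      using cm by (simp add: c'_def)
    moreover have "abs_Kinf (c' j) \<le> 1" if "j \<in> {2..r}" for j
    proof -
      have "abs_Kinf (c j) = abs_Kinf (c m) * abs_Kinf (c' j)"
        using arg_cong[OF emb[of j], of nrm] by (simp add: nrm_mult nrm_emb)
      with max[OF that] acm show ?thesis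
        by (metis mult_le_cancel_left_pos mult.right_neutral)
    qed
    ultimately show ?thesis
      using m(1) by blast
  qed
  then obtain c where c1: "\<And>n i. i \<in> {2..r} \<Longrightarrow> abs_Kinf (c n i) \<le> 1"
    and c2: "\<And>n. \<exists>i\<in>{2..r}. c n i = 1" and c3: "\<And>n. nrm (S (c n)) < M / ?q ^ n"
    by metis
  \<comment> \<open>The \<open>j\<close>-th digits of all coordinates at once, so that the alphabet
    is a finite set of functions on \<open>{2..r}\<close>; digits of negative index vanish by
    \<open>c1\<close>.\<close>
  define h where "h n j = (\<lambda>i\<in>{2..r}. fls_nth (c n i) (int j))" for n j
  have "\<exists>f. \<forall>n. infinite {k. \<forall>j<n. h k j = f j}"
    by (rule exists_infinitely_often_prefix[of "{2..r} \<rightarrow>\<^sub>E UNIV"]) (auto simp: h_def intro: finite_PiE)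
  then obtain f where f: "\<And>n. infinite {k. \<forall>j<n. h k j = f j}"
    by blast
  define x where "x i = fps_to_fls (Abs_fps (\<lambda>j. f j i))" for i
  have "nrm (S x) \<le> M / ?q ^ n" for n
  proof -
    \<comment> \<open>Infinitely many \<open>k\<close> share the prefix, so one can be taken with
      \<open>k \<ge> n\<close>: then \<open>S (c k)\<close> is small, and agreement in the first
      \<open>n\<close> digits bounds the difference to \<open>S x\<close>.\<close>
    have "\<exists>k\<ge>n. k \<in> {k. \<forall>j<n. h k j = f j}"
      using f[of n] unfolding infinite_nat_iff_unbounded_le by blast
    then obtain k where k: "k \<ge> n" "\<And>j. j < n \<Longrightarrow> h k j = f j"
      by auto
    have diff: "abs_Kinf (x i - c k i) \<le> 1 / ?q ^ n" if i: "i \<in> {2..r}" for i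
    proof (rule abs_Kinf_le)
      fix j assume "j < int n"
      show "fls_nth (x i - c k i) j = 0"
      proof (cases "j < 0")
        case True
        then show ?thesis
          using abs_Kinf_le_1D[OF c1[OF i]] by (simp add: x_def)
      next
        case False
        then have "f (nat j) i = fls_nth (c k i) j"
          using fun_cong[OF k(2)[of "nat j"], of i] \<open>j < int n\<close> i by (simp add: h_def)
        then show ?thesis
          using False by (simp add: x_def)
      qed
    qed
    have "S x = S (c k) + S (\<lambda>i. x i - c k i)"
      unfolding S_def sum.distrib[symmetric]
      by (rule sum.cong) (simp_all add: emb_diff algebra_simps)
    moreover have "nrm (S (c k)) \<le> M / ?q ^ n"
    proof -
      have "M / ?q ^ k \<le> M / ?q ^ n"
        using M1 k(1) card_gt_1 by (intro divide_left_mono power_increasing) auto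
      then show ?thesis
        using c3[of k] by linarith
    qed
    moreover have "nrm (S (\<lambda>i. x i - c k i)) \<le> M / ?q ^ n"
      unfolding S_def
    proof (rule nrm_sum_le)
      fix i assume i: "i \<in> {2..r}"
      have "nrm (\<iota> (x i - c k i) * \<omega> i) \<le> 1 / ?q ^ n * M"
        unfolding nrm_mult nrm_emb using diff[OF i] M[OF i] by (intro mult_mono) auto
      then show "nrm (\<iota> (x i - c k i) * \<omega> i) \<le> M / ?q ^ n"
        by simp
    qed (use M1 in simp)
    ultimately show ?thesis
      using nrm_add_le by simp
  qed
  moreover have "(\<lambda>n. M / ?q ^ n) \<longlonglongrightarrow> 0"
    by (rule LIMSEQ_divide_realpow_zero[OF card_gt_1])
  ultimately have "nrm (S x) \<le> 0"
    by (intro tendsto_lowerbound[of "\<lambda>n. M / ?q ^ n" 0 sequentially]) auto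
  then have "S x = 0"
    using nrm_nonneg[of "S x"] by (simp flip: nrm_eq_0_iff)
  then have x0: "x i = 0" if "i \<in> {2..r}" for i
    using \<omega> that by (auto simp: Omega_def S_def)
  \<comment> \<open>The normalisation survives in digit zero: some \<open>c k\<close> with the same
    digits there has a coordinate \<open>1\<close>, so that coordinate of \<open>x\<close> is
    nonzero.\<close>
  obtain k where k: "h k 0 = f 0"
    using f[of 1] by (metis (mono_tags, lifting) mem_Collect_eq not_finite_existsD zero_less_one)
  obtain i where i: "i \<in> {2..r}" "c k i = 1"
    using c2 by blast
  have "f 0 i = 1"
    using fun_cong[OF k, of i] i by (simp add: h_def)
  then have "fls_nth (x i) 0 = 1"
    by (simp add: x_def)
  then show False
    using x0[OF i(1)] by simp
qed

end

section \<open>The lattice exponential\<close>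

context finite_field_extension
begin

definition sub_exp :: "'a set \<Rightarrow> 'a \<Rightarrow> 'a" where
  "sub_exp V z = z * (\<Prod>v\<in>V - {0}. 1 - z / v)"

lemma uminus_image_subspace: "fq_subspace V \<Longrightarrow> uminus ` V = V"
proof -
  assume V: "fq_subspace V"
  then have "0 \<in> V"
    by (simp add: fq_subspace_def)
  then have neg: "- v \<in> V" if "v \<in> V" for v
    using subspace_diff[OF V, of 0 v] that by simp
  show ?thesis
  proof (intro equalityI subsetI)
    fix v assume "v \<in> V"
    then show "v \<in> uminus ` V"
      using neg by (intro image_eqI[of _ _ "- v"]) auto
  qed (use neg in auto)
qed

text \<open>A subspace is symmetric under negation, so \<open>1 - z / v\<close> may be replaced by
  \<open>(z + v) / v\<close>; the factor \<open>z\<close> accounts for \<open>v = 0\<close>.\<close>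

lemma sub_exp_eq_poly:
  assumes "finite V" "fq_subspace V"
  shows "sub_exp V z = poly (\<Prod>v\<in>V. [:v, 1:]) z / (\<Prod>v\<in>V - {0}. v)"
proof -
  have 0: "0 \<in> V"
    using assms(2) by (simp add: fq_subspace_def)
  have "(\<Prod>v\<in>V - {0}. 1 - z / v) = (\<Prod>v\<in>V - {0}. 1 + z / v)"
    by (rule prod.reindex_bij_witness[of _ uminus uminus])
      (use uminus_image_subspace[OF assms(2)] in auto)
  also have "\<dots> = (\<Prod>v\<in>V - {0}. (z + v) / v)"
    by (rule prod.cong) (auto simp: field_simps)
  finally show ?thesis
    using prod.remove[OF assms(1) 0, of "\<lambda>v. z + v"]
    by (simp add: sub_exp_def poly_prod prod_dividef add.commute)
qed

lemma sub_exp_add: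
  assumes "finite V" "fq_subspace V"
  shows "sub_exp V (x + y) = sub_exp V x + sub_exp V y"
  unfolding sub_exp_eq_poly[OF assms] poly_q_poly_add[OF q_poly_prod_subspace[OF assms]]
  by (rule add_divide_distrib)

lemma sub_exp_kappa:
  assumes "finite V" "fq_subspace V"
  shows "sub_exp V (\<kappa> c * x) = \<kappa> c * sub_exp V x"
  unfolding sub_exp_eq_poly[OF assms] poly_q_poly_kappa[OF q_poly_prod_subspace[OF assms]]
  by simp

lemma sub_exp_eq_0_iff:
  assumes "finite V" "fq_subspace V"
  shows "sub_exp V z = 0 \<longleftrightarrow> z \<in> V"
proof -
  have "sub_exp V z = 0 \<longleftrightarrow> (\<exists>v\<in>V. v + z = 0)"
    using assms(1) by (simp add: sub_exp_eq_poly[OF assms] poly_prod)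
  also have "\<dots> \<longleftrightarrow> z \<in> uminus ` V"
    by (metis (no_types, lifting) add_eq_0_iff image_iff)
  finally show ?thesis
    by (simp add: uminus_image_subspace[OF assms(2)])
qed

text \<open>\<open>V\<close> is the disjoint union of the cosets \<open>u i + W\<close>. The trivial
  one contributes \<open>e_W(z)\<close>; any other contributes
  \<open>\<Prod>(u - z + w) / (u + w) = e_W(u - z) / e_W(u)\<close>, which is
  \<open>1 - e_W(z) / e_W(u)\<close> by additivity.\<close>

lemma sub_exp_cosets:
  assumes W: "finite W" "fq_subspace W" and I: "finite I" "i0 \<in> I" "u i0 = 0"
    and inj: "inj_on (\<lambda>(i, w). u i + w) (I \<times> W)"
    and V: "V = (\<lambda>(i, w). u i + w) ` (I \<times> W)"
  shows "sub_exp V z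
    = sub_exp W z * (\<Prod>i\<in>I - {i0}. 1 - sub_exp W z / sub_exp W (u i))"
proof -
  have W0: "0 \<in> W"
    using W(2) by (simp add: fq_subspace_def)
  have notin: "u i \<notin> W" if "i \<in> I - {i0}" for i
    using inj_onD[OF inj, of "(i, 0)" "(i0, u i)"] that I W0 by auto
  define f where "f v = 1 - z / v" for v
  have "V - {0} = (\<lambda>(i, w). u i + w) ` (I \<times> W - {(i0, 0)})"
    unfolding V using inj_on_image_set_diff[OF inj, of "I \<times> W" "{(i0, 0)}"] I W0 by auto
  then have "(\<Prod>v\<in>V - {0}. f v) = (\<Prod>(i, w)\<in>I \<times> W - {(i0, 0)}. f (u i + w))"
    using prod.reindex[OF inj_on_subset[OF inj Diff_subset], of f "{(i0, 0)}"]
    by (simp add: case_prod_beta comp_def)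
  also have "I \<times> W - {(i0, 0)} = ({i0} \<times> (W - {0})) \<union> ((I - {i0}) \<times> W)"
    using I W0 by auto
  also have "(\<Prod>(i, w)\<in>\<dots>. f (u i + w))
      = (\<Prod>(i, w)\<in>{i0} \<times> (W - {0}). f (u i + w)) * (\<Prod>(i, w)\<in>(I - {i0}) \<times> W. f (u i + w))"
    using W I by (intro prod.union_disjoint) auto
  also have "(\<Prod>(i, w)\<in>{i0} \<times> (W - {0}). f (u i + w)) = (\<Prod>w\<in>W - {0}. f w)"
    using I by (simp flip: prod.cartesian_product)
  also have "(\<Prod>(i, w)\<in>(I - {i0}) \<times> W. f (u i + w)) = (\<Prod>i\<in>I - {i0}. \<Prod>w\<in>W. f (u i + w))"
    by (simp add: prod.cartesian_product)
  also have "\<dots> = (\<Prod>i\<in>I - {i0}. 1 - sub_exp W z / sub_exp W (u i))"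
  proof (rule prod.cong)
    fix i assume i: "i \<in> I - {i0}"
    let ?P = "\<Prod>v\<in>W. [:v, 1:]"
    have nz: "u i + w \<noteq> 0" if "w \<in> W" for w
      using notin[OF i] that uminus_image_subspace[OF W(2)]
      by (metis add_eq_0_iff image_iff add.commute)
    have c: "(\<Prod>v\<in>W - {0}. v) \<noteq> 0"
      using W(1) by auto
    have Pu: "poly ?P (u i) \<noteq> 0"
      using nz W(1) by (auto simp: poly_prod add.commute)
    have "(\<Prod>w\<in>W. f (u i + w)) = (\<Prod>w\<in>W. ((u i - z) + w) / (u i + w))"
      by (rule prod.cong) (use nz in \<open>auto simp: f_def field_simps\<close>)
    also have "\<dots> = poly ?P (u i + \<kappa> (- 1) * z) / poly ?P (u i)"
      by (simp add: prod_dividef poly_prod add_ac kappa_uminus)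
    also have "\<dots> = 1 - poly ?P z / poly ?P (u i)"
      unfolding poly_q_poly_add[OF q_poly_prod_subspace[OF W]]
        poly_q_poly_kappa[OF q_poly_prod_subspace[OF W]]
      using Pu by (simp add: kappa_uminus field_simps)
    also have "\<dots> = 1 - sub_exp W z / sub_exp W (u i)"
      using c by (simp add: sub_exp_eq_poly[OF W])
    finally show "(\<Prod>w\<in>W. f (u i + w)) = 1 - sub_exp W z / sub_exp W (u i)" .
  qed simp
  finally show ?thesis
    by (simp add: sub_exp_def f_def)
qed

lemma sub_exp_scale:
  assumes "t \<noteq> 0"
  shows "sub_exp ((\<lambda>v. v / t) ` V) z = sub_exp V (t * z) / t"
proof -
  have "(\<lambda>v. v / t) ` V - {0} = (\<lambda>v. v / t) ` (V - {0})"
    using assms by auto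
  moreover have "inj_on (\<lambda>v. v / t) (V - {0})"
    using assms by (auto simp: inj_on_def)
  ultimately show ?thesis
    using assms by (simp add: sub_exp_def prod.reindex mult.commute)
qed

end

locale lattice_setting = completed_alg_closure \<iota>
  for \<iota> :: "'f::{field,finite} fls \<Rightarrow> 'c::{field,complete_space}" +
  fixes r :: nat
  assumes r_ge_2: "r \<ge> 2"
begin

definition polys_below :: "nat \<Rightarrow> 'f poly set" where
  "polys_below m = {p. \<forall>k\<ge>m. Polynomial.coeff p k = 0}"

text \<open>Extensional coefficient vectors index the lattice points. The index set does not depend
  on \<open>\<omega>\<close>, so products over lattice points can be studied as functions of
  \<open>\<omega>\<close>.\<close>

definition tuples :: "nat \<Rightarrow> (nat \<Rightarrow> 'f poly) set" where
  "tuples m = {2..r} \<rightarrow>\<^sub>E polys_below m"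

definition ztup :: "nat \<Rightarrow> 'f poly" where
  "ztup = (\<lambda>i\<in>{2..r}. 0)"

definition lam :: "(nat \<Rightarrow> 'c) \<Rightarrow> (nat \<Rightarrow> 'f poly) \<Rightarrow> 'c" where
  "lam \<omega> a = (\<Sum>i=2..r. A_emb \<iota> (a i) * \<omega> i)"

definition Lam :: "(nat \<Rightarrow> 'c) \<Rightarrow> nat \<Rightarrow> 'c set" where
  "Lam \<omega> m = lam \<omega> ` tuples m"

definition expn :: "(nat \<Rightarrow> 'c) \<Rightarrow> nat \<Rightarrow> 'c \<Rightarrow> 'c" where
  "expn \<omega> m z = sub_exp (Lam \<omega> m) z"

definition expL :: "(nat \<Rightarrow> 'c) \<Rightarrow> 'c \<Rightarrow> 'c" where
  "expL \<omega> z = lattice_exp (lattice_of \<iota> r \<omega>) z"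

lemma q_power_pos [simp]: "real CARD('f) ^ n > 0"
  using card_gt_1 by simp

lemma polys_below_Suc: "polys_below (Suc m) = (\<lambda>(c, p). pCons c p) ` (UNIV \<times> polys_below m)"
proof (intro equalityI subsetI)
  fix p assume p: "p \<in> polys_below (Suc m)"
  obtain c p' where [simp]: "p = pCons c p'"
    by (cases p)
  have "Polynomial.coeff p' k = 0" if "k \<ge> m" for k
    using p that unfolding polys_below_def by (auto dest: spec[of _ "Suc k"])
  then show "p \<in> (\<lambda>(c, p). pCons c p) ` (UNIV \<times> polys_below m)"
    by (intro image_eqI[of _ _ "(c, p')"]) (auto simp: polys_below_def)
qed (auto simp: polys_below_def coeff_pCons split: nat.splits)

lemma polys_below_0: "polys_below 0 = {0}"
  by (auto simp: polys_below_def poly_eq_iff)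

lemma finite_polys_below [simp]: "finite (polys_below m)"
  by (induction m) (auto simp: polys_below_0 polys_below_Suc)

lemma card_polys_below_1: "card (polys_below 1) = CARD('f)"
proof -
  have "polys_below 1 = range (\<lambda>c. [:c:])"
    using polys_below_Suc[of 0] by (auto simp: polys_below_0 image_iff)
  then show ?thesis
    by (simp add: card_image inj_on_def)
qed

lemma finite_tuples [simp]: "finite (tuples m)"
  unfolding tuples_def by (intro finite_PiE) auto

lemma card_tuples_1: "card (tuples 1) = CARD('f) ^ (r - 1)"
  using r_ge_2 by (simp add: tuples_def card_PiE card_polys_below_1[simplified])

lemma ztup_in_tuples [simp]: "ztup \<in> tuples m"
  by (auto simp: ztup_def tuples_def polys_below_def)

lemma tuples_0: "tuples 0 = {ztup}"
  by (auto simp: tuples_def polys_below_0 ztup_def PiE_iff extensional_def fun_eq_iff)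

lemma tuples_mono: "m \<le> m' \<Longrightarrow> tuples m \<subseteq> tuples m'"
  unfolding tuples_def by (intro PiE_mono) (auto simp: polys_below_def)

lemma tuples_PiE: "a \<in> tuples m \<Longrightarrow> a \<in> {2..r} \<rightarrow>\<^sub>E UNIV"
  by (auto simp: tuples_def PiE_iff)

lemma PiE_tuples: "a \<in> {2..r} \<rightarrow>\<^sub>E UNIV \<Longrightarrow> \<exists>m. a \<in> tuples m"
proof -
  assume a: "a \<in> {2..r} \<rightarrow>\<^sub>E UNIV"
  have "a i \<in> polys_below (Suc (Max ((\<lambda>i. degree (a i)) ` {2..r})))" if "i \<in> {2..r}" for i
  proof -
    have "degree (a i) \<le> Max ((\<lambda>i. degree (a i)) ` {2..r})"
      using that by (intro Max_ge) auto
    then show ?thesis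
      by (auto simp: polys_below_def intro!: coeff_eq_0)
  qed
  then have "a \<in> tuples (Suc (Max ((\<lambda>i. degree (a i)) ` {2..r})))"
    using a by (auto simp: tuples_def PiE_iff)
  then show ?thesis ..
qed

lemma tuple_nonzero:
  assumes "a \<in> {2..r} \<rightarrow>\<^sub>E UNIV" "a \<noteq> ztup"
  shows "\<exists>i\<in>{2..r}. a i \<noteq> 0"
proof (rule ccontr)
  assume "\<not> ?thesis"
  then have "a = ztup"
    using assms(1) by (auto simp: ztup_def PiE_iff extensional_def fun_eq_iff)
  then show False
    using assms(2) by simp
qed

lemma lam_cong: "(\<And>i. i \<in> {2..r} \<Longrightarrow> a i = b i) \<Longrightarrow> lam \<omega> a = lam \<omega> b"
  unfolding lam_def by (rule sum.cong) auto

lemma lam_ztup [simp]: "lam \<omega> ztup = 0"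
  by (simp add: lam_def ztup_def)

lemma lam_add: "lam \<omega> (\<lambda>i\<in>{2..r}. a i + b i) = lam \<omega> a + lam \<omega> b"
  by (simp add: lam_def A_emb_add algebra_simps sum.distrib)

lemma lam_diff: "lam \<omega> (\<lambda>i\<in>{2..r}. a i - b i) = lam \<omega> a - lam \<omega> b"
  by (simp add: lam_def A_emb_diff algebra_simps sum_subtractf)

lemma lam_mult: "lam \<omega> (\<lambda>i\<in>{2..r}. b * a i) = A_emb \<iota> b * lam \<omega> a"
  by (simp add: lam_def A_emb_mult sum_distrib_left mult.assoc)

lemma lam_smult: "lam \<omega> (\<lambda>i\<in>{2..r}. Polynomial.smult c (a i)) = \<kappa> c * lam \<omega> a"
  by (simp add: lam_def A_emb_smult sum_distrib_left mult.assoc)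

lemma finite_Lam [simp]: "finite (Lam \<omega> m)"
  by (simp add: Lam_def)

lemma subspace_Lam: "fq_subspace (Lam \<omega> m)"
  unfolding fq_subspace_def
proof (intro conjI ballI allI)
  show "0 \<in> Lam \<omega> m"
    unfolding Lam_def by (intro image_eqI[of _ _ ztup]) auto
next
  fix x y assume "x \<in> Lam \<omega> m" "y \<in> Lam \<omega> m"
  then obtain a b where "a \<in> tuples m" "b \<in> tuples m" "x = lam \<omega> a" "y = lam \<omega> b"
    by (auto simp: Lam_def)
  then show "x + y \<in> Lam \<omega> m"
    unfolding Lam_def
    by (intro image_eqI[of _ _ "\<lambda>i\<in>{2..r}. a i + b i"])
      (auto simp: lam_add tuples_def polys_below_def PiE_iff)
next
  fix c x assume "x \<in> Lam \<omega> m"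
  then obtain a where "a \<in> tuples m" "x = lam \<omega> a"
    by (auto simp: Lam_def)
  then show "\<kappa> c * x \<in> Lam \<omega> m"
    unfolding Lam_def
    by (intro image_eqI[of _ _ "\<lambda>i\<in>{2..r}. Polynomial.smult c (a i)"])
      (auto simp: lam_smult tuples_def polys_below_def PiE_iff)
qed

lemma lattice_of_eq: "lattice_of \<iota> r \<omega> = lam \<omega> ` ({2..r} \<rightarrow>\<^sub>E UNIV)"
proof (intro equalityI subsetI)
  fix x assume "x \<in> lattice_of \<iota> r \<omega>"
  then obtain a where "x = lam \<omega> a"
    by (auto simp: lattice_of_def lam_def)
  then show "x \<in> lam \<omega> ` ({2..r} \<rightarrow>\<^sub>E UNIV)"
    by (intro image_eqI[of _ _ "restrict a {2..r}"]) (auto intro: lam_cong)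
qed (auto simp: lattice_of_def lam_def)

lemma Lam_subset_lattice: "Lam \<omega> m \<subseteq> lattice_of \<iota> r \<omega>"
  unfolding Lam_def lattice_of_eq using tuples_PiE by blast

section \<open>Size of lattice points on the affinoids\<close>

lemma nrm_lam_ge:
  assumes "\<omega> \<in> Omega_affinoid \<iota> r n" "i \<in> {2..r}"
  shows "nrm (A_emb \<iota> (a i)) / real CARD('f) ^ n \<le> nrm (lam \<omega> a)"
proof -
  have "\<omega> r = 1"
    using assms by (simp add: Omega_affinoid_def Omega_def)
  moreover have "abs_Kinf (A_to_Kinf (a i)) * dist (\<omega> r) 0 / real CARD('f) ^ n
      \<le> dist (\<Sum>k=2..r. \<iota> (A_to_Kinf (a k)) * \<omega> k) 0"
    using assms r_ge_2 unfolding Omega_affinoid_def by (auto dest!: spec[of _ "\<lambda>i. A_to_Kinf (a i)"])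
  ultimately show ?thesis
    by (simp add: lam_def A_emb_def flip: nrm_emb nrm_def)
qed

text \<open>This is the affinoid condition for the coefficient vector concentrated at
  \<open>r\<close>, where the linear combination is \<open>\<omega> r = 1\<close>.\<close>

lemma nrm_omega_le:
  assumes "\<omega> \<in> Omega_affinoid \<iota> r n" "j \<in> {2..r}"
  shows "nrm (\<omega> j) \<le> real CARD('f) ^ n"
proof -
  define c :: "nat \<Rightarrow> 'f fls" where "c i = (if i = r then 1 else 0)" for i
  have "\<omega> r = 1"
    using assms by (simp add: Omega_affinoid_def Omega_def)
  have "abs_Kinf (c r) * dist (\<omega> j) 0 / real CARD('f) ^ n \<le> dist (\<Sum>k=2..r. \<iota> (c k) * \<omega> k) 0"
    using assms r_ge_2 unfolding Omega_affinoid_def by auto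
  moreover have "(\<Sum>k=2..r. \<iota> (c k) * \<omega> k) = (\<Sum>k=2..r. if k = r then 1 else 0)"
    using \<open>\<omega> r = 1\<close> by (intro sum.cong) (auto simp: c_def emb_one)
  moreover have "\<dots> = 1"
    using r_ge_2 by simp
  moreover have "abs_Kinf (c r) = 1"
    by (simp add: c_def emb_one flip: nrm_emb)
  ultimately show ?thesis
    by (simp add: field_simps flip: nrm_def)
qed

lemma nrm_lam_ge_1:
  assumes "\<omega> \<in> Omega_affinoid \<iota> r n" "a \<in> {2..r} \<rightarrow>\<^sub>E UNIV" "a \<noteq> ztup"
  shows "1 / real CARD('f) ^ n \<le> nrm (lam \<omega> a)"
proof -
  obtain i where i: "i \<in> {2..r}" "a i \<noteq> 0"
    using tuple_nonzero assms by blast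
  have "1 / real CARD('f) ^ n \<le> nrm (A_emb \<iota> (a i)) / real CARD('f) ^ n"
    using nrm_A_emb_ge_1[OF i(2)] by (intro divide_right_mono) auto
  also have "\<dots> \<le> nrm (lam \<omega> a)"
    by (rule nrm_lam_ge[OF assms(1) i(1)])
  finally show ?thesis .
qed

text \<open>A tuple outside \<open>tuples m\<close> has an entry of degree at least
  \<open>m\<close>. The bound is uniform on the affinoid and controls the factors of the exponential
  outside \<open>Lam \<omega> m\<close>.\<close>

lemma nrm_lam_ge_power:
  assumes "\<omega> \<in> Omega_affinoid \<iota> r n" "a \<in> {2..r} \<rightarrow>\<^sub>E UNIV" "a \<notin> tuples m"
  shows "real CARD('f) ^ m / real CARD('f) ^ n \<le> nrm (lam \<omega> a)"
proof -
  obtain i k where i: "i \<in> {2..r}" "k \<ge> m" "Polynomial.coeff (a i) k \<noteq> 0"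
    using assms by (auto simp: tuples_def polys_below_def PiE_iff)
  then have "a i \<noteq> 0" "degree (a i) \<ge> m"
    using le_degree[of "a i" k] by auto
  then have "real CARD('f) ^ m \<le> nrm (A_emb \<iota> (a i))"
    using card_gt_1 by (simp add: nrm_A_emb power_increasing)
  then have "real CARD('f) ^ m / real CARD('f) ^ n \<le> nrm (A_emb \<iota> (a i)) / real CARD('f) ^ n"
    by (intro divide_right_mono) auto
  also have "\<dots> \<le> nrm (lam \<omega> a)"
    by (rule nrm_lam_ge[OF assms(1) i(1)])
  finally show ?thesis .
qed

lemma nrm_lam_le:
  assumes "\<omega> \<in> Omega_affinoid \<iota> r n" "a \<in> tuples m"
  shows "nrm (lam \<omega> a) \<le> real CARD('f) ^ m * real CARD('f) ^ n"
  unfolding lam_def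
proof (rule nrm_sum_le)
  fix i assume i: "i \<in> {2..r}"
  have "nrm (A_emb \<iota> (a i)) \<le> real CARD('f) ^ m"
  proof (cases "a i = 0")
    case False
    have "a i \<in> polys_below m"
      using assms i by (auto simp: tuples_def)
    then have "degree (a i) < m"
      using False by (metis (mono_tags, lifting) leading_coeff_neq_0 mem_Collect_eq not_le polys_below_def)
    then show ?thesis
      using card_gt_1 False by (simp add: nrm_A_emb power_increasing)
  qed simp
  then show "nrm (A_emb \<iota> (a i) * \<omega> i) \<le> real CARD('f) ^ m * real CARD('f) ^ n"
    unfolding nrm_mult using nrm_omega_le[OF assms(1) i] by (intro mult_mono) auto
qed simp

lemma lam_nonzero:
  assumes "\<omega> \<in> Omega \<iota> r" "a \<in> {2..r} \<rightarrow>\<^sub>E UNIV" "a \<noteq> ztup"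
  shows "lam \<omega> a \<noteq> 0"
proof -
  obtain n where "\<omega> \<in> Omega_affinoid \<iota> r n"
    using Omega_in_affinoid[OF assms(1) r_ge_2] by blast
  from nrm_lam_ge_1[OF this assms(2,3)] have "nrm (lam \<omega> a) \<noteq> 0"
    by (smt (verit) q_power_pos zero_less_divide_1_iff)
  then show ?thesis
    by simp
qed

lemma inj_lam:
  assumes "\<omega> \<in> Omega \<iota> r"
  shows "inj_on (lam \<omega>) ({2..r} \<rightarrow>\<^sub>E UNIV)"
proof (rule inj_onI)
  fix a b assume ab: "a \<in> {2..r} \<rightarrow>\<^sub>E UNIV" "b \<in> {2..r} \<rightarrow>\<^sub>E UNIV" "lam \<omega> a = lam \<omega> b"
  then have "lam \<omega> (\<lambda>i\<in>{2..r}. a i - b i) = 0"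
    by (simp add: lam_diff)
  then have *: "(\<lambda>i\<in>{2..r}. a i - b i) = ztup"
    using lam_nonzero[OF assms, of "\<lambda>i\<in>{2..r}. a i - b i"] by auto
  have "a i = b i" if "i \<in> {2..r}" for i
    using fun_cong[OF *, of i] that by (simp add: ztup_def)
  with ab show "a = b"
    by (auto intro: PiE_ext)
qed

text \<open>Indexing by tuples, possible as \<open>lam \<omega>\<close> is injective, exhibits the
  value as a rational expression in \<open>z\<close> and the coordinates of
  \<open>\<omega>\<close>.\<close>

lemma expn_eq_prod:
  assumes "\<omega> \<in> Omega \<iota> r"
  shows "expn \<omega> m z = z * (\<Prod>a\<in>tuples m - {ztup}. 1 - z / lam \<omega> a)"
proof -
  have inj: "inj_on (lam \<omega>) (tuples m)"
    using inj_on_subset[OF inj_lam[OF assms]] tuples_PiE by blast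
  have "Lam \<omega> m - {0} = lam \<omega> ` (tuples m - {ztup})"
    unfolding Lam_def using inj_on_image_set_diff[OF inj, of "tuples m" "{ztup}"] by auto
  then show ?thesis
    unfolding expn_def sub_exp_def
    by (simp add: prod.reindex[OF inj_on_subset[OF inj Diff_subset]])
qed

text \<open>Partial products have absolute value at most \<open>1\<close>, so one more factor
  changes them by at most \<open>\<delta>\<close>; by the ultrametric inequality these changes do
  not add up.\<close>

lemma nrm_prod_one_minus:
  assumes "0 \<le> \<delta>" "\<delta> \<le> 1" "\<And>i. i \<in> A \<Longrightarrow> nrm (x i) \<le> \<delta>"
  shows "nrm ((\<Prod>i\<in>A. 1 - x i) - 1) \<le> \<delta>"
  using assms(3)
proof (induction A rule: infinite_finite_induct)
  case (insert i A)
  define P where "P = (\<Prod>i\<in>A. 1 - x i)"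
  have IH: "nrm (P - 1) \<le> \<delta>"
    using insert by (simp add: P_def)
  have eq: "(1 - x i) * P - 1 = (P - 1) - x i * P"
    by (simp add: algebra_simps)
  have "nrm P \<le> 1"
    using nrm_add_le[of "P - 1" 1 1] IH assms(2) by simp
  then have "nrm (x i * P) \<le> \<delta> * 1"
    unfolding nrm_mult using insert assms(1) by (intro mult_mono) auto
  then have "nrm ((1 - x i) * P - 1) \<le> \<delta>"
    unfolding eq by (intro nrm_diff_le[OF IH]) simp
  then show ?case
    using insert by (simp add: P_def)
qed (use assms in auto)

text \<open>Lattice points outside \<open>Lam \<omega> m\<close> satisfy
  \<open>|z / l| \<le> R q^n / q^m\<close>, which is below \<open>1\<close> from level
  \<open>m0\<close> on. Their factors then have absolute value \<open>1\<close>, and their product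
  is as close to \<open>1\<close> as this bound. Only \<open>n\<close>, \<open>R\<close> and the
  size at level \<open>m0\<close> enter, which later gives uniform convergence on affinoids.\<close>

lemma exp_approx:
  assumes \<omega>: "\<omega> \<in> Omega_affinoid \<iota> r n" and z: "nrm z \<le> R" and m0: "R * real CARD('f) ^ n / real CARD('f) ^ m0 < 1"
    and m: "m0 \<le> m"
  shows "nrm (expn \<omega> m z) = nrm (expn \<omega> m0 z)"
    and "nrm (expL \<omega> z - expn \<omega> m z) \<le> nrm (expn \<omega> m0 z) * (R * real CARD('f) ^ n / real CARD('f) ^ m)"
proof -
  define \<Lambda> where "\<Lambda> = lattice_of \<iota> r \<omega>"
  define p where "p F = (\<Prod>l\<in>F. 1 - z / l)" for F
  define P where "P m = p (Lam \<omega> m - {0})" for m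
  define \<delta> where "\<delta> m = R * real CARD('f) ^ n / real CARD('f) ^ m" for m
  have \<omega>': "\<omega> \<in> Omega \<iota> r"
    using \<omega> by (simp add: Omega_affinoid_def)
  have R: "R \<ge> 0"
    using z nrm_nonneg[of z] by linarith
  have \<delta>0: "0 \<le> \<delta> m" for m
    using R by (simp add: \<delta>_def)
  have \<delta>_mono: "\<delta> m' \<le> \<delta> m" if "m \<le> m'" for m m'
    unfolding \<delta>_def using that card_gt_1 R by (intro divide_left_mono power_increasing) auto
  have \<delta>1: "\<delta> m < 1" if "m0 \<le> m" for m
    by (rule le_less_trans[OF \<delta>_mono[OF that]]) (use m0 in \<open>simp only: \<delta>_def\<close>)
  have tail: "nrm (p (F - (Lam \<omega> m - {0})) - 1) \<le> \<delta> m"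
    if "m0 \<le> m" "F \<subseteq> \<Lambda> - {0}" for F m
    unfolding p_def
  proof (rule nrm_prod_one_minus)
    fix l assume l: "l \<in> F - (Lam \<omega> m - {0})"
    then have "l \<in> \<Lambda>" "l \<notin> Lam \<omega> m"
      using that by auto
    then obtain a where a: "a \<in> {2..r} \<rightarrow>\<^sub>E UNIV" "l = lam \<omega> a" "a \<notin> tuples m"
      unfolding \<Lambda>_def lattice_of_eq Lam_def by auto
    have ge: "real CARD('f) ^ m / real CARD('f) ^ n \<le> nrm l"
      unfolding a(2) by (rule nrm_lam_ge_power[OF \<omega> a(1,3)])
    have "nrm (z / l) \<le> R / (real CARD('f) ^ m / real CARD('f) ^ n)"
      unfolding nrm_divide using ge z R by (intro frac_le) auto
    then show "nrm (z / l) \<le> \<delta> m"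
      by (simp add: \<delta>_def)
  qed (use \<delta>0 \<delta>1[OF that(1)] in auto)
  have nrm_tail: "nrm (p (F - (Lam \<omega> m - {0}))) = 1"
    if "m0 \<le> m" "F \<subseteq> \<Lambda> - {0}" for F m
  proof -
    have "nrm (p (F - (Lam \<omega> m - {0})) - 1) < nrm 1"
      using tail[OF that] \<delta>1[OF that(1)] by simp
    from nrm_add_eq[OF this] show ?thesis
      by simp
  qed
  have split: "p F = P m * p (F - (Lam \<omega> m - {0}))"
    if "finite F" "Lam \<omega> m - {0} \<subseteq> F" for F m
    unfolding P_def p_def using prod.subset_diff[OF that(2,1), of "\<lambda>l. 1 - z / l"] by (simp add: mult.commute)
  have sub: "Lam \<omega> m - {0} \<subseteq> \<Lambda> - {0}" for m
    using Lam_subset_lattice by (auto simp: \<Lambda>_def)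
  have mono: "Lam \<omega> m - {0} \<subseteq> Lam \<omega> m' - {0}" if "m \<le> m'" for m m'
    unfolding Lam_def using tuples_mono[OF that] by blast
  have nrm_P: "nrm (P m) = nrm (P m0)" if "m0 \<le> m" for m
  proof -
    have "P m = P m0 * p (Lam \<omega> m - {0} - (Lam \<omega> m0 - {0}))"
      unfolding P_def[of m] by (rule split[OF _ mono[OF that]]) simp
    then show ?thesis
      using nrm_tail[OF order.refl sub] by (simp add: nrm_mult)
  qed
  have close: "nrm (p F - P m) \<le> nrm (P m0) * \<delta> m"
    if "m0 \<le> m" "finite F" "Lam \<omega> m - {0} \<subseteq> F" "F \<subseteq> \<Lambda> - {0}" for F m
  proof -
    have "p F - P m = P m * (p (F - (Lam \<omega> m - {0})) - 1)"
      unfolding split[OF that(2,3)] by (simp add: algebra_simps)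
    then have "nrm (p F - P m) = nrm (P m0) * nrm (p (F - (Lam \<omega> m - {0})) - 1)"
      using nrm_P[OF that(1)] by (simp add: nrm_mult)
    also have "\<dots> \<le> nrm (P m0) * \<delta> m"
      using tail[OF that(1,4)] by (intro mult_left_mono) auto
    finally show ?thesis .
  qed
  have lim0: "(\<lambda>m. nrm (P m0) * \<delta> m) \<longlonglongrightarrow> 0"
    using tendsto_mult[OF tendsto_const[of "nrm (P m0)"]
        LIMSEQ_divide_realpow_zero[OF card_gt_1, of "R * real CARD('f) ^ n"]] by (simp add: \<delta>_def)
  have small: "\<exists>m\<ge>m0. nrm (P m0) * \<delta> m < e" if "e > 0" for e
  proof -
    have "eventually (\<lambda>m. nrm (P m0) * \<delta> m < e) sequentially"
      using order_tendstoD(2)[OF lim0 that] .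
    then obtain N where "\<And>m. m \<ge> N \<Longrightarrow> nrm (P m0) * \<delta> m < e"
      by (auto simp: eventually_sequentially)
    then show ?thesis
      by (intro exI[of _ "max m0 N"]) auto
  qed
  have PP: "nrm (P m' - P m) \<le> nrm (P m0) * \<delta> m" if "m0 \<le> m" "m \<le> m'" for m m'
    unfolding P_def[of m'] using close[OF that(1) _ mono[OF that(2)] sub] by simp
  \<comment> \<open>Completeness supplies a limit along the levels; \<open>close\<close> compares
    any finite set containing a level with that level, which gives convergence along the filter used
    in \<open>lattice_exp\<close>.\<close>
  have "Cauchy P"
    unfolding Cauchy_altdef
  proof (intro allI impI)
    fix e :: real assume "e > 0"
    then obtain M where M: "M \<ge> m0" "nrm (P m0) * \<delta> M < e"
      using small by blast
    have "dist (P m) (P m') < e" if "m \<ge> M" "m' > m" for m m'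
    proof -
      have "dist (P m) (P m') \<le> nrm (P m0) * \<delta> m"
        using PP[of m m'] that M by (simp add: dist_eq_nrm nrm_minus_commute)
      also have "\<dots> \<le> nrm (P m0) * \<delta> M"
        using \<delta>_mono[OF that(1)] by (intro mult_left_mono) auto
      finally show ?thesis
        using M by simp
    qed
    then show "\<exists>M. \<forall>m\<ge>M. \<forall>n>m. dist (P m) (P n) < e"
      by blast
  qed
  then obtain L where L: "P \<longlonglongrightarrow> L"
    using Cauchy_convergent_iff[of P] by (auto simp: convergent_def)
  have LP: "nrm (L - P m) \<le> nrm (P m0) * \<delta> m" if "m0 \<le> m" for m
  proof (rule tendsto_upperbound)
    show "(\<lambda>m'. nrm (P m' - P m)) \<longlonglongrightarrow> nrm (L - P m)"
      by (intro tendsto_nrm tendsto_diff_nrm L tendsto_const)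
    show "eventually (\<lambda>m'. nrm (P m' - P m) \<le> nrm (P m0) * \<delta> m) sequentially"
      using PP[OF that] by (auto simp: eventually_sequentially)
  qed simp
  have "(p \<longlongrightarrow> L) (finite_subsets_at_top (\<Lambda> - {0}))"
  proof (rule tendstoI)
    fix e :: real assume "e > 0"
    then obtain M where M: "M \<ge> m0" "nrm (P m0) * \<delta> M < e"
      using small by blast
    have "dist (p F) L < e" if "finite F" "Lam \<omega> M - {0} \<subseteq> F" "F \<subseteq> \<Lambda> - {0}" for F
    proof -
      have "nrm (p F - L) = nrm ((p F - P M) - (L - P M))"
        by simp
      also have "\<dots> \<le> nrm (P m0) * \<delta> M"
        using close[OF M(1) that] LP[OF M(1)] by (rule nrm_diff_le)
      finally show ?thesis
        using M by (simp add: dist_eq_nrm)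
    qed
    then show "eventually (\<lambda>F. dist (p F) L < e) (finite_subsets_at_top (\<Lambda> - {0}))"
      unfolding eventually_finite_subsets_at_top using sub[of M]
      by (intro exI[of _ "Lam \<omega> M - {0}"]) auto
  qed
  then have "Lim (finite_subsets_at_top (\<Lambda> - {0})) p = L"
    by (intro tendsto_Lim) auto
  then have expL: "expL \<omega> z = z * L"
    by (simp add: expL_def lattice_exp_def \<Lambda>_def p_def[abs_def])
  have expn: "expn \<omega> m z = z * P m" for m
    by (simp add: expn_def sub_exp_def P_def p_def)
  show "nrm (expn \<omega> m z) = nrm (expn \<omega> m0 z)"
    using nrm_P[OF m] by (simp add: expn nrm_mult)
  have "expL \<omega> z - expn \<omega> m z = z * (L - P m)"
    by (simp add: expn expL algebra_simps)
  then have "nrm (expL \<omega> z - expn \<omega> m z) = nrm z * nrm (L - P m)"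
    by (simp add: nrm_mult)
  also have "\<dots> \<le> nrm z * (nrm (P m0) * \<delta> m)"
    using LP[OF m] by (intro mult_left_mono) auto
  finally show "nrm (expL \<omega> z - expn \<omega> m z) \<le> nrm (expn \<omega> m0 z) * (R * real CARD('f) ^ n / real CARD('f) ^ m)"
    by (simp add: expn nrm_mult \<delta>_def mult.assoc)
qed

end

section \<open>The Drinfeld module of a lattice\<close>

context lattice_setting
begin

definition mu :: "(nat \<Rightarrow> 'c) \<Rightarrow> (nat \<Rightarrow> 'f poly) \<Rightarrow> 'c" where
  "mu \<omega> c = lam \<omega> c / T"

text \<open>The values \<open>expL \<omega> (mu \<omega> c)\<close>, for \<open>c\<close> a tuple of constants, are the \<open>T\<close>-torsion points.\<close>

definition phiT :: "(nat \<Rightarrow> 'c) \<Rightarrow> 'c poly" where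
  "phiT \<omega> = Polynomial.smult T
     ([:0, 1:] * (\<Prod>c\<in>tuples 1 - {ztup}. [:1, - inverse (expL \<omega> (mu \<omega> c)):]))"

lemma affinoid_subset: "\<omega> \<in> Omega_affinoid \<iota> r n \<Longrightarrow> \<omega> \<in> Omega \<iota> r"
  by (simp add: Omega_affinoid_def)

lemma exists_level: "\<exists>m0. R * real CARD('f) ^ n / real CARD('f) ^ m0 < 1"
proof -
  have "eventually (\<lambda>m. R * real CARD('f) ^ n / real CARD('f) ^ m < 1) sequentially"
    by (rule order_tendstoD(2)[OF LIMSEQ_divide_realpow_zero[OF card_gt_1]]) simp
  then show ?thesis
    by (auto simp: eventually_sequentially)
qed

lemma expn_tendsto:
  assumes "\<omega> \<in> Omega \<iota> r"
  shows "(\<lambda>m. expn \<omega> m z) \<longlonglongrightarrow> expL \<omega> z"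
proof -
  obtain n where n: "\<omega> \<in> Omega_affinoid \<iota> r n"
    using Omega_in_affinoid[OF assms r_ge_2] by blast
  obtain m0 where m0: "nrm z * real CARD('f) ^ n / real CARD('f) ^ m0 < 1"
    using exists_level by blast
  let ?g = "\<lambda>m. nrm (expn \<omega> m0 z) * (nrm z * real CARD('f) ^ n / real CARD('f) ^ m)"
  show ?thesis
  proof (rule tendsto_if_nrm_le)
    show "?g \<longlonglongrightarrow> 0"
      using tendsto_mult[OF tendsto_const[of "nrm (expn \<omega> m0 z)"]
          LIMSEQ_divide_realpow_zero[OF card_gt_1, of "nrm z * real CARD('f) ^ n"]] by simp
    show "eventually (\<lambda>m. nrm (expn \<omega> m z - expL \<omega> z) \<le> ?g m) sequentially"
      using exp_approx(2)[OF n order.refl m0]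
      by (subst nrm_minus_commute) (auto simp: eventually_sequentially)
  qed
qed

text \<open>The absolute value of \<open>expn \<omega> m z\<close> no longer changes for
  \<open>m \<ge> m0\<close>, so the limit inherits it.\<close>

lemma nrm_expL:
  assumes "\<omega> \<in> Omega_affinoid \<iota> r n" and "nrm z \<le> R"
    and "R * real CARD('f) ^ n / real CARD('f) ^ m0 < 1"
  shows "nrm (expL \<omega> z) = nrm (expn \<omega> m0 z)"
proof (rule LIMSEQ_unique)
  show "(\<lambda>m. nrm (expn \<omega> m z)) \<longlonglongrightarrow> nrm (expL \<omega> z)"
    by (intro tendsto_nrm expn_tendsto affinoid_subset[OF assms(1)])
  have "eventually (\<lambda>m. nrm (expn \<omega> m z) = nrm (expn \<omega> m0 z)) sequentially"
    unfolding eventually_sequentially using exp_approx(1)[OF assms] by blast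
  then show "(\<lambda>m. nrm (expn \<omega> m z)) \<longlonglongrightarrow> nrm (expn \<omega> m0 z)"
    by (rule tendsto_eventually)
qed

lemma expn_add: "expn \<omega> m (x + y) = expn \<omega> m x + expn \<omega> m y"
  unfolding expn_def by (rule sub_exp_add[OF finite_Lam subspace_Lam])

lemma expn_kappa: "expn \<omega> m (\<kappa> c * x) = \<kappa> c * expn \<omega> m x"
  unfolding expn_def by (rule sub_exp_kappa[OF finite_Lam subspace_Lam])

lemma expL_add:
  assumes "\<omega> \<in> Omega \<iota> r"
  shows "expL \<omega> (x + y) = expL \<omega> x + expL \<omega> y"
proof (rule LIMSEQ_unique)
  show "(\<lambda>m. expn \<omega> m (x + y)) \<longlonglongrightarrow> expL \<omega> (x + y)"
    by (rule expn_tendsto[OF assms])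
  show "(\<lambda>m. expn \<omega> m (x + y)) \<longlonglongrightarrow> expL \<omega> x + expL \<omega> y"
    unfolding expn_add
    by (intro tendsto_add_nrm expn_tendsto[OF assms])
qed

lemma expL_kappa:
  assumes "\<omega> \<in> Omega \<iota> r"
  shows "expL \<omega> (\<kappa> c * x) = \<kappa> c * expL \<omega> x"
proof (rule LIMSEQ_unique)
  show "(\<lambda>m. expn \<omega> m (\<kappa> c * x)) \<longlonglongrightarrow> expL \<omega> (\<kappa> c * x)"
    by (rule expn_tendsto[OF assms])
  show "(\<lambda>m. expn \<omega> m (\<kappa> c * x)) \<longlonglongrightarrow> \<kappa> c * expL \<omega> x"
    unfolding expn_kappa
    by (intro tendsto_mult_nrm tendsto_const expn_tendsto[OF assms])
qed

lemma expL_0: "expL \<omega> 0 = 0"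
  by (simp add: expL_def lattice_exp_def)

lemma expL_diff:
  assumes "\<omega> \<in> Omega \<iota> r"
  shows "expL \<omega> (x - y) = expL \<omega> x - expL \<omega> y"
  using expL_add[OF assms, of "x - y" y] by simp

section \<open>Cosets of the truncated lattice and the functional equation\<close>

lemma tuples_PiE_shift:
  assumes "c \<in> tuples 1" "b \<in> {2..r} \<rightarrow>\<^sub>E UNIV" "c' \<in> tuples 1" "b' \<in> {2..r} \<rightarrow>\<^sub>E UNIV"
    and eq: "\<And>i. i \<in> {2..r} \<Longrightarrow> c i + [:0, 1:] * b i = c' i + [:0, 1:] * b' i"
  shows "c = c' \<and> b = b'"
proof -
  have "c i = c' i \<and> b i = b' i" if i: "i \<in> {2..r}" for i
  proof -
    have "c i \<in> polys_below 1" "c' i \<in> polys_below 1"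
      using assms i by (auto simp: tuples_def)
    then obtain u u' where "c i = [:u:]" "c' i = [:u':]"
      using polys_below_Suc[of 0] by (auto simp: polys_below_0)
    then show ?thesis
      using eq[OF i] by simp
  qed
  then show ?thesis
    using assms(1,3)[THEN tuples_PiE] assms(2,4) by (auto intro!: PiE_ext[of _ "{2..r}"])
qed

lemma mu_eq_lam_add:
  "mu \<omega> c + lam \<omega> b = lam \<omega> (\<lambda>i\<in>{2..r}. c i + [:0, 1:] * b i) / T"
proof -
  have "lam \<omega> (\<lambda>i\<in>{2..r}. c i + [:0, 1:] * b i)
      = lam \<omega> (\<lambda>i\<in>{2..r}. c i + (\<lambda>i\<in>{2..r}. [:0, 1:] * b i) i)"
    by (rule lam_cong) simp
  also have "\<dots> = lam \<omega> c + T * lam \<omega> b"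
    by (simp only: lam_add lam_mult A_emb_T)
  finally show ?thesis
    by (simp add: mu_def field_simps)
qed

text \<open>After multiplication by \<open>T\<close> and by injectivity of
  \<open>lam \<omega>\<close>, this says that a polynomial \<open>c + T b\<close> with constant
  \<open>c\<close> determines \<open>c\<close> and \<open>b\<close>.\<close>

lemma inj_on_mu_add:
  assumes "\<omega> \<in> Omega \<iota> r"
  shows "inj_on (\<lambda>(c, l). mu \<omega> c + l) (tuples 1 \<times> Lam \<omega> m)"
proof (rule inj_onI, clarify)
  fix c l c' l'
  assume c: "c \<in> tuples 1" "c' \<in> tuples 1" and l: "l \<in> Lam \<omega> m" "l' \<in> Lam \<omega> m"
    and eq: "mu \<omega> c + l = mu \<omega> c' + l'"
  obtain b b' where b: "b \<in> tuples m" "b' \<in> tuples m" "l = lam \<omega> b" "l' = lam \<omega> b'"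
    using l by (auto simp: Lam_def)
  have "(\<lambda>i\<in>{2..r}. c i + [:0, 1:] * b i) = (\<lambda>i\<in>{2..r}. c' i + [:0, 1:] * b' i)"
    using eq unfolding b(3,4) mu_eq_lam_add
    by (intro inj_onD[OF inj_lam[OF assms]]) (auto simp del: mult_pCons_left)
  then have "c i + [:0, 1:] * b i = c' i + [:0, 1:] * b' i" if "i \<in> {2..r}" for i
    using that by (metis (no_types, lifting) restrict_apply')
  then have "c = c' \<and> b = b'"
    by (rule tuples_PiE_shift[OF c(1) tuples_PiE[OF b(1)] c(2) tuples_PiE[OF b(2)]])
  then show "c = c' \<and> l = l'"
    by (simp add: b)
qed

lemma mu_ztup [simp]: "mu \<omega> ztup = 0"
  by (simp add: mu_def)

lemma mu_notin_Lam:
  assumes "\<omega> \<in> Omega \<iota> r" "c \<in> tuples 1" "c \<noteq> ztup"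
  shows "mu \<omega> c \<notin> Lam \<omega> m"
proof
  assume "mu \<omega> c \<in> Lam \<omega> m"
  moreover have "0 \<in> Lam \<omega> m"
    using subspace_Lam by (auto simp: fq_subspace_def)
  ultimately show False
    using inj_onD[OF inj_on_mu_add[OF assms(1)], of "(c, 0)" "(ztup, mu \<omega> c)" m] assms by auto
qed

text \<open>Nonvanishing at each level would not exclude a zero limit; it survives because the
  absolute value is stationary from \<open>m0\<close> on.\<close>

lemma expL_mu_nonzero:
  assumes "\<omega> \<in> Omega \<iota> r" "c \<in> tuples 1" "c \<noteq> ztup"
  shows "expL \<omega> (mu \<omega> c) \<noteq> 0"
proof -
  obtain n where n: "\<omega> \<in> Omega_affinoid \<iota> r n"
    using Omega_in_affinoid[OF assms(1) r_ge_2] by blast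
  obtain m0 where m0: "nrm (mu \<omega> c) * real CARD('f) ^ n / real CARD('f) ^ m0 < 1"
    using exists_level by blast
  have "expn \<omega> m0 (mu \<omega> c) \<noteq> 0"
    unfolding expn_def sub_exp_eq_0_iff[OF finite_Lam subspace_Lam] by (rule mu_notin_Lam[OF assms])
  then show ?thesis
    using nrm_expL[OF n order.refl m0] by (metis nrm_eq_0_iff)
qed

lemma Lam_Suc:
  "(\<lambda>v. v / T) ` Lam \<omega> (Suc m) = (\<lambda>(c, l). mu \<omega> c + l) ` (tuples 1 \<times> Lam \<omega> m)"
proof (intro equalityI subsetI)
  fix x assume "x \<in> (\<lambda>v. v / T) ` Lam \<omega> (Suc m)"
  then obtain a where a: "a \<in> tuples (Suc m)" "x = lam \<omega> a / T"
    by (auto simp: Lam_def)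
  define c where "c = (\<lambda>i\<in>{2..r}. [:Polynomial.coeff (a i) 0:])"
  define b where "b = (\<lambda>i\<in>{2..r}. poly_shift 1 (a i))"
  have "c \<in> tuples 1"
    by (auto simp: c_def tuples_def polys_below_def coeff_pCons split: nat.splits)
  moreover have "b \<in> tuples m"
    using a by (auto simp: b_def tuples_def polys_below_def coeff_poly_shift PiE_iff)
  moreover have "x = mu \<omega> c + lam \<omega> b"
    unfolding a(2) mu_eq_lam_add
    by (intro arg_cong2[of _ _ _ _ "(/)"] lam_cong refl)
      (auto simp: c_def b_def poly_eq_iff coeff_poly_shift coeff_pCons split: nat.splits)
  ultimately show "x \<in> (\<lambda>(c, l). mu \<omega> c + l) ` (tuples 1 \<times> Lam \<omega> m)"
    by (intro image_eqI[of _ _ "(c, lam \<omega> b)"]) (auto simp: Lam_def)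
next
  fix x assume "x \<in> (\<lambda>(c, l). mu \<omega> c + l) ` (tuples 1 \<times> Lam \<omega> m)"
  then obtain c b where cb: "c \<in> tuples 1" "b \<in> tuples m" "x = mu \<omega> c + lam \<omega> b"
    by (auto simp: Lam_def)
  have "(\<lambda>i\<in>{2..r}. c i + [:0, 1:] * b i) \<in> tuples (Suc m)"
    using cb by (auto simp: tuples_def polys_below_def PiE_iff coeff_pCons split: nat.splits)
  then show "x \<in> (\<lambda>v. v / T) ` Lam \<omega> (Suc m)"
    unfolding cb(3) mu_eq_lam_add Lam_def by blast
qed

lemma expn_Suc:
  assumes "\<omega> \<in> Omega \<iota> r"
  shows "expn \<omega> (Suc m) (T * z)
    = T * (expn \<omega> m z * (\<Prod>c\<in>tuples 1 - {ztup}. 1 - expn \<omega> m z * inverse (expn \<omega> m (mu \<omega> c))))"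
proof -
  have "expn \<omega> (Suc m) (T * z) = T * sub_exp ((\<lambda>v. v / T) ` Lam \<omega> (Suc m)) z"
    by (simp add: sub_exp_scale expn_def)
  also have "sub_exp ((\<lambda>v. v / T) ` Lam \<omega> (Suc m)) z
      = sub_exp (Lam \<omega> m) z
        * (\<Prod>c\<in>tuples 1 - {ztup}. 1 - sub_exp (Lam \<omega> m) z / sub_exp (Lam \<omega> m) (mu \<omega> c))"
    by (rule sub_exp_cosets[OF finite_Lam subspace_Lam _ _ _ inj_on_mu_add[OF assms] Lam_Suc]) auto
  finally show ?thesis
    by (simp add: expn_def divide_inverse)
qed

lemma poly_phiT_expL:
  assumes "\<omega> \<in> Omega \<iota> r"
  shows "poly (phiT \<omega>) (expL \<omega> z) = expL \<omega> (T * z)"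
proof (rule LIMSEQ_unique)
  show "(\<lambda>m. expn \<omega> (Suc m) (T * z)) \<longlonglongrightarrow> expL \<omega> (T * z)"
    by (rule LIMSEQ_Suc[OF expn_tendsto[OF assms]])
  have "(\<lambda>m. expn \<omega> (Suc m) (T * z)) \<longlonglongrightarrow> T * (expL \<omega> z
      * (\<Prod>c\<in>tuples 1 - {ztup}. 1 - expL \<omega> z * inverse (expL \<omega> (mu \<omega> c))))"
    unfolding expn_Suc[OF assms]
    by (intro tendsto_mult_nrm tendsto_const tendsto_prod_nrm tendsto_diff_nrm
        tendsto_inverse_nrm expn_tendsto[OF assms] expL_mu_nonzero[OF assms]) auto
  then show "(\<lambda>m. expn \<omega> (Suc m) (T * z)) \<longlonglongrightarrow> poly (phiT \<omega>) (expL \<omega> z)"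
    by (simp add: phiT_def poly_prod mult_ac)
qed

text \<open>For \<open>|z| < q^(-n)\<close> level \<open>0\<close> already suffices, where the
  lattice is \<open>{0}\<close> and \<open>expn \<omega> 0 z = z\<close>; hence
  \<open>|expL \<omega> z| = |z|\<close>, and inverse powers of \<open>T\<close> give infinitely
  many values.\<close>

lemma infinite_range_expL:
  assumes "\<omega> \<in> Omega \<iota> r"
  shows "infinite (range (expL \<omega>))"
proof -
  obtain n where n: "\<omega> \<in> Omega_affinoid \<iota> r n"
    using Omega_in_affinoid[OF assms r_ge_2] by blast
  define z where "z k = inverse (T ^ (n + Suc k))" for k
  have nz: "nrm (z k) = 1 / real CARD('f) ^ (n + Suc k)" for k
    by (simp add: z_def nrm_inverse nrm_power nrm_T divide_inverse del: power_Suc)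
  have "nrm (expL \<omega> (z k)) = nrm (expn \<omega> 0 (z k))" for k
  proof (rule nrm_expL[OF n order.refl])
    have "real CARD('f) ^ n < real CARD('f) ^ (n + Suc k)"
      using card_gt_1 by (intro power_strict_increasing) auto
    then show "nrm (z k) * real CARD('f) ^ n / real CARD('f) ^ 0 < 1"
      by (simp add: nz field_simps del: power_Suc)
  qed
  moreover have "expn \<omega> 0 (z k) = z k" for k
    by (simp add: expn_def sub_exp_def Lam_def tuples_0)
  ultimately have nE: "nrm (expL \<omega> (z k)) = 1 / real CARD('f) ^ (n + Suc k)" for k
    by (simp only: nz)
  have "inj (\<lambda>k. expL \<omega> (z k))"
  proof (rule injI)
    fix k k' assume "expL \<omega> (z k) = expL \<omega> (z k')"
    then have "1 / real CARD('f) ^ (n + Suc k) = 1 / real CARD('f) ^ (n + Suc k')"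
      using nE by metis
    then have "real CARD('f) ^ (n + Suc k) = real CARD('f) ^ (n + Suc k')"
      by (simp del: power_Suc)
    then show "k = k'"
      using power_inject_exp[OF card_gt_1] by (metis add_left_cancel Suc_inject)
  qed
  then have "infinite (range (\<lambda>k. expL \<omega> (z k)))"
    using range_inj_infinite by blast
  moreover have "range (\<lambda>k. expL \<omega> (z k)) \<subseteq> range (expL \<omega>)"
    by auto
  ultimately show ?thesis
    using infinite_super by blast
qed

lemma poly_eqI_expL:
  assumes "\<omega> \<in> Omega \<iota> r" "\<And>z. poly p (expL \<omega> z) = poly p' (expL \<omega> z)"
  shows "p = p'"
  by (rule poly_eqI_infinite[OF infinite_range_expL[OF assms(1)]]) (use assms(2) in auto)

text \<open>By additivity of the exponential the torsion points form a finite subspace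
  \<open>W\<close>, and \<open>phiT \<omega>\<close> is \<open>T\<close> times the polynomial of
  \<open>sub_exp W\<close>.\<close>

lemma q_poly_phiT:
  assumes "\<omega> \<in> Omega \<iota> r"
  shows "q_poly CARD('f) (phiT \<omega>)"
proof -
  define w where "w c = expL \<omega> (mu \<omega> c)" for c
  define W where "W = w ` tuples 1"
  have mu_add: "mu \<omega> (\<lambda>i\<in>{2..r}. c i + c' i) = mu \<omega> c + mu \<omega> c'" for c c'
    by (simp add: mu_def lam_add add_divide_distrib)
  have w_add: "w (\<lambda>i\<in>{2..r}. c i + c' i) = w c + w c'" for c c'
    by (simp add: w_def mu_add expL_add[OF assms])
  have w_smult: "w (\<lambda>i\<in>{2..r}. Polynomial.smult b (c i)) = \<kappa> b * w c" for b c
    by (simp add: w_def mu_def lam_smult expL_kappa[OF assms, symmetric])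
  have w0: "w ztup = 0"
    by (simp add: w_def expL_0)
  have inj: "inj_on w (tuples 1)"
  proof (rule inj_onI)
    fix c c' assume c: "c \<in> tuples 1" "c' \<in> tuples 1" "w c = w c'"
    define d where "d = (\<lambda>i\<in>{2..r}. c i - c' i)"
    have d: "d \<in> tuples 1"
      using c by (auto simp: d_def tuples_def polys_below_def PiE_iff)
    have "w d = 0"
      using c(3) by (simp add: w_def d_def mu_def lam_diff diff_divide_distrib expL_diff[OF assms])
    then have "d = ztup"
      using expL_mu_nonzero[OF assms d] by (auto simp: w_def)
    have "c i = c' i" if "i \<in> {2..r}" for i
      using that fun_cong[OF \<open>d = ztup\<close>, of i] by (simp add: d_def ztup_def)
    then show "c = c'"
      using c(1,2)[THEN tuples_PiE] by (auto intro: PiE_ext)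
  qed
  have W: "finite W" "fq_subspace W"
  proof -
    show "finite W"
      by (simp add: W_def)
    show "fq_subspace W"
      unfolding fq_subspace_def
    proof (intro conjI ballI allI)
      show "0 \<in> W"
        unfolding W_def using w0 by (intro image_eqI[of _ _ ztup]) auto
    next
      fix x y assume "x \<in> W" "y \<in> W"
      then obtain c c' where "c \<in> tuples 1" "c' \<in> tuples 1" "x = w c" "y = w c'"
        by (auto simp: W_def)
      then show "x + y \<in> W"
        unfolding W_def by (intro image_eqI[of _ _ "\<lambda>i\<in>{2..r}. c i + c' i"])
          (auto simp: w_add tuples_def polys_below_def PiE_iff)
    next
      fix b x assume "x \<in> W"
      then obtain c where "c \<in> tuples 1" "x = w c"
        by (auto simp: W_def)
      then show "\<kappa> b * x \<in> W"
        unfolding W_def by (intro image_eqI[of _ _ "\<lambda>i\<in>{2..r}. Polynomial.smult b (c i)"])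
          (auto simp: w_smult tuples_def polys_below_def PiE_iff)
    qed
  qed
  have W0: "W - {0} = w ` (tuples 1 - {ztup})"
    unfolding W_def using inj_on_image_set_diff[OF inj, of "tuples 1" "{ztup}"] w0 by auto
  have "phiT \<omega> = Polynomial.smult (T / (\<Prod>v\<in>W - {0}. v)) (\<Prod>v\<in>W. [:v, 1:])"
  proof (rule poly_eqI_infinite[OF infinite_UNIV])
    fix x
    have "poly (phiT \<omega>) x = T * sub_exp W x"
      unfolding sub_exp_def W0
      using prod.reindex[OF inj_on_subset[OF inj Diff_subset], of "\<lambda>v. 1 - x / v" "{ztup}"]
      by (simp add: phiT_def poly_prod divide_inverse w_def comp_def)
    then show "poly (phiT \<omega>) x
        = poly (Polynomial.smult (T / (\<Prod>v\<in>W - {0}. v)) (\<Prod>v\<in>W. [:v, 1:])) x"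
      by (simp add: sub_exp_eq_poly[OF W])
  qed
  then show ?thesis
    by (simp add: q_poly_smult q_poly_prod_subspace[OF W])
qed

section \<open>Existence and uniqueness of the Drinfeld module\<close>

lemma coeff_1_phiT: "Polynomial.coeff (phiT \<omega>) 1 = T"
  by (simp add: phiT_def flip: poly_0_coeff_0) (simp add: poly_prod)

lemma degree_phiT:
  assumes "\<omega> \<in> Omega \<iota> r"
  shows "degree (phiT \<omega>) = CARD('f) ^ (r - 1)"
proof -
  let ?P = "\<Prod>c\<in>tuples 1 - {ztup}. [:1, - inverse (expL \<omega> (mu \<omega> c)):]"
  have nz: "inverse (expL \<omega> (mu \<omega> c)) \<noteq> 0" if "c \<in> tuples 1 - {ztup}" for c
    using expL_mu_nonzero[OF assms] that by auto
  have "degree ?P = (\<Sum>c\<in>tuples 1 - {ztup}. degree [:1, - inverse (expL \<omega> (mu \<omega> c)):])"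
    by (rule degree_prod_eq_sum_degree) auto
  also have "\<dots> = (\<Sum>c\<in>tuples 1 - {ztup}. 1)"
    using nz by (intro sum.cong) auto
  also have "\<dots> = CARD('f) ^ (r - 1) - 1"
    by (simp add: card_Diff_singleton card_tuples_1[simplified])
  finally have "degree ?P = CARD('f) ^ (r - 1) - 1" .
  moreover have "?P \<noteq> 0"
    by (auto simp: prod_zero_iff)
  moreover have "CARD('f) ^ (r - 1) > 0"
    by simp
  ultimately show ?thesis
    unfolding phiT_def by (simp add: degree_mult_eq)
qed

text \<open>Horner recursion: \<open>pCons c a\<close> stands for \<open>c + T a\<close>, so
  \<open>\<kappa> c X\<close> plus the composite of \<open>phiT \<omega>\<close> with a solution for
  \<open>a\<close> is a solution for it.\<close>

lemma exists_phi:
  assumes "\<omega> \<in> Omega \<iota> r"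
  shows "\<exists>p. q_poly CARD('f) p \<and> Polynomial.coeff p 1 = A_emb \<iota> a
    \<and> (\<forall>z. poly p (expL \<omega> z) = expL \<omega> (A_emb \<iota> a * z))"
proof (induction a)
  case 0
  show ?case
    by (intro exI[of _ 0]) (simp add: expL_0)
next
  case (pCons c a)
  then obtain p where p: "q_poly CARD('f) p" "Polynomial.coeff p 1 = A_emb \<iota> a"
    "\<And>z. poly p (expL \<omega> z) = expL \<omega> (A_emb \<iota> a * z)"
    by blast
  \<comment> \<open>Neither polynomial has a constant term, so linear coefficients multiply under
    composition.\<close>
  have "Polynomial.coeff p 0 = 0"
    using p(1) by (auto simp: q_poly_def)
  moreover obtain b f where f: "phiT \<omega> = pCons b f"
    by (cases "phiT \<omega>")
  moreover have "b = 0"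
    using q_poly_phiT[OF assms] f by (auto simp: q_poly_def dest: spec[of _ 0])
  ultimately have "Polynomial.coeff (pcompose (phiT \<omega>) p) 1 = T * A_emb \<iota> a"
    using p(2) coeff_1_phiT[of \<omega>]
    by (simp add: pcompose_pCons coeff_mult poly_0_coeff_0)
  then show ?case
    using p q_poly_phiT[OF assms]
    by (intro exI[of _ "[:0, \<kappa> c:] + pcompose (phiT \<omega>) p"])
      (auto simp: A_emb_pCons poly_pcompose poly_phiT_expL[OF assms] expL_add[OF assms]
        expL_kappa[OF assms] distrib_right mult.assoc mult.commute[of _ "\<kappa> c"]
        intro: q_poly_add q_poly_pcompose)
qed

text \<open>The composition laws hold on the range of the exponential, and
  \<open>poly_eqI_expL\<close> promotes them to identities of polynomials; the same argument
  identifies any second candidate for the definite description.\<close>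

lemma phi'_spec:
  assumes "\<omega> \<in> Omega \<iota> r"
  shows "drinfeld_module \<iota> (r - 1) (phi' \<iota> r \<omega>)"
    and "phi' \<iota> r \<omega> [:0, 1:] = phiT \<omega>"
proof -
  obtain \<phi> where \<phi>: "\<And>a. q_poly CARD('f) (\<phi> a)" "\<And>a. Polynomial.coeff (\<phi> a) 1 = A_emb \<iota> a"
    "\<And>a z. poly (\<phi> a) (expL \<omega> z) = expL \<omega> (A_emb \<iota> a * z)"
    using exists_phi[OF assms] by metis
  note eqI = poly_eqI_expL[OF assms]
  have T: "\<phi> [:0, 1:] = phiT \<omega>"
    by (rule eqI) (simp add: \<phi>(3) poly_phiT_expL[OF assms])
  have drinfeld: "drinfeld_module \<iota> (r - 1) \<phi>"
    unfolding drinfeld_module_def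
  proof (intro conjI allI)
    show "Polynomial.coeff (\<phi> a) n \<noteq> 0 \<longrightarrow> (\<exists>k. n = CARD('f) ^ k)" for a n
      using \<phi>(1) by (auto simp: q_poly_def)
    show "\<phi> [:c:] = [:0, A_emb \<iota> [:c:]:]" for c
      by (rule eqI) (simp add: \<phi>(3) expL_kappa[OF assms])
    show "\<phi> (a + b) = \<phi> a + \<phi> b" for a b
      by (rule eqI) (simp add: \<phi>(3) A_emb_add distrib_right expL_add[OF assms])
    show "\<phi> (a * b) = pcompose (\<phi> a) (\<phi> b)" for a b
      by (rule eqI) (simp add: \<phi>(3) A_emb_mult poly_pcompose mult.assoc)
    show "degree (\<phi> [:0, 1:]) = CARD('f) ^ (r - 1)"
      by (simp add: T degree_phiT[OF assms])
  qed (rule \<phi>(2))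
  have "phi' \<iota> r \<omega> = \<phi>"
    unfolding phi'_def expL_def[symmetric]
  proof (rule the_equality)
    fix \<psi> assume "drinfeld_module \<iota> (r - 1) \<psi>
      \<and> (\<forall>a z. poly (\<psi> a) (expL \<omega> z) = expL \<omega> (A_emb \<iota> a * z))"
    then have "\<psi> a = \<phi> a" for a
      by (intro eqI) (simp add: \<phi>(3))
    then show "\<psi> = \<phi>" ..
  qed (use drinfeld \<phi>(3) in auto)
  then show "drinfeld_module \<iota> (r - 1) (phi' \<iota> r \<omega>)" "phi' \<iota> r \<omega> [:0, 1:] = phiT \<omega>"
    using drinfeld T by auto
qed

end

section \<open>Holomorphy of the coefficients\<close>

context lattice_setting
begin

text \<open>
  Bounded on every affinoid of the exhaustion, besides being a uniform limit of rational functions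
  there. Boundedness makes closure under products elementary; that every holomorphic function has
  this property would need the maximum modulus principle.
\<close>

definition bhol :: "((nat \<Rightarrow> 'c) \<Rightarrow> 'c) \<Rightarrow> bool" where
  "bhol f \<longleftrightarrow> (\<forall>n. (\<exists>M. \<forall>\<omega>\<in>Omega_affinoid \<iota> r n. nrm (f \<omega>) \<le> M) \<and>
     (\<forall>\<epsilon>>0. \<exists>P\<in>poly_functions r. \<exists>Q\<in>poly_functions r.
        \<forall>\<omega>\<in>Omega_affinoid \<iota> r n. Q \<omega> \<noteq> 0 \<and> nrm (f \<omega> - P \<omega> / Q \<omega>) < \<epsilon>))"

lemma bhol_holomorphic: "bhol f \<Longrightarrow> restrict f (Omega \<iota> r) \<in> holomorphic_functions \<iota> r"
  unfolding holomorphic_functions_def bhol_def dist_eq_nrm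
  by (auto simp: affinoid_subset)

lemma bhol_bounded: "bhol f \<Longrightarrow> \<exists>M. \<forall>\<omega>\<in>Omega_affinoid \<iota> r n. nrm (f \<omega>) \<le> M"
  unfolding bhol_def by blast

lemma bhol_approxE:
  assumes "bhol f" "\<epsilon> > 0"
  obtains P Q where "P \<in> poly_functions r" "Q \<in> poly_functions r"
    "\<forall>\<omega>\<in>Omega_affinoid \<iota> r n. Q \<omega> \<noteq> 0 \<and> nrm (f \<omega> - P \<omega> / Q \<omega>) < \<epsilon>"
  using assms unfolding bhol_def by blast

lemma bhol_cong:
  assumes "\<And>\<omega>. \<omega> \<in> Omega \<iota> r \<Longrightarrow> f \<omega> = g \<omega>"
  shows "bhol f \<longleftrightarrow> bhol g"
proof -
  have "\<omega> \<in> Omega_affinoid \<iota> r n \<Longrightarrow> f \<omega> = g \<omega>" for \<omega> n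
    using assms affinoid_subset by blast
  then show ?thesis
    unfolding bhol_def by (intro all_cong1 conj_cong ex_cong1 bex_cong ball_cong refl imp_cong) auto
qed

lemma bhol_const [simp]: "bhol (\<lambda>\<omega>. c)"
  unfolding bhol_def
proof (intro allI conjI impI)
  fix n and \<epsilon> :: real assume "\<epsilon> > 0"
  then show "\<exists>P\<in>poly_functions r. \<exists>Q\<in>poly_functions r.
      \<forall>\<omega>\<in>Omega_affinoid \<iota> r n. Q \<omega> \<noteq> 0 \<and> nrm (c - P \<omega> / Q \<omega>) < \<epsilon>"
    by (intro bexI[of _ "\<lambda>\<omega>. c"] bexI[of _ "\<lambda>\<omega>. 1"]) (auto intro: poly_functions.const)
qed auto

lemma bhol_add:
  assumes "bhol f" "bhol g"
  shows "bhol (\<lambda>\<omega>. f \<omega> + g \<omega>)"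
  unfolding bhol_def
proof (intro allI conjI impI)
  fix n
  obtain M where M: "\<forall>\<omega>\<in>Omega_affinoid \<iota> r n. nrm (f \<omega>) \<le> M"
    using bhol_bounded[OF assms(1)] by blast
  obtain N where "\<forall>\<omega>\<in>Omega_affinoid \<iota> r n. nrm (g \<omega>) \<le> N"
    using bhol_bounded[OF assms(2)] by blast
  with M have "\<forall>\<omega>\<in>Omega_affinoid \<iota> r n. nrm (f \<omega> + g \<omega>) \<le> max M N"
    by (auto intro!: nrm_add_le intro: max.coboundedI1 max.coboundedI2)
  then show "\<exists>M. \<forall>\<omega>\<in>Omega_affinoid \<iota> r n. nrm (f \<omega> + g \<omega>) \<le> M" ..
  fix \<epsilon> :: real assume "\<epsilon> > 0"
  obtain P Q where PQ: "P \<in> poly_functions r" "Q \<in> poly_functions r"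
      "\<forall>\<omega>\<in>Omega_affinoid \<iota> r n. Q \<omega> \<noteq> 0 \<and> nrm (f \<omega> - P \<omega> / Q \<omega>) < \<epsilon>"
    by (rule bhol_approxE[OF assms(1) \<open>\<epsilon> > 0\<close>])
  obtain P' Q' where PQ': "P' \<in> poly_functions r" "Q' \<in> poly_functions r"
      "\<forall>\<omega>\<in>Omega_affinoid \<iota> r n. Q' \<omega> \<noteq> 0 \<and> nrm (g \<omega> - P' \<omega> / Q' \<omega>) < \<epsilon>"
    by (rule bhol_approxE[OF assms(2) \<open>\<epsilon> > 0\<close>])
  show "\<exists>P\<in>poly_functions r. \<exists>Q\<in>poly_functions r.
      \<forall>\<omega>\<in>Omega_affinoid \<iota> r n. Q \<omega> \<noteq> 0 \<and> nrm (f \<omega> + g \<omega> - P \<omega> / Q \<omega>) < \<epsilon>"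
  proof (intro bexI ballI)
    fix \<omega> assume \<omega>: "\<omega> \<in> Omega_affinoid \<iota> r n"
    have eq: "f \<omega> + g \<omega> - (P \<omega> * Q' \<omega> + P' \<omega> * Q \<omega>) / (Q \<omega> * Q' \<omega>)
        = (f \<omega> - P \<omega> / Q \<omega>) + (g \<omega> - P' \<omega> / Q' \<omega>)"
      using PQ(3) PQ'(3) \<omega> by (simp add: field_simps)
    have "nrm ((f \<omega> - P \<omega> / Q \<omega>) + (g \<omega> - P' \<omega> / Q' \<omega>)) < \<epsilon>"
      using PQ(3) PQ'(3) \<omega> by (intro le_less_trans[OF nrm_add_le_max]) auto
    then show "Q \<omega> * Q' \<omega> \<noteq> 0
        \<and> nrm (f \<omega> + g \<omega> - (P \<omega> * Q' \<omega> + P' \<omega> * Q \<omega>) / (Q \<omega> * Q' \<omega>)) < \<epsilon>"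
      unfolding eq using PQ(3) PQ'(3) \<omega> by simp
  qed (use PQ PQ' in \<open>auto intro: poly_functions.intros\<close>)
qed

lemma bhol_mult:
  assumes "bhol f" "bhol g"
  shows "bhol (\<lambda>\<omega>. f \<omega> * g \<omega>)"
  unfolding bhol_def
proof (intro allI conjI impI)
  fix n
  obtain M0 where M0: "\<forall>\<omega>\<in>Omega_affinoid \<iota> r n. nrm (f \<omega>) \<le> M0"
    using bhol_bounded[OF assms(1)] by blast
  obtain N0 where N0: "\<forall>\<omega>\<in>Omega_affinoid \<iota> r n. nrm (g \<omega>) \<le> N0"
    using bhol_bounded[OF assms(2)] by blast
  define M where "M = max 1 M0"
  define N where "N = max 1 N0"
  have MN: "nrm (f \<omega>) \<le> M" "nrm (g \<omega>) \<le> N" if "\<omega> \<in> Omega_affinoid \<iota> r n" for \<omega>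
    using M0 N0 that by (auto simp: M_def N_def intro: max.coboundedI2)
  have pos: "M \<ge> 1" "N \<ge> 1"
    by (simp_all add: M_def N_def)
  have "\<forall>\<omega>\<in>Omega_affinoid \<iota> r n. nrm (f \<omega> * g \<omega>) \<le> M * N"
    unfolding nrm_mult using MN pos by (auto intro!: mult_mono)
  then show "\<exists>M. \<forall>\<omega>\<in>Omega_affinoid \<iota> r n. nrm (f \<omega> * g \<omega>) \<le> M" ..
  fix \<epsilon> :: real assume "\<epsilon> > 0"
  \<comment> \<open>The bound \<open>\<delta> \<le> 1 \<le> N\<close> keeps the approximant
    \<open>v\<close> of \<open>g\<close> below \<open>N\<close>; the other bound makes both error
    terms smaller than \<open>\<epsilon>\<close>.\<close>
  define \<delta> where "\<delta> = min 1 (\<epsilon> / (M * N))"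
  have \<delta>: "\<delta> > 0" "\<delta> \<le> 1" "\<delta> * M \<le> \<epsilon>" "\<delta> * N \<le> \<epsilon>"
  proof -
    show "\<delta> > 0" "\<delta> \<le> 1"
      using \<open>\<epsilon> > 0\<close> pos by (auto simp: \<delta>_def)
    have "\<delta> * (M * N) \<le> \<epsilon>"
      using pos by (auto simp: \<delta>_def field_simps min_def)
    moreover have "M * 1 \<le> M * N" "1 * N \<le> M * N"
      using pos by (auto intro!: mult_mono)
    ultimately show "\<delta> * M \<le> \<epsilon>" "\<delta> * N \<le> \<epsilon>"
      using \<open>\<delta> > 0\<close> by (smt (verit) mult_left_mono mult.right_neutral mult_1)+
  qed
  obtain P Q where PQ: "P \<in> poly_functions r" "Q \<in> poly_functions r"
      "\<forall>\<omega>\<in>Omega_affinoid \<iota> r n. Q \<omega> \<noteq> 0 \<and> nrm (f \<omega> - P \<omega> / Q \<omega>) < \<delta>"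
    by (rule bhol_approxE[OF assms(1) \<delta>(1)])
  obtain P' Q' where PQ': "P' \<in> poly_functions r" "Q' \<in> poly_functions r"
      "\<forall>\<omega>\<in>Omega_affinoid \<iota> r n. Q' \<omega> \<noteq> 0 \<and> nrm (g \<omega> - P' \<omega> / Q' \<omega>) < \<delta>"
    by (rule bhol_approxE[OF assms(2) \<delta>(1)])
  show "\<exists>P\<in>poly_functions r. \<exists>Q\<in>poly_functions r.
      \<forall>\<omega>\<in>Omega_affinoid \<iota> r n. Q \<omega> \<noteq> 0 \<and> nrm (f \<omega> * g \<omega> - P \<omega> / Q \<omega>) < \<epsilon>"
  proof (intro bexI ballI)
    fix \<omega> assume \<omega>: "\<omega> \<in> Omega_affinoid \<iota> r n"
    define u where "u = P \<omega> / Q \<omega>"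
    define v where "v = P' \<omega> / Q' \<omega>"
    have uv: "nrm (f \<omega> - u) < \<delta>" "nrm (g \<omega> - v) < \<delta>"
      using PQ(3) PQ'(3) \<omega> by (auto simp: u_def v_def)
    have "nrm v \<le> N"
      using nrm_diff_le[of "g \<omega>" N "g \<omega> - v"] MN(2)[OF \<omega>] uv(2) \<delta>(2) pos(2) by simp
    have "f \<omega> * g \<omega> - u * v = f \<omega> * (g \<omega> - v) + (f \<omega> - u) * v"
      by (simp add: algebra_simps)
    moreover have "nrm (f \<omega> * (g \<omega> - v)) < \<epsilon>"
    proof -
      have "nrm (f \<omega> * (g \<omega> - v)) \<le> M * nrm (g \<omega> - v)"
        unfolding nrm_mult using MN(1)[OF \<omega>] by (intro mult_right_mono) auto
      also have "\<dots> < M * \<delta>"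
        using uv pos by (intro mult_strict_left_mono) auto
      finally show ?thesis
        using \<delta>(3) by (simp add: mult.commute)
    qed
    moreover have "nrm ((f \<omega> - u) * v) < \<epsilon>"
    proof -
      have "nrm ((f \<omega> - u) * v) \<le> nrm (f \<omega> - u) * N"
        unfolding nrm_mult using \<open>nrm v \<le> N\<close> by (intro mult_left_mono) auto
      also have "\<dots> < \<delta> * N"
        using uv pos by (intro mult_strict_right_mono) auto
      finally show ?thesis
        using \<delta>(4) by simp
    qed
    ultimately have "nrm (f \<omega> * g \<omega> - u * v) < \<epsilon>"
      using nrm_add_le_max[of "f \<omega> * (g \<omega> - v)" "(f \<omega> - u) * v"] by simp
    then show "Q \<omega> * Q' \<omega> \<noteq> 0 \<and> nrm (f \<omega> * g \<omega> - (P \<omega> * P' \<omega>) / (Q \<omega> * Q' \<omega>)) < \<epsilon>"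
      using PQ(3) PQ'(3) \<omega> by (simp add: u_def v_def)
  qed (use PQ PQ' in \<open>auto intro: poly_functions.intros\<close>)
qed

lemma bhol_sum: "(\<And>i. i \<in> A \<Longrightarrow> bhol (f i)) \<Longrightarrow> bhol (\<lambda>\<omega>. \<Sum>i\<in>A. f i \<omega>)"
  by (induction A rule: infinite_finite_induct) (auto intro: bhol_add)

lemma bhol_prod: "(\<And>i. i \<in> A \<Longrightarrow> bhol (f i)) \<Longrightarrow> bhol (\<lambda>\<omega>. \<Prod>i\<in>A. f i \<omega>)"
  by (induction A rule: infinite_finite_induct) (auto intro: bhol_mult)

lemma bhol_power: "bhol f \<Longrightarrow> bhol (\<lambda>\<omega>. f \<omega> ^ k)"
  by (induction k) (auto intro: bhol_mult)

lemma bhol_uminus: "bhol f \<Longrightarrow> bhol (\<lambda>\<omega>. - f \<omega>)"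
  using bhol_mult[OF bhol_const[of "- 1"]] by simp

section \<open>Rational functions on an affinoid\<close>

definition rational_on :: "nat \<Rightarrow> ((nat \<Rightarrow> 'c) \<Rightarrow> 'c) \<Rightarrow> bool" where
  "rational_on n f \<longleftrightarrow> (\<exists>P\<in>poly_functions r. \<exists>Q\<in>poly_functions r.
     \<forall>\<omega>\<in>Omega_affinoid \<iota> r n. Q \<omega> \<noteq> 0 \<and> f \<omega> = P \<omega> / Q \<omega>)"

lemma rational_onE:
  assumes "rational_on n f"
  obtains P Q where "P \<in> poly_functions r" "Q \<in> poly_functions r"
    "\<forall>\<omega>\<in>Omega_affinoid \<iota> r n. Q \<omega> \<noteq> 0 \<and> f \<omega> = P \<omega> / Q \<omega>"
  using assms unfolding rational_on_def by blast

lemma rational_on_poly: "P \<in> poly_functions r \<Longrightarrow> rational_on n P"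
  unfolding rational_on_def
  by (intro bexI[of _ P] bexI[of _ "\<lambda>\<omega>. 1"]) (auto intro: poly_functions.const)

lemma rational_on_mult:
  assumes "rational_on n f" "rational_on n g"
  shows "rational_on n (\<lambda>\<omega>. f \<omega> * g \<omega>)"
proof -
  obtain P Q where PQ: "P \<in> poly_functions r" "Q \<in> poly_functions r"
      "\<forall>\<omega>\<in>Omega_affinoid \<iota> r n. Q \<omega> \<noteq> 0 \<and> f \<omega> = P \<omega> / Q \<omega>"
    by (rule rational_onE[OF assms(1)])
  obtain P' Q' where PQ': "P' \<in> poly_functions r" "Q' \<in> poly_functions r"
      "\<forall>\<omega>\<in>Omega_affinoid \<iota> r n. Q' \<omega> \<noteq> 0 \<and> g \<omega> = P' \<omega> / Q' \<omega>"
    by (rule rational_onE[OF assms(2)])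
  from PQ PQ' show ?thesis
    unfolding rational_on_def
    by (intro bexI[of _ "\<lambda>\<omega>. P \<omega> * P' \<omega>"] bexI[of _ "\<lambda>\<omega>. Q \<omega> * Q' \<omega>"])
      (auto intro: poly_functions.intros)
qed

lemma rational_on_diff:
  assumes "rational_on n f" "rational_on n g"
  shows "rational_on n (\<lambda>\<omega>. f \<omega> - g \<omega>)"
proof -
  obtain P Q where PQ: "P \<in> poly_functions r" "Q \<in> poly_functions r"
      "\<forall>\<omega>\<in>Omega_affinoid \<iota> r n. Q \<omega> \<noteq> 0 \<and> f \<omega> = P \<omega> / Q \<omega>"
    by (rule rational_onE[OF assms(1)])
  obtain P' Q' where PQ': "P' \<in> poly_functions r" "Q' \<in> poly_functions r"
      "\<forall>\<omega>\<in>Omega_affinoid \<iota> r n. Q' \<omega> \<noteq> 0 \<and> g \<omega> = P' \<omega> / Q' \<omega>"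
    by (rule rational_onE[OF assms(2)])
  have eq: "\<forall>\<omega>\<in>Omega_affinoid \<iota> r n. Q \<omega> * Q' \<omega> \<noteq> 0
      \<and> f \<omega> - g \<omega> = (P \<omega> * Q' \<omega> + (- 1) * (P' \<omega> * Q \<omega>)) / (Q \<omega> * Q' \<omega>)"
    using PQ(3) PQ'(3) by (simp add: diff_frac_eq)
  have num: "(\<lambda>\<omega>. P \<omega> * Q' \<omega> + (- 1) * (P' \<omega> * Q \<omega>)) \<in> poly_functions r"
    by (intro poly_functions.add poly_functions.mult poly_functions.const PQ PQ')
  have den: "(\<lambda>\<omega>. Q \<omega> * Q' \<omega>) \<in> poly_functions r"
    by (intro poly_functions.mult PQ PQ')
  show ?thesis
    unfolding rational_on_def
    by (intro bexI[of _ "\<lambda>\<omega>. P \<omega> * Q' \<omega> + (- 1) * (P' \<omega> * Q \<omega>)"]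
        bexI[of _ "\<lambda>\<omega>. Q \<omega> * Q' \<omega>"] eq num den)
qed

lemma rational_on_inverse:
  assumes "rational_on n f" "\<And>\<omega>. \<omega> \<in> Omega_affinoid \<iota> r n \<Longrightarrow> f \<omega> \<noteq> 0"
  shows "rational_on n (\<lambda>\<omega>. inverse (f \<omega>))"
proof -
  obtain P Q where PQ: "P \<in> poly_functions r" "Q \<in> poly_functions r"
      "\<forall>\<omega>\<in>Omega_affinoid \<iota> r n. Q \<omega> \<noteq> 0 \<and> f \<omega> = P \<omega> / Q \<omega>"
    by (rule rational_onE[OF assms(1)])
  moreover from PQ(3) have "\<forall>\<omega>\<in>Omega_affinoid \<iota> r n. P \<omega> \<noteq> 0"
    using assms(2) by fastforce
  ultimately show ?thesis
    unfolding rational_on_def by (intro bexI[of _ Q] bexI[of _ P]) auto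
qed

lemma rational_on_const: "rational_on n (\<lambda>\<omega>. c)"
  by (rule rational_on_poly) (rule poly_functions.const)

lemma rational_on_prod:
  "(\<And>i. i \<in> A \<Longrightarrow> rational_on n (f i)) \<Longrightarrow> rational_on n (\<lambda>\<omega>. \<Prod>i\<in>A. f i \<omega>)"
  by (induction A rule: infinite_finite_induct) (auto intro: rational_on_mult rational_on_const)

lemma rational_on_cong:
  assumes "rational_on n f" "\<And>\<omega>. \<omega> \<in> Omega_affinoid \<iota> r n \<Longrightarrow> g \<omega> = f \<omega>"
  shows "rational_on n g"
  using assms unfolding rational_on_def by simp

lemma poly_functions_sum:
  "finite A \<Longrightarrow> (\<And>i. i \<in> A \<Longrightarrow> f i \<in> poly_functions r) \<Longrightarrow> (\<lambda>\<omega>. \<Sum>i\<in>A. f i \<omega>) \<in> poly_functions r"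
  by (induction A rule: finite_induct) (auto intro: poly_functions.intros)

lemma rational_on_lam: "rational_on n (\<lambda>\<omega>. lam \<omega> a)"
  unfolding lam_def
  by (intro rational_on_poly poly_functions_sum poly_functions.mult poly_functions.const
      poly_functions.coord) auto

lemma rational_on_mu: "rational_on n (\<lambda>\<omega>. mu \<omega> c)"
  unfolding mu_def divide_inverse
  by (intro rational_on_mult rational_on_const rational_on_lam)

lemma lam_nonzero_affinoid:
  assumes "\<omega> \<in> Omega_affinoid \<iota> r n" "a \<in> tuples m - {ztup}"
  shows "lam \<omega> a \<noteq> 0"
  using lam_nonzero[OF affinoid_subset[OF assms(1)] tuples_PiE] assms(2) by blast

lemma rational_on_expn_mu: "rational_on n (\<lambda>\<omega>. expn \<omega> m (mu \<omega> c))"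
proof (rule rational_on_cong)
  show "rational_on n (\<lambda>\<omega>. mu \<omega> c * (\<Prod>a\<in>tuples m - {ztup}. 1 - mu \<omega> c * inverse (lam \<omega> a)))"
    by (intro rational_on_mult rational_on_prod rational_on_diff rational_on_mu rational_on_const
        rational_on_inverse rational_on_lam) (rule lam_nonzero_affinoid)
qed (simp add: expn_eq_prod affinoid_subset divide_inverse)

lemma bholI_rational:
  assumes "\<And>n. \<exists>M. \<forall>\<omega>\<in>Omega_affinoid \<iota> r n. nrm (f \<omega>) \<le> M"
    and "\<And>n \<epsilon>. \<epsilon> > 0 \<Longrightarrow> \<exists>g. rational_on n g \<and> (\<forall>\<omega>\<in>Omega_affinoid \<iota> r n. nrm (f \<omega> - g \<omega>) < \<epsilon>)"
  shows "bhol f"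
  unfolding bhol_def
proof (intro allI conjI impI)
  fix n and \<epsilon> :: real assume "\<epsilon> > 0"
  then obtain g where g: "rational_on n g" "\<forall>\<omega>\<in>Omega_affinoid \<iota> r n. nrm (f \<omega> - g \<omega>) < \<epsilon>"
    using assms(2) by blast
  obtain P Q where "P \<in> poly_functions r" "Q \<in> poly_functions r"
      "\<forall>\<omega>\<in>Omega_affinoid \<iota> r n. Q \<omega> \<noteq> 0 \<and> g \<omega> = P \<omega> / Q \<omega>"
    by (rule rational_onE[OF g(1)])
  then show "\<exists>P\<in>poly_functions r. \<exists>Q\<in>poly_functions r.
      \<forall>\<omega>\<in>Omega_affinoid \<iota> r n. Q \<omega> \<noteq> 0 \<and> nrm (f \<omega> - P \<omega> / Q \<omega>) < \<epsilon>"
    using g(2) by (intro bexI[of _ P] bexI[of _ Q]) auto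
qed (rule assms(1))

section \<open>Two-sided bounds for the torsion points\<close>

definition bounded_away :: "nat \<Rightarrow> ((nat \<Rightarrow> 'c) \<Rightarrow> 'c) \<Rightarrow> bool" where
  "bounded_away n f \<longleftrightarrow> (\<exists>b>0. \<exists>B. \<forall>\<omega>\<in>Omega_affinoid \<iota> r n. b \<le> nrm (f \<omega>) \<and> nrm (f \<omega>) \<le> B)"

lemma bounded_away_mult:
  assumes "bounded_away n f" "bounded_away n g"
  shows "bounded_away n (\<lambda>\<omega>. f \<omega> * g \<omega>)"
proof -
  obtain b B where b: "b > 0" "\<forall>\<omega>\<in>Omega_affinoid \<iota> r n. b \<le> nrm (f \<omega>) \<and> nrm (f \<omega>) \<le> B"
    using assms unfolding bounded_away_def by meson
  obtain c C where c: "c > 0" "\<forall>\<omega>\<in>Omega_affinoid \<iota> r n. c \<le> nrm (g \<omega>) \<and> nrm (g \<omega>) \<le> C"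
    using assms unfolding bounded_away_def by meson
  have "b * c \<le> nrm (f \<omega> * g \<omega>) \<and> nrm (f \<omega> * g \<omega>) \<le> B * C" if "\<omega> \<in> Omega_affinoid \<iota> r n" for \<omega>
  proof -
    have "b \<le> nrm (f \<omega>)" "nrm (f \<omega>) \<le> B" "c \<le> nrm (g \<omega>)" "nrm (g \<omega>) \<le> C"
      using b c that by auto
    moreover from this have "0 \<le> B"
      using b(1) by linarith
    ultimately show ?thesis
      unfolding nrm_mult using b(1) c(1) by (intro conjI mult_mono) auto
  qed
  then show ?thesis
    unfolding bounded_away_def using b c by (intro exI[of _ "b * c"] conjI exI[of _ "B * C"]) auto
qed

lemma bounded_away_inverse:
  assumes "bounded_away n f"
  shows "bounded_away n (\<lambda>\<omega>. inverse (f \<omega>))"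
proof -
  obtain b B where b: "b > 0" "\<forall>\<omega>\<in>Omega_affinoid \<iota> r n. b \<le> nrm (f \<omega>) \<and> nrm (f \<omega>) \<le> B"
    using assms unfolding bounded_away_def by meson
  have "inverse (max 1 B) \<le> nrm (inverse (f \<omega>)) \<and> nrm (inverse (f \<omega>)) \<le> inverse b"
    if "\<omega> \<in> Omega_affinoid \<iota> r n" for \<omega>
  proof -
    have "b \<le> nrm (f \<omega>)" "nrm (f \<omega>) \<le> B"
      using b that by auto
    then show ?thesis
      unfolding nrm_inverse using b(1)
      by (intro conjI le_imp_inverse_le) (auto intro: max.coboundedI2)
  qed
  then show ?thesis
    unfolding bounded_away_def
    by (intro exI[of _ "inverse (max 1 B)"] conjI exI[of _ "inverse b"]) auto
qed

lemma bounded_away_const: "c \<noteq> 0 \<Longrightarrow> bounded_away n (\<lambda>\<omega>. c)"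
  unfolding bounded_away_def by (intro exI[of _ "nrm c"] conjI exI[of _ "nrm c"]) auto

lemma bounded_away_prod:
  "(\<And>i. i \<in> A \<Longrightarrow> bounded_away n (f i)) \<Longrightarrow> bounded_away n (\<lambda>\<omega>. \<Prod>i\<in>A. f i \<omega>)"
  by (induction A rule: infinite_finite_induct) (auto intro: bounded_away_mult bounded_away_const)

lemma bounded_away_cong:
  assumes "bounded_away n f" "\<And>\<omega>. \<omega> \<in> Omega_affinoid \<iota> r n \<Longrightarrow> g \<omega> = f \<omega>"
  shows "bounded_away n g"
  using assms unfolding bounded_away_def by simp

lemma bounded_away_lam:
  assumes "a \<in> {2..r} \<rightarrow>\<^sub>E UNIV" "a \<noteq> ztup"
  shows "bounded_away n (\<lambda>\<omega>. lam \<omega> a)"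
proof -
  obtain m where "a \<in> tuples m"
    using PiE_tuples[OF assms(1)] by blast
  then show ?thesis
    unfolding bounded_away_def using nrm_lam_ge_1[OF _ assms] nrm_lam_le
    by (intro exI[of _ "1 / real CARD('f) ^ n"] conjI
        exI[of _ "real CARD('f) ^ m * real CARD('f) ^ n"]) auto
qed

lemma bounded_away_mu:
  assumes "c \<in> tuples 1" "c \<noteq> ztup"
  shows "bounded_away n (\<lambda>\<omega>. mu \<omega> c)"
  unfolding mu_def divide_inverse
  by (intro bounded_away_mult bounded_away_const bounded_away_lam tuples_PiE[OF assms(1)] assms(2))
    simp

text \<open>Each factor \<open>1 - mu \<omega> c / lam \<omega> a\<close> equals
  \<open>lam \<omega> (d a) / (T * lam \<omega> a)\<close> with \<open>d a = T a - c\<close>, a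
  quotient of lattice points up to \<open>T\<close>. The tuple \<open>d a\<close> is nonzero because
  its constant term is \<open>- c\<close>.\<close>

lemma bounded_away_expn_mu:
  assumes "c \<in> tuples 1" "c \<noteq> ztup"
  shows "bounded_away n (\<lambda>\<omega>. expn \<omega> m (mu \<omega> c))"
proof (rule bounded_away_cong)
  define d where "d a = (\<lambda>i\<in>{2..r}. [:0, 1:] * a i - c i)" for a
  have lam_d: "lam \<omega> (d a) = T * lam \<omega> a - lam \<omega> c" for \<omega> a
  proof -
    have "lam \<omega> (d a) = lam \<omega> (\<lambda>i\<in>{2..r}. (\<lambda>i\<in>{2..r}. [:0, 1:] * a i) i - c i)"
      unfolding d_def by (rule lam_cong) simp
    then show ?thesis
      by (simp only: lam_diff lam_mult A_emb_T)
  qed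
  obtain i where i: "i \<in> {2..r}" "c i \<noteq> 0"
    using tuple_nonzero[OF tuples_PiE[OF assms(1)] assms(2)] by blast
  have "c i \<in> polys_below 1"
    using assms i by (auto simp: tuples_def)
  then obtain u where u: "c i = [:u:]"
    using polys_below_Suc[of 0] by (auto simp: polys_below_0)
  have d: "d a \<in> {2..r} \<rightarrow>\<^sub>E UNIV" "d a \<noteq> ztup" for a
  proof -
    show "d a \<in> {2..r} \<rightarrow>\<^sub>E UNIV"
      by (auto simp: d_def)
    have "Polynomial.coeff (d a i) 0 \<noteq> 0"
      using i u by (simp add: d_def)
    then show "d a \<noteq> ztup"
      using i by (auto simp: ztup_def)
  qed
  show "bounded_away n (\<lambda>\<omega>. mu \<omega> c
      * (\<Prod>a\<in>tuples m - {ztup}. lam \<omega> (d a) * inverse T * inverse (lam \<omega> a)))"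
    by (intro bounded_away_mult bounded_away_prod bounded_away_inverse bounded_away_const
        bounded_away_mu[OF assms] bounded_away_lam d)
      (use tuples_PiE in \<open>blast | simp\<close>)+
  fix \<omega> assume "\<omega> \<in> Omega_affinoid \<iota> r n"
  then have \<omega>: "\<omega> \<in> Omega \<iota> r"
    by (rule affinoid_subset)
  show "expn \<omega> m (mu \<omega> c)
      = mu \<omega> c * (\<Prod>a\<in>tuples m - {ztup}. lam \<omega> (d a) * inverse T * inverse (lam \<omega> a))"
    unfolding expn_eq_prod[OF \<omega>]
  proof (intro arg_cong2[of _ _ _ _ "(*)"] refl prod.cong)
    fix a assume "a \<in> tuples m - {ztup}"
    then have "lam \<omega> a \<noteq> 0"
      using lam_nonzero[OF \<omega>] tuples_PiE by auto
    then show "1 - mu \<omega> c / lam \<omega> a = lam \<omega> (d a) * inverse T * inverse (lam \<omega> a)"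
      by (simp add: lam_d mu_def field_simps)
  qed
qed

text \<open>One lower bound \<open>b\<close> serves the limit and the approximants alike, because
  their absolute values agree from level \<open>m0\<close> on. Uniform approximation of the inverse
  relies on this.\<close>

lemma expL_mu_estimates:
  assumes "c \<in> tuples 1" "c \<noteq> ztup"
  shows "\<exists>b>0. \<exists>B. (\<forall>\<omega>\<in>Omega_affinoid \<iota> r n. b \<le> nrm (expL \<omega> (mu \<omega> c)) \<and> nrm (expL \<omega> (mu \<omega> c)) \<le> B)
    \<and> (\<forall>\<epsilon>>0. \<exists>m. \<forall>\<omega>\<in>Omega_affinoid \<iota> r n.
        nrm (expL \<omega> (mu \<omega> c) - expn \<omega> m (mu \<omega> c)) < \<epsilon> \<and> b \<le> nrm (expn \<omega> m (mu \<omega> c)))"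
proof -
  obtain R where R: "\<And>\<omega>. \<omega> \<in> Omega_affinoid \<iota> r n \<Longrightarrow> nrm (mu \<omega> c) \<le> R"
    using bounded_away_mu[OF assms, of n] unfolding bounded_away_def by meson
  obtain m0 where m0: "R * real CARD('f) ^ n / real CARD('f) ^ m0 < 1"
    using exists_level by blast
  obtain b B where b: "b > 0" "\<And>\<omega>. \<omega> \<in> Omega_affinoid \<iota> r n \<Longrightarrow>
      b \<le> nrm (expn \<omega> m0 (mu \<omega> c)) \<and> nrm (expn \<omega> m0 (mu \<omega> c)) \<le> B"
    using bounded_away_expn_mu[OF assms, of n m0] unfolding bounded_away_def by meson
  have "\<exists>m. \<forall>\<omega>\<in>Omega_affinoid \<iota> r n.
        nrm (expL \<omega> (mu \<omega> c) - expn \<omega> m (mu \<omega> c)) < \<epsilon> \<and> b \<le> nrm (expn \<omega> m (mu \<omega> c))"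
    if "\<epsilon> > 0" for \<epsilon>
  proof -
    have "(\<lambda>m. B * (R * real CARD('f) ^ n / real CARD('f) ^ m)) \<longlonglongrightarrow> 0"
      using tendsto_mult[OF tendsto_const[of B]
          LIMSEQ_divide_realpow_zero[OF card_gt_1, of "R * real CARD('f) ^ n"]] by simp
    from order_tendstoD(2)[OF this that]
    obtain M where M: "\<And>m. m \<ge> M \<Longrightarrow> B * (R * real CARD('f) ^ n / real CARD('f) ^ m) < \<epsilon>"
      by (auto simp: eventually_sequentially)
    define m where "m = max m0 M"
    have "nrm (expL \<omega> (mu \<omega> c) - expn \<omega> m (mu \<omega> c)) < \<epsilon> \<and> b \<le> nrm (expn \<omega> m (mu \<omega> c))"
      if \<omega>: "\<omega> \<in> Omega_affinoid \<iota> r n" for \<omega>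
    proof
      have "m0 \<le> m"
        by (simp add: m_def)
      note approx = exp_approx[OF \<omega> R[OF \<omega>] m0 this]
      have "0 \<le> R"
        using R[OF \<omega>] nrm_nonneg[of "mu \<omega> c"] by linarith
      have "nrm (expL \<omega> (mu \<omega> c) - expn \<omega> m (mu \<omega> c))
          \<le> nrm (expn \<omega> m0 (mu \<omega> c)) * (R * real CARD('f) ^ n / real CARD('f) ^ m)"
        by (rule approx(2))
      also have "\<dots> \<le> B * (R * real CARD('f) ^ n / real CARD('f) ^ m)"
        using b(2)[OF \<omega>] \<open>0 \<le> R\<close> by (intro mult_right_mono) auto
      also have "\<dots> < \<epsilon>"
        by (rule M) (simp add: m_def)
      finally show "nrm (expL \<omega> (mu \<omega> c) - expn \<omega> m (mu \<omega> c)) < \<epsilon>" .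
      show "b \<le> nrm (expn \<omega> m (mu \<omega> c))"
        unfolding approx(1) using b(2)[OF \<omega>] by simp
    qed
    then show ?thesis
      by blast
  qed
  moreover have "b \<le> nrm (expL \<omega> (mu \<omega> c)) \<and> nrm (expL \<omega> (mu \<omega> c)) \<le> B"
    if \<omega>: "\<omega> \<in> Omega_affinoid \<iota> r n" for \<omega>
    using nrm_expL[OF \<omega> R[OF \<omega>] m0] b(2)[OF \<omega>] by simp
  ultimately show ?thesis
    using b(1) by blast
qed

lemma bhol_expL_mu:
  assumes "c \<in> tuples 1" "c \<noteq> ztup"
  shows "bhol (\<lambda>\<omega>. expL \<omega> (mu \<omega> c))"
proof (rule bholI_rational)
  show "\<exists>M. \<forall>\<omega>\<in>Omega_affinoid \<iota> r n. nrm (expL \<omega> (mu \<omega> c)) \<le> M" for n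
    using expL_mu_estimates[OF assms, of n] by meson
  fix n and \<epsilon> :: real assume "\<epsilon> > 0"
  then obtain m where "\<forall>\<omega>\<in>Omega_affinoid \<iota> r n. nrm (expL \<omega> (mu \<omega> c) - expn \<omega> m (mu \<omega> c)) < \<epsilon>"
    using expL_mu_estimates[OF assms, of n] by meson
  then show "\<exists>g. rational_on n g \<and> (\<forall>\<omega>\<in>Omega_affinoid \<iota> r n. nrm (expL \<omega> (mu \<omega> c) - g \<omega>) < \<epsilon>)"
    by (intro exI[of _ "\<lambda>\<omega>. expn \<omega> m (mu \<omega> c)"]) (simp add: rational_on_expn_mu)
qed

lemma bhol_inverse_expL_mu:
  assumes "c \<in> tuples 1" "c \<noteq> ztup"
  shows "bhol (\<lambda>\<omega>. inverse (expL \<omega> (mu \<omega> c)))"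
proof (rule bholI_rational)
  fix n
  obtain b where b: "b > 0" "\<And>\<omega>. \<omega> \<in> Omega_affinoid \<iota> r n \<Longrightarrow> b \<le> nrm (expL \<omega> (mu \<omega> c))"
    and approx: "\<And>\<epsilon>. \<epsilon> > 0 \<Longrightarrow> \<exists>m. \<forall>\<omega>\<in>Omega_affinoid \<iota> r n.
        nrm (expL \<omega> (mu \<omega> c) - expn \<omega> m (mu \<omega> c)) < \<epsilon> \<and> b \<le> nrm (expn \<omega> m (mu \<omega> c))"
    using expL_mu_estimates[OF assms, of n] by meson
  have "nrm (inverse (expL \<omega> (mu \<omega> c))) \<le> inverse b" if "\<omega> \<in> Omega_affinoid \<iota> r n" for \<omega>
    unfolding nrm_inverse using b that by (intro le_imp_inverse_le) auto
  then show "\<exists>M. \<forall>\<omega>\<in>Omega_affinoid \<iota> r n. nrm (inverse (expL \<omega> (mu \<omega> c))) \<le> M"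
    by blast
  fix \<epsilon> :: real assume "\<epsilon> > 0"
  \<comment> \<open>Since \<open>|1/x - 1/y| = |x - y| / (|x| |y|)\<close> with both absolute values
    at least \<open>b\<close>, precision \<open>\<epsilon> b^2\<close> is enough.\<close>
  then have "\<epsilon> * (b * b) > 0"
    using b by simp
  then obtain m where m: "\<And>\<omega>. \<omega> \<in> Omega_affinoid \<iota> r n \<Longrightarrow>
      nrm (expL \<omega> (mu \<omega> c) - expn \<omega> m (mu \<omega> c)) < \<epsilon> * (b * b) \<and> b \<le> nrm (expn \<omega> m (mu \<omega> c))"
    using approx by meson
  have "nrm (inverse (expL \<omega> (mu \<omega> c)) - inverse (expn \<omega> m (mu \<omega> c))) < \<epsilon>"
    if \<omega>: "\<omega> \<in> Omega_affinoid \<iota> r n" for \<omega>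
  proof -
    define x where "x = expL \<omega> (mu \<omega> c)"
    define y where "y = expn \<omega> m (mu \<omega> c)"
    have xy: "b \<le> nrm x" "b \<le> nrm y" "nrm (x - y) < \<epsilon> * (b * b)"
      using b(2)[OF \<omega>] m[OF \<omega>] by (auto simp: x_def y_def)
    then have nz: "x \<noteq> 0" "y \<noteq> 0"
      using b(1) by (auto simp flip: nrm_pos_iff)
    have "nrm (x - y) < \<epsilon> * (nrm x * nrm y)"
    proof -
      have "b * b \<le> nrm x * nrm y"
        using xy b(1) by (intro mult_mono) auto
      then have "\<epsilon> * (b * b) \<le> \<epsilon> * (nrm x * nrm y)"
        using \<open>\<epsilon> > 0\<close> by (intro mult_left_mono) auto
      then show ?thesis
        using xy(3) by linarith
    qed
    then have "nrm (x - y) / (nrm x * nrm y) < \<epsilon>"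
      using nz by (simp add: pos_divide_less_eq)
    then show ?thesis
      using nrm_inverse_diff[OF nz] by (simp add: x_def y_def)
  qed
  moreover have "rational_on n (\<lambda>\<omega>. inverse (expn \<omega> m (mu \<omega> c)))"
    using m b(1) by (intro rational_on_inverse rational_on_expn_mu) (force simp flip: nrm_pos_iff)
  ultimately show "\<exists>g. rational_on n g
      \<and> (\<forall>\<omega>\<in>Omega_affinoid \<iota> r n. nrm (inverse (expL \<omega> (mu \<omega> c)) - g \<omega>) < \<epsilon>)"
    by blast
qed

end

section \<open>Polynomials over the ring of holomorphic functions\<close>

text \<open>
  Evaluates \<^const>\<open>finprod\<close> and \<^const>\<open>finsum\<close> without knowing that the ambient structure is a
  commutative monoid; only the partial results have to be closed.
\<close>

lemma foldD_eqI:
  assumes "finite A" and e: "e = h {}"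
    and closed: "\<And>B. B \<subseteq> A \<Longrightarrow> h B \<in> D"
    and step: "\<And>x B. x \<in> A \<Longrightarrow> B \<subseteq> A \<Longrightarrow> x \<notin> B \<Longrightarrow> f x (h B) = h (insert x B)"
  shows "foldD D f e A = h A"
  unfolding foldD_def
proof (rule the_equality)
  have "(B, h B) \<in> foldSetD D f e" if "B \<subseteq> A" for B
    using finite_subset[OF that assms(1)] that
  proof (induction B rule: finite_induct)
    case empty
    show ?case
      unfolding e by (intro foldSetD.emptyI closed) simp
  next
    case (insert x B)
    then have "f x (h B) = h (insert x B)"
      by (intro step) auto
    then show ?case
      using insert closed[of "insert x B"] foldSetD.insertI[of x B f "h B" D e] by auto
  qed
  then show "(A, h A) \<in> foldSetD D f e"
    by simp
  have "B \<subseteq> A \<longrightarrow> y = h B" if "(B, y) \<in> foldSetD D f e" for B y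
    using that
  proof (induction rule: foldSetD.induct)
    case (insertI x B y)
    then show ?case
      using step[of x B] by auto
  qed (simp add: e)
  then show "\<And>y. (A, y) \<in> foldSetD D f e \<Longrightarrow> y = h A"
    by simp
qed

context lattice_setting
begin

text \<open>A polynomial over \<open>O'\<close> seen as a family of polynomials over
  \<open>'c\<close>. The degree bound is uniform in \<open>\<omega>\<close>, as \<open>up\<close>
  asks for one bound on the whole coefficient sequence.\<close>

definition bhol_poly :: "((nat \<Rightarrow> 'c) \<Rightarrow> 'c poly) \<Rightarrow> bool" where
  "bhol_poly F \<longleftrightarrow> (\<forall>k. bhol (\<lambda>\<omega>. Polynomial.coeff (F \<omega>) k))
     \<and> (\<exists>N. \<forall>\<omega>\<in>Omega \<iota> r. degree (F \<omega>) \<le> N)"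

lemma bhol_polyI:
  assumes "\<And>k. bhol (\<lambda>\<omega>. Polynomial.coeff (F \<omega>) k)"
    and "\<And>\<omega>. \<omega> \<in> Omega \<iota> r \<Longrightarrow> degree (F \<omega>) \<le> N"
  shows "bhol_poly F"
  using assms unfolding bhol_poly_def by blast

lemma bhol_poly_coeff: "bhol_poly F \<Longrightarrow> bhol (\<lambda>\<omega>. Polynomial.coeff (F \<omega>) k)"
  by (simp add: bhol_poly_def)

lemma bhol_poly_degree: "bhol_poly F \<Longrightarrow> \<exists>N. \<forall>\<omega>\<in>Omega \<iota> r. degree (F \<omega>) \<le> N"
  by (simp add: bhol_poly_def)

lemma bhol_poly_cong:
  assumes "\<And>\<omega>. \<omega> \<in> Omega \<iota> r \<Longrightarrow> F \<omega> = G \<omega>"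
  shows "bhol_poly F \<longleftrightarrow> bhol_poly G"
proof -
  have "bhol (\<lambda>\<omega>. Polynomial.coeff (F \<omega>) k) \<longleftrightarrow> bhol (\<lambda>\<omega>. Polynomial.coeff (G \<omega>) k)" for k
    by (rule bhol_cong) (simp add: assms)
  then show ?thesis
    using assms by (simp add: bhol_poly_def)
qed

lemma bhol_poly_const [simp]: "bhol_poly (\<lambda>\<omega>. p)"
  by (rule bhol_polyI) auto

lemma bhol_poly_linear:
  assumes "bhol f"
  shows "bhol_poly (\<lambda>\<omega>. [:a, f \<omega>:])"
proof (rule bhol_polyI)
  fix k
  have "Polynomial.coeff [:a, f \<omega>:] k = (if k = 0 then a else if k = 1 then f \<omega> else 0)" for \<omega>
    by (auto simp: coeff_pCons split: nat.splits)
  then show "bhol (\<lambda>\<omega>. Polynomial.coeff [:a, f \<omega>:] k)"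
    using assms by (cases "k = 0"; cases "k = 1") simp_all
next
  show "degree [:a, f \<omega>:] \<le> 1" for \<omega>
    by simp
qed

lemma bhol_poly_add:
  assumes "bhol_poly F" "bhol_poly G"
  shows "bhol_poly (\<lambda>\<omega>. F \<omega> + G \<omega>)"
proof -
  obtain M where M: "\<forall>\<omega>\<in>Omega \<iota> r. degree (F \<omega>) \<le> M"
    using bhol_poly_degree[OF assms(1)] by blast
  obtain N where N: "\<forall>\<omega>\<in>Omega \<iota> r. degree (G \<omega>) \<le> N"
    using bhol_poly_degree[OF assms(2)] by blast
  show ?thesis
  proof (rule bhol_polyI)
    show "bhol (\<lambda>\<omega>. Polynomial.coeff (F \<omega> + G \<omega>) k)" for k
      unfolding coeff_add by (intro bhol_add bhol_poly_coeff assms)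
    show "degree (F \<omega> + G \<omega>) \<le> max M N" if "\<omega> \<in> Omega \<iota> r" for \<omega>
      using M N that by (intro degree_add_le) (auto intro: max.coboundedI1 max.coboundedI2)
  qed
qed

lemma bhol_poly_mult:
  assumes "bhol_poly F" "bhol_poly G"
  shows "bhol_poly (\<lambda>\<omega>. F \<omega> * G \<omega>)"
proof -
  obtain M where M: "\<forall>\<omega>\<in>Omega \<iota> r. degree (F \<omega>) \<le> M"
    using bhol_poly_degree[OF assms(1)] by blast
  obtain N where N: "\<forall>\<omega>\<in>Omega \<iota> r. degree (G \<omega>) \<le> N"
    using bhol_poly_degree[OF assms(2)] by blast
  show ?thesis
  proof (rule bhol_polyI)
    show "bhol (\<lambda>\<omega>. Polynomial.coeff (F \<omega> * G \<omega>) k)" for k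
      unfolding coeff_mult by (intro bhol_sum bhol_mult bhol_poly_coeff assms)
    show "degree (F \<omega> * G \<omega>) \<le> M + N" if "\<omega> \<in> Omega \<iota> r" for \<omega>
      using M N that by (intro order.trans[OF degree_mult_le] add_mono) auto
  qed
qed

lemma bhol_poly_smult:
  assumes "bhol f" "bhol_poly F"
  shows "bhol_poly (\<lambda>\<omega>. Polynomial.smult (f \<omega>) (F \<omega>))"
proof -
  obtain N where N: "\<forall>\<omega>\<in>Omega \<iota> r. degree (F \<omega>) \<le> N"
    using bhol_poly_degree[OF assms(2)] by blast
  show ?thesis
  proof (rule bhol_polyI)
    show "bhol (\<lambda>\<omega>. Polynomial.coeff (Polynomial.smult (f \<omega>) (F \<omega>)) k)" for k
      unfolding coeff_smult by (intro bhol_mult bhol_poly_coeff assms)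
    show "degree (Polynomial.smult (f \<omega>) (F \<omega>)) \<le> N" if "\<omega> \<in> Omega \<iota> r" for \<omega>
      using N that by (intro order.trans[OF degree_smult_le]) auto
  qed
qed

lemma bhol_poly_sum: "(\<And>i. i \<in> A \<Longrightarrow> bhol_poly (F i)) \<Longrightarrow> bhol_poly (\<lambda>\<omega>. \<Sum>i\<in>A. F i \<omega>)"
  by (induction A rule: infinite_finite_induct) (auto intro: bhol_poly_add)

lemma bhol_poly_prod: "(\<And>i. i \<in> A \<Longrightarrow> bhol_poly (F i)) \<Longrightarrow> bhol_poly (\<lambda>\<omega>. \<Prod>i\<in>A. F i \<omega>)"
  by (induction A rule: infinite_finite_induct) (auto intro: bhol_poly_mult)

lemma bhol_poly_power: "bhol_poly F \<Longrightarrow> bhol_poly (\<lambda>\<omega>. F \<omega> ^ k)"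
  by (induction k) (auto intro: bhol_poly_mult)

text \<open>The degree of \<open>F \<omega>\<close> may vary with \<open>\<omega>\<close>, so the
  composite is written as a sum up to the uniform bound \<open>N\<close>.\<close>

lemma bhol_poly_pcompose:
  assumes "bhol_poly F" "bhol_poly G"
  shows "bhol_poly (\<lambda>\<omega>. pcompose (F \<omega>) (G \<omega>))"
proof -
  obtain N where N: "\<forall>\<omega>\<in>Omega \<iota> r. degree (F \<omega>) \<le> N"
    using bhol_poly_degree[OF assms(1)] by blast
  have "pcompose (F \<omega>) (G \<omega>) = (\<Sum>i\<le>N. Polynomial.smult (Polynomial.coeff (F \<omega>) i) (G \<omega> ^ i))"
    if "\<omega> \<in> Omega \<iota> r" for \<omega>
  proof -
    have "pcompose (F \<omega>) (G \<omega>)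
        = (\<Sum>i\<le>degree (F \<omega>). Polynomial.smult (Polynomial.coeff (F \<omega>) i) (G \<omega> ^ i))"
      by (simp add: pcompose_altdef poly_altdef degree_map_poly coeff_map_poly)
    also have "\<dots> = (\<Sum>i\<le>N. Polynomial.smult (Polynomial.coeff (F \<omega>) i) (G \<omega> ^ i))"
      using N that by (intro sum.mono_neutral_left) (auto simp: coeff_eq_0)
    finally show ?thesis .
  qed
  moreover have "bhol_poly (\<lambda>\<omega>. \<Sum>i\<le>N. Polynomial.smult (Polynomial.coeff (F \<omega>) i) (G \<omega> ^ i))"
    by (intro bhol_poly_sum bhol_poly_smult bhol_poly_coeff bhol_poly_power assms)
  ultimately show ?thesis
    using bhol_poly_cong[of "\<lambda>\<omega>. pcompose (F \<omega>) (G \<omega>)"] by simp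
qed

lemma bhol_poly_rev_poly:
  assumes "bhol_poly F"
  shows "bhol_poly (\<lambda>\<omega>. rev_poly N (F \<omega>))"
proof (rule bhol_polyI)
  show "bhol (\<lambda>\<omega>. Polynomial.coeff (rev_poly N (F \<omega>)) k)" for k
    unfolding coeff_rev_poly using assms by (cases "k \<le> N") (auto intro: bhol_poly_coeff)
  show "degree (rev_poly N (F \<omega>)) \<le> N" for \<omega>
    by (rule degree_le) (simp add: coeff_rev_poly)
qed

section \<open>Passage to the formal polynomial ring\<close>

definition enc :: "((nat \<Rightarrow> 'c) \<Rightarrow> 'c poly) \<Rightarrow> nat \<Rightarrow> (nat \<Rightarrow> 'c) \<Rightarrow> 'c" where
  "enc F = (\<lambda>n. \<lambda>\<omega>\<in>Omega \<iota> r. Polynomial.coeff (F \<omega>) n)"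

lemma enc_in_up:
  assumes "bhol_poly F"
  shows "enc F \<in> up (hol_ring \<iota> r)"
proof (rule mem_upI)
  show "enc F n \<in> carrier (hol_ring \<iota> r)" for n
    unfolding enc_def hol_ring_def using bhol_holomorphic[OF bhol_poly_coeff[OF assms]] by simp
  obtain N where N: "\<forall>\<omega>\<in>Omega \<iota> r. degree (F \<omega>) \<le> N"
    using bhol_poly_degree[OF assms] by blast
  have "bound \<zero>\<^bsub>hol_ring \<iota> r\<^esub> N (enc F)"
  proof
    fix m assume "N < m"
    then have "Polynomial.coeff (F \<omega>) m = 0" if "\<omega> \<in> Omega \<iota> r" for \<omega>
      using N that by (intro coeff_eq_0) (auto intro: le_less_trans)
    then show "enc F m = \<zero>\<^bsub>hol_ring \<iota> r\<^esub>"
      by (auto simp: enc_def hol_ring_def restrict_def)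
  qed
  then show "\<exists>n. bound \<zero>\<^bsub>hol_ring \<iota> r\<^esub> n (enc F)" ..
qed

text \<open>Coefficients of a product in \<open>UP\<close> are given by \<open>finsum\<close>; the
  partial sums stay in the carrier because \<open>bhol\<close> is closed under addition.\<close>

lemma finsum_hol_ring:
  assumes "finite A" "\<And>i. i \<in> A \<Longrightarrow> bhol (g i)"
  shows "finsum (hol_ring \<iota> r) (\<lambda>i. restrict (g i) (Omega \<iota> r)) A
    = (\<lambda>\<omega>\<in>Omega \<iota> r. \<Sum>i\<in>A. g i \<omega>)"
proof -
  have "foldD (carrier (hol_ring \<iota> r)) (add (hol_ring \<iota> r) \<circ> (\<lambda>i. restrict (g i) (Omega \<iota> r)))
      \<zero>\<^bsub>hol_ring \<iota> r\<^esub> A = (\<lambda>\<omega>\<in>Omega \<iota> r. \<Sum>i\<in>A. g i \<omega>)"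
  proof (rule foldD_eqI[where h = "\<lambda>B. \<lambda>\<omega>\<in>Omega \<iota> r. \<Sum>i\<in>B. g i \<omega>"])
    fix B assume "B \<subseteq> A"
    then have "bhol (\<lambda>\<omega>. \<Sum>i\<in>B. g i \<omega>)"
      using assms(2) by (intro bhol_sum) auto
    then show "(\<lambda>\<omega>\<in>Omega \<iota> r. \<Sum>i\<in>B. g i \<omega>) \<in> carrier (hol_ring \<iota> r)"
      using bhol_holomorphic by (simp add: hol_ring_def)
    fix x assume "x \<notin> B"
    then show "(add (hol_ring \<iota> r) \<circ> (\<lambda>i. restrict (g i) (Omega \<iota> r))) x
        (\<lambda>\<omega>\<in>Omega \<iota> r. \<Sum>i\<in>B. g i \<omega>) = (\<lambda>\<omega>\<in>Omega \<iota> r. \<Sum>i\<in>insert x B. g i \<omega>)"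
      using finite_subset[OF \<open>B \<subseteq> A\<close> assms(1)]
      by (auto simp: hol_ring_def restrict_def fun_eq_iff)
  qed (use assms in \<open>auto simp: hol_ring_def\<close>)
  then show ?thesis
    using assms(1) by (simp add: finsum_def finprod_def)
qed

lemma enc_mult:
  assumes "bhol_poly F" "bhol_poly G"
  shows "enc F \<otimes>\<^bsub>UP (hol_ring \<iota> r)\<^esub> enc G = enc (\<lambda>\<omega>. F \<omega> * G \<omega>)"
proof
  fix n
  have "(enc F \<otimes>\<^bsub>UP (hol_ring \<iota> r)\<^esub> enc G) n
      = finsum (hol_ring \<iota> r) (\<lambda>i. enc F i \<otimes>\<^bsub>hol_ring \<iota> r\<^esub> enc G (n - i)) {..n}"
    using enc_in_up[OF assms(1)] enc_in_up[OF assms(2)] by (simp add: UP_def)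
  also have "(\<lambda>i. enc F i \<otimes>\<^bsub>hol_ring \<iota> r\<^esub> enc G (n - i))
      = (\<lambda>i. restrict (\<lambda>\<omega>. Polynomial.coeff (F \<omega>) i * Polynomial.coeff (G \<omega>) (n - i)) (Omega \<iota> r))"
    by (auto simp: fun_eq_iff hol_ring_def enc_def restrict_def)
  also have "finsum (hol_ring \<iota> r) \<dots> {..n}
      = (\<lambda>\<omega>\<in>Omega \<iota> r. \<Sum>i\<in>{..n}. Polynomial.coeff (F \<omega>) i * Polynomial.coeff (G \<omega>) (n - i))"
    by (intro finsum_hol_ring bhol_mult bhol_poly_coeff assms) simp
  also have "\<dots> = enc (\<lambda>\<omega>. F \<omega> * G \<omega>) n"
    by (simp add: enc_def coeff_mult)
  finally show "(enc F \<otimes>\<^bsub>UP (hol_ring \<iota> r)\<^esub> enc G) n = enc (\<lambda>\<omega>. F \<omega> * G \<omega>) n" .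
qed

lemma enc_one: "\<one>\<^bsub>UP (hol_ring \<iota> r)\<^esub> = enc (\<lambda>\<omega>. 1)"
  by (auto simp: UP_def hol_ring_def enc_def fun_eq_iff Polynomial.coeff_1 restrict_def)

lemma finprod_enc:
  assumes "finite M" "\<And>a. a \<in> M \<Longrightarrow> s a = enc (F a)" "\<And>a. a \<in> M \<Longrightarrow> bhol_poly (F a)"
  shows "finprod (UP (hol_ring \<iota> r)) s M = enc (\<lambda>\<omega>. \<Prod>a\<in>M. F a \<omega>)"
proof -
  have "foldD (carrier (UP (hol_ring \<iota> r))) (monoid.mult (UP (hol_ring \<iota> r)) \<circ> s)
      \<one>\<^bsub>UP (hol_ring \<iota> r)\<^esub> M = enc (\<lambda>\<omega>. \<Prod>a\<in>M. F a \<omega>)"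
  proof (rule foldD_eqI[where h = "\<lambda>B. enc (\<lambda>\<omega>. \<Prod>a\<in>B. F a \<omega>)"])
    fix B assume "B \<subseteq> M"
    then have B: "bhol_poly (\<lambda>\<omega>. \<Prod>a\<in>B. F a \<omega>)"
      using assms(3) by (intro bhol_poly_prod) auto
    then show "enc (\<lambda>\<omega>. \<Prod>a\<in>B. F a \<omega>) \<in> carrier (UP (hol_ring \<iota> r))"
      using enc_in_up by (simp add: UP_def)
    fix x assume "x \<in> M" "x \<notin> B"
    then show "(monoid.mult (UP (hol_ring \<iota> r)) \<circ> s) x (enc (\<lambda>\<omega>. \<Prod>a\<in>B. F a \<omega>))
        = enc (\<lambda>\<omega>. \<Prod>a\<in>insert x B. F a \<omega>)"
      using finite_subset[OF \<open>B \<subseteq> M\<close> assms(1)] assms B by (simp add: enc_mult)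
  qed (use assms(1) in \<open>auto simp: enc_one\<close>)
  then show ?thesis
    using assms(1) by (simp add: finprod_def)
qed

text \<open>Negation in \<open>UP\<close> is a definite description. The pointwise negative is an
  inverse of the unit; any other agrees with it on \<open>\<Omega>\<close> by the defining equation
  and off \<open>\<Omega>\<close> by extensionality.\<close>

lemma enc_minus_one:
  assumes "bhol_poly F"
  shows "enc F \<ominus>\<^bsub>UP (hol_ring \<iota> r)\<^esub> \<one>\<^bsub>UP (hol_ring \<iota> r)\<^esub> = enc (\<lambda>\<omega>. F \<omega> - 1)"
proof -
  let ?R = "hol_ring \<iota> r"
  have up: "enc (\<lambda>\<omega>. 1) \<in> up ?R" "enc (\<lambda>\<omega>. - 1) \<in> up ?R" "enc F \<in> up ?R"
    using assms by (auto intro!: enc_in_up)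
  have add: "x \<oplus>\<^bsub>UP ?R\<^esub> y = (\<lambda>i. \<lambda>\<omega>\<in>Omega \<iota> r. x i \<omega> + y i \<omega>)" if "x \<in> up ?R" "y \<in> up ?R" for x y
    using that by (simp add: UP_def hol_ring_def)
  have "\<ominus>\<^bsub>UP ?R\<^esub> enc (\<lambda>\<omega>. 1) = enc (\<lambda>\<omega>. - 1)"
    unfolding a_inv_def m_inv_def
  proof (rule the_equality)
    show "enc (\<lambda>\<omega>. - 1) \<in> carrier (add_monoid (UP ?R))
        \<and> enc (\<lambda>\<omega>. 1) \<otimes>\<^bsub>add_monoid (UP ?R)\<^esub> enc (\<lambda>\<omega>. - 1) = \<one>\<^bsub>add_monoid (UP ?R)\<^esub>
        \<and> enc (\<lambda>\<omega>. - 1) \<otimes>\<^bsub>add_monoid (UP ?R)\<^esub> enc (\<lambda>\<omega>. 1) = \<one>\<^bsub>add_monoid (UP ?R)\<^esub>"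
      using up by (simp add: add) (auto simp: UP_def hol_ring_def enc_def fun_eq_iff restrict_def)
  next
    fix y assume y: "y \<in> carrier (add_monoid (UP ?R))
        \<and> enc (\<lambda>\<omega>. 1) \<otimes>\<^bsub>add_monoid (UP ?R)\<^esub> y = \<one>\<^bsub>add_monoid (UP ?R)\<^esub>
        \<and> y \<otimes>\<^bsub>add_monoid (UP ?R)\<^esub> enc (\<lambda>\<omega>. 1) = \<one>\<^bsub>add_monoid (UP ?R)\<^esub>"
    then have y_up: "y \<in> up ?R"
      by (simp add: UP_def)
    have "(\<lambda>i. \<lambda>\<omega>\<in>Omega \<iota> r. enc (\<lambda>\<omega>. 1) i \<omega> + y i \<omega>) = (\<lambda>i. \<zero>\<^bsub>?R\<^esub>)"
      using y add[OF up(1) y_up] by (simp add: UP_def)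
    then have sum0: "enc (\<lambda>\<omega>. 1) i \<omega> + y i \<omega> = 0" if "\<omega> \<in> Omega \<iota> r" for i \<omega>
      using that by (auto simp: fun_eq_iff hol_ring_def restrict_def split: if_splits)
    have y_ext: "y i \<in> extensional (Omega \<iota> r)" for i
      using mem_upD[OF y_up, of i] by (simp add: hol_ring_def holomorphic_functions_def)
    show "y = enc (\<lambda>\<omega>. - 1)"
    proof (intro ext)
      fix i \<omega>
      show "y i \<omega> = enc (\<lambda>\<omega>. - 1) i \<omega>"
        using sum0[of \<omega> i] y_ext[of i]
        by (cases "\<omega> \<in> Omega \<iota> r") (auto simp: enc_def extensional_def add_eq_0_iff)
    qed
  qed
  then have "enc F \<ominus>\<^bsub>UP ?R\<^esub> \<one>\<^bsub>UP ?R\<^esub> = enc F \<oplus>\<^bsub>UP ?R\<^esub> enc (\<lambda>\<omega>. - 1)"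
    by (simp add: a_minus_def enc_one)
  also have "\<dots> = enc (\<lambda>\<omega>. F \<omega> - 1)"
    unfolding add[OF up(3,2)] by (auto simp: enc_def fun_eq_iff restrict_def)
  finally show ?thesis .
qed

text \<open>Divisibility at every point kills the lower coefficients as functions, while a
  coefficient is nonzero in the ring as soon as it is nonzero at one point;
  \<open>Omega_nonempty\<close> supplies that point.\<close>

lemma order_at_0_enc:
  assumes F: "bhol_poly F"
    and eq: "\<And>\<omega>. \<omega> \<in> Omega \<iota> r \<Longrightarrow> \<exists>U. F \<omega> = Polynomial.monom 1 t * U \<and> Polynomial.coeff U 0 \<noteq> 0"
  shows "order_at_0 (hol_ring \<iota> r) (enc F) = enat t"
proof -
  have coeff: "Polynomial.coeff (F \<omega>) n = 0" if "\<omega> \<in> Omega \<iota> r" "n < t" for \<omega> n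
    using eq[OF that(1)] that(2) by (auto simp: coeff_monom_mult)
  have coeff_t: "Polynomial.coeff (F \<omega>) t \<noteq> 0" if "\<omega> \<in> Omega \<iota> r" for \<omega>
    using eq[OF that] by (auto simp: coeff_monom_mult)
  obtain \<omega>0 where \<omega>0: "\<omega>0 \<in> Omega \<iota> r"
    using Omega_nonempty[OF r_ge_2] by blast
  define N where "N = {n. up_ring.coeff (UP (hol_ring \<iota> r)) (enc F) n \<noteq> \<zero>\<^bsub>hol_ring \<iota> r\<^esub>}"
  have N: "n \<in> N \<longleftrightarrow> enc F n \<noteq> (\<lambda>\<omega>\<in>Omega \<iota> r. 0)" for n
    using enc_in_up[OF F] by (simp add: N_def UP_def hol_ring_def)
  have "enc F t \<omega>0 \<noteq> (\<lambda>\<omega>\<in>Omega \<iota> r. 0) \<omega>0"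
    using coeff_t[OF \<omega>0] \<omega>0 by (simp add: enc_def)
  then have "t \<in> N"
    unfolding N by metis
  moreover have "t \<le> n" if "n \<in> N" for n
  proof (rule ccontr)
    assume "\<not> t \<le> n"
    then have "enc F n = (\<lambda>\<omega>\<in>Omega \<iota> r. 0)"
      using coeff by (auto simp: enc_def restrict_def)
    then show False
      using that N by blast
  qed
  ultimately have "(INF n\<in>N. enat n) = enat t"
    by (intro antisym INF_lower INF_greatest) auto
  then show ?thesis
    by (simp add: order_at_0_def N_def)
qed

section \<open>The product over the monic quadratics\<close>

lemma bhol_poly_phiT: "bhol_poly phiT"
proof -
  have "bhol_poly (\<lambda>\<omega>. phiT \<omega>)"
    unfolding phiT_def
    by (intro bhol_poly_smult bhol_poly_mult bhol_poly_prod bhol_poly_linear bhol_uminus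
        bhol_inverse_expL_mu bhol_const bhol_poly_const) auto
  then show ?thesis .
qed

text \<open>The leading coefficient is \<open>T\<close> times the product of the negated inverse
  torsion points, so its inverse is again a polynomial expression, now in the torsion points
  themselves.\<close>

lemma bhol_inverse_lead_coeff_phiT: "bhol (\<lambda>\<omega>. inverse (lead_coeff (phiT \<omega>)))"
proof -
  have "inverse (lead_coeff (phiT \<omega>)) = inverse T * (\<Prod>c\<in>tuples 1 - {ztup}. - expL \<omega> (mu \<omega> c))"
    if "\<omega> \<in> Omega \<iota> r" for \<omega>
  proof -
    have "lead_coeff (phiT \<omega>)
        = T * (\<Prod>c\<in>tuples 1 - {ztup}. lead_coeff [:1, - inverse (expL \<omega> (mu \<omega> c)):])"
      by (simp add: phiT_def lead_coeff_mult lead_coeff_prod)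
    also have "(\<Prod>c\<in>tuples 1 - {ztup}. lead_coeff [:1, - inverse (expL \<omega> (mu \<omega> c)):])
        = (\<Prod>c\<in>tuples 1 - {ztup}. - inverse (expL \<omega> (mu \<omega> c)))"
      using expL_mu_nonzero[OF that] by (intro prod.cong) auto
    finally show ?thesis
      by (simp flip: prod_inversef)
  qed
  moreover have "bhol (\<lambda>\<omega>. inverse T * (\<Prod>c\<in>tuples 1 - {ztup}. - expL \<omega> (mu \<omega> c)))"
    by (intro bhol_mult bhol_const bhol_prod bhol_uminus bhol_expL_mu) auto
  ultimately show ?thesis
    using bhol_cong[of "\<lambda>\<omega>. inverse (lead_coeff (phiT \<omega>))"] by simp
qed

lemma phi'_quadratic:
  assumes "\<omega> \<in> Omega \<iota> r"
  shows "phi' \<iota> r \<omega> [:c, b, 1:]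
    = pcompose (phiT \<omega>) (phiT \<omega>) + Polynomial.smult (\<kappa> b) (phiT \<omega>) + [:0, \<kappa> c:]"
proof -
  let ?\<phi> = "phi' \<iota> r \<omega>"
  have add: "?\<phi> (a + a') = ?\<phi> a + ?\<phi> a'" and mult: "?\<phi> (a * a') = pcompose (?\<phi> a) (?\<phi> a')"
    and const: "?\<phi> [:u:] = [:0, A_emb \<iota> [:u:]:]" for a a' u
    using phi'_spec(1)[OF assms] unfolding drinfeld_module_def by blast+
  have "[:c, b, 1:] = [:0, 1:] * [:0, 1:] + [:b:] * [:0, 1:] + [:c:]"
    by simp
  then have "?\<phi> [:c, b, 1:] = ?\<phi> ([:0, 1:] * [:0, 1:]) + ?\<phi> ([:b:] * [:0, 1:]) + ?\<phi> [:c:]"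
    by (simp only: add)
  then show ?thesis
    unfolding mult const phi'_spec(2)[OF assms] by (simp add: pcompose_pCons)
qed

text \<open>With \<open>Q = q^(r-1)\<close> the exponent is
  \<open>(Q^2 - 1) / (Q - 1) = Q + 1\<close>, the power of the leading coefficient that occurs in
  \<open>phiT \<omega>\<close> composed with itself.\<close>

lemma Delta'_deg_2:
  assumes "\<omega> \<in> Omega \<iota> r"
  shows "Delta'_deg \<iota> r 2 \<omega> = lead_coeff (phiT \<omega>) ^ (CARD('f) ^ (r - 1) + 1)"
proof -
  define Q where "Q = CARD('f) ^ (r - 1)"
  have "Q > 1"
    unfolding Q_def using card_finite_field_ge_2[where ?'f = 'f] r_ge_2
    by (intro one_less_power) auto
  have "CARD('f) ^ ((r - 1) * 2) = Q * Q"
    by (simp only: Q_def power_mult power2_eq_square)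
  then have eq: "CARD('f) ^ ((r - 1) * 2) - 1 = (Q + 1) * (Q - 1)"
    by (simp add: algebra_simps)
  have "(CARD('f) ^ ((r - 1) * 2) - 1) div (Q - 1) = Q + 1"
    unfolding eq using \<open>Q > 1\<close> by (intro nonzero_mult_div_cancel_right) simp
  then show ?thesis
    by (simp add: Delta'_deg_def Delta'_def phi'_spec(2)[OF assms] degree_phiT[OF assms] Q_def)
qed

lemma Pi_poly_2:
  defines "q \<equiv> CARD('f)"
  defines "t \<equiv> (q - 1) * q * (q ^ (2 * (r - 1)) - q ^ (r - 1))"
  shows "Pi_poly \<iota> r 2 \<in> carrier (UP (hol_ring \<iota> r))"
    and "order_at_0 (hol_ring \<iota> r)
      (Pi_poly \<iota> r 2 \<ominus>\<^bsub>UP (hol_ring \<iota> r)\<^esub> \<one>\<^bsub>UP (hol_ring \<iota> r)\<^esub>) = enat t"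
proof -
  define s where "s = r - 1"
  define N where "N = q ^ (2 * s)"
  define M where "M = {a :: 'f poly. lead_coeff a = 1 \<and> degree a = 2}"
  define D where "D \<omega> = lead_coeff (phiT \<omega>) ^ (q ^ s + 1)" for \<omega>
  \<comment> \<open>The pointwise form of \<open>S_a\<close>, with \<open>D \<omega>\<close> in
    place of \<open>Delta'_deg\<close> so that its inverse is visibly a power of a holomorphic
    function.\<close>
  define F where "F a \<omega> = Polynomial.smult (1 / D \<omega>) (rev_poly N (phi' \<iota> r \<omega> a))" for a \<omega>
  have M: "M = (\<lambda>(b, c). [:c, b, 1:]) ` UNIV"
  proof (intro equalityI subsetI)
    fix a assume "a \<in> M"
    then have "a = [:Polynomial.coeff a 0, Polynomial.coeff a 1, 1:]"
      by (auto simp: M_def poly_eq_iff coeff_pCons coeff_eq_0 numeral_2_eq_2 split: nat.splits)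
    then show "a \<in> (\<lambda>(b, c). [:c, b, 1:]) ` UNIV"
      by (intro image_eqI[of _ _ "(Polynomial.coeff a 1, Polynomial.coeff a 0)"]) auto
  qed (auto simp: M_def)
  have inj: "inj (\<lambda>(b, c). [:c, b, 1 :: 'f:])"
    by (auto simp: inj_on_def)
  have finM: "finite M"
    unfolding M by simp
  have bhol: "bhol_poly (F a)" if a_M: "a \<in> M" for a
  proof -
    obtain b c where a: "a = [:c, b, 1:]"
      using a_M unfolding M by auto
    have "bhol_poly (\<lambda>\<omega>. phi' \<iota> r \<omega> a)"
      unfolding a
      by (rule bhol_poly_cong[OF phi'_quadratic, THEN iffD2], assumption)
        (intro bhol_poly_add bhol_poly_pcompose bhol_poly_phiT bhol_poly_smult bhol_const
          bhol_poly_const)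
    moreover have "bhol (\<lambda>\<omega>. inverse (lead_coeff (phiT \<omega>)) ^ (q ^ s + 1))"
      by (intro bhol_power bhol_inverse_lead_coeff_phiT)
    then have "bhol (\<lambda>\<omega>. 1 / D \<omega>)"
      by (simp add: D_def divide_inverse power_inverse del: power_Suc)
    ultimately show ?thesis
      unfolding F_def[abs_def] by (intro bhol_poly_smult bhol_poly_rev_poly)
  qed
  have S: "S_poly \<iota> r a = enc (F a)" if "a \<in> M" for a
  proof -
    have "degree a = 2"
      using that by (simp add: M_def)
    then show ?thesis
      by (auto simp: S_poly_def enc_def F_def coeff_rev_poly fun_eq_iff Let_def Delta'_deg_2
          D_def N_def q_def s_def mult.commute restrict_def)
  qed
  define P where "P \<omega> = (\<Prod>a\<in>M. F a \<omega>)" for \<omega>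
  have Pi: "Pi_poly \<iota> r 2 = enc P"
    unfolding Pi_poly_def P_def[abs_def] M_def[symmetric] by (rule finprod_enc[OF finM S bhol])
  have bholP: "bhol_poly P"
    unfolding P_def[abs_def] by (intro bhol_poly_prod bhol)
  show "Pi_poly \<iota> r 2 \<in> carrier (UP (hol_ring \<iota> r))"
    using enc_in_up[OF bholP] by (simp add: Pi UP_def)
  have "order_at_0 (hol_ring \<iota> r) (enc (\<lambda>\<omega>. P \<omega> - 1)) = enat t"
  proof (rule order_at_0_enc)
    show "bhol_poly (\<lambda>\<omega>. P \<omega> - 1)"
      using bhol_poly_add[OF bholP bhol_poly_const[of "- 1"]] by simp
    fix \<omega> assume \<omega>: "\<omega> \<in> Omega \<iota> r"
    \<comment> \<open>Monic quadratics correspond to pairs \<open>(b, c)\<close>, which gives the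
      double product of \<open>prod_rev_poly_order\<close>.\<close>
    have "P \<omega> = (\<Prod>b\<in>UNIV. \<Prod>c\<in>UNIV. F [:c, b, 1:] \<omega>)"
      unfolding P_def M prod.reindex[OF inj]
      by (simp add: prod.cartesian_product case_prod_beta)
    also have "\<dots> = (\<Prod>b\<in>UNIV. \<Prod>c\<in>UNIV. Polynomial.smult (1 / D \<omega>)
        (rev_poly N (pcompose (phiT \<omega>) (phiT \<omega>) + Polynomial.smult (\<kappa> b) (phiT \<omega>) + [:0, \<kappa> c:])))"
      by (simp add: F_def phi'_quadratic[OF \<omega>])
    finally have "P \<omega> = \<dots>" .
    moreover have "s > 0"
      using r_ge_2 by (simp add: s_def)
    ultimately show "\<exists>U. P \<omega> - 1 = Polynomial.monom 1 t * U \<and> Polynomial.coeff U 0 \<noteq> 0"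
      using prod_rev_poly_order[of "phiT \<omega>" s] q_poly_phiT[OF \<omega>] degree_phiT[OF \<omega>]
      by (simp add: D_def N_def t_def q_def s_def)
  qed
  then show "order_at_0 (hol_ring \<iota> r)
      (Pi_poly \<iota> r 2 \<ominus>\<^bsub>UP (hol_ring \<iota> r)\<^esub> \<one>\<^bsub>UP (hol_ring \<iota> r)\<^esub>) = enat t"
    by (simp add: Pi enc_minus_one[OF bholP])
qed

end

text \<open>\<open>finprod\<close> and the coefficient map of \<open>UP\<close> are total functions;
  membership in the carrier certifies that the order is that of a genuine element of
  \<open>O'[X]\<close>.\<close>

theorem proposition4p3:
  fixes \<iota> :: "'f::{field,finite} fls \<Rightarrow> 'c::{field,complete_space}"
    and r q :: nat
  assumes "completed_alg_closure \<iota>"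
    and "r \<ge> 3"
    and "q = CARD('f)"
  shows "Pi_poly \<iota> r 2 \<in> carrier (UP (hol_ring \<iota> r)) \<and>
         order_at_0 (hol_ring \<iota> r)
           (Pi_poly \<iota> r 2 \<ominus>\<^bsub>UP (hol_ring \<iota> r)\<^esub> \<one>\<^bsub>UP (hol_ring \<iota> r)\<^esub>)
         = enat ((q - 1) * q * (q ^ (2 * (r - 1)) - q ^ (r - 1))) \<and>
         (q - 1) * q * (q ^ (2 * (r - 1)) - q ^ (r - 1)) = (q - 1) * (q ^ (2 * r - 1) - q ^ r)"
proof -
  interpret completed_alg_closure \<iota>
    by (rule assms(1))
  interpret lattice_setting \<iota> r
    by standard (use assms(2) in simp)
  \<comment> \<open>With \<open>r = k + 1\<close> the factor \<open>q\<close> is absorbed as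
    \<open>q (q^(2k) - q^k) = q^(2k+1) - q^(k+1)\<close>, without subtraction in the
    exponents.\<close>
  obtain k where k: "r = Suc k"
    using assms(2) by (cases r) auto
  have "(q - 1) * q * (q ^ (2 * (r - 1)) - q ^ (r - 1)) = (q - 1) * (q ^ (2 * r - 1) - q ^ r)"
    by (simp add: k mult.assoc diff_mult_distrib2)
  then show ?thesis
    using Pi_poly_2 assms(3) by simp
qed

end
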